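(* Let $b$ be a prime, let $\alpha,\alpha'>1/2$ be real and let $\boldsymbol{\gamma}=(\gamma_u)_u$, $\boldsymbol{\gamma}'=(\gamma'_u)_u$ be families of non-negative real weights. For $s,m\in\mathbb{N}$ let $p\in\mathbb{F}_b[x]$ be irreducible with $\deg(p)=m$ and let $\boldsymbol{q}\in(G_m\setminus\{0\})^s$ be a vector constructed by the component-by-component (CBC) algorithm for polynomial lattice rules based on the criterion $P_{\alpha,\boldsymbol{\gamma},b^m}$. Then the following holds. 1. (General weights.) Assume that there exist $\lambda,\delta,q,q'\ge0$ such that $1/(2\alpha)<\lambda<1$, $0<\delta<\alpha'/(\alpha\lambda)$, $$\sup_{s\in\mathbb{N}}\frac1{s^q}\sum_{\emptyset\ne u\subseteq\{1,\ldots,s\}}\gamma_u^\lambda\left(\frac{b-1}{b^{2\alpha\lambda}-b}\right)^{|u|}<\infty$$ and $$\sup_{s,m\in\mathbb{N}}\frac1{s^{q'}b^{\delta m}}\sum_{\emptyset\ne u\subseteq\{1,\ldots,s\}}\frac{\gamma'_u}{\gamma_u^{\alpha'/\alpha}}\left(\frac{b^{2\alpha'-1}(b-1)}{b^{2\alpha'-1}-1}\right)^{|u|}(m+1)^{|u|-1}<\infty.$$ Then $P_{\alpha',\boldsymbol{\gamma}',b^m}(\boldsymbol{q})$ depends only polynomially on $s$: there is a constant $C>0$ independent of $s$ and $m$ such that $$P_{\alpha',\boldsymbol{\gamma}',b^m}(\boldsymbol{q})\le C\,s^{q\alpha'/(\alpha\lambda)+q'}\,b^{-(\alpha'/(\alpha\lambda)-\delta)m}.$$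 If there exist $\lambda,\delta$ with $1/(2\alpha)<\lambda<1$ and $0<\delta<\alpha'/(\alpha\lambda)$ such that $$\sup_{s\in\mathbb{N}}\sum_{\emptyset\ne u\subseteq\{1,\ldots,s\}}\gamma_u^\lambda\left(\frac{b-1}{b^{2\alpha\lambda}-b}\right)^{|u|}<\infty\quad\text{and}\quad\sup_{s,m\in\mathbb{N}}\frac1{b^{\delta m}}\sum_{\emptyset\ne u\subseteq\{1,\ldots,s\}}\frac{\gamma'_u}{\gamma_u^{\alpha'/\alpha}}\left(\frac{b^{2\alpha'-1}(b-1)}{b^{2\alpha'-1}-1}\right)^{|u|}(m+1)^{|u|-1}<\infty$$ (the case $q=q'=0$), then $P_{\alpha',\boldsymbol{\gamma}',b^m}(\boldsymbol{q})$ is bounded independently of $s$. 2. (Product weights.) Suppose $\boldsymbol{\gamma}$ and $\boldsymbol{\gamma}'$ are product weights, $\gamma_u=\prod_{j\in u}\gamma_j$ and $\gamma'_u=\prod_{j\in u}\gamma'_j$ with $\gamma_j,\gamma'_j\ge0$, and that there exists $\lambda\in(1/(2\alpha),1]$ such that $$\sum_{j=1}^\infty\gamma_j^\lambda<\infty\quad\text{and}\quad\sum_{j=1}^\infty\frac{\gamma'_j}{\gamma_j^{\alpha'/\alpha}}<\infty.$$ Then for arbitrarily small $\delta>0$ there is a constant $C>0$ (which may depend on $\delta$) independent of $s$ and $m$ such that $$P_{\alpha',\boldsymbol{\gamma}',b^m}(\boldsymbol{q})\le C\,b^{-(\alpha'/(\alpha\lambda)-\delta)m}.$$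
   Context: $\mathbb{N}$ is the set of positive integers; $\mathbb{F}_b$ is the field with $b$ elements, identified with $\{0,\ldots,b-1\}$; $G_m=\{g\in\mathbb{F}_b[x]:\deg(g)<m\}$ (including $0$). Weights are families $\boldsymbol{\gamma}=(\gamma_u)$ of non-negative reals indexed by the finite non-empty subsets $u\subset\mathbb{N}$. For an integer $k\ge0$ with $b$-adic expansion $k=\kappa_0+\kappa_1b+\cdots$ let $\mathrm{tr}_m(k)=\kappa_0+\kappa_1x+\cdots+\kappa_{m-1}x^{m-1}\in G_m$. For $k=\kappa_0+\cdots+\kappa_{a-1}b^{a-1}\in\mathbb{N}$ with $\kappa_{a-1}\ne0$ let $\mu(k)=a$; for $\boldsymbol{k}_u=(k_j)_{j\in u}\in\mathbb{N}^{|u|}$ let $\mu(\boldsymbol{k}_u)=\sum_{j\in u}\mu(k_j)$. For non-empty $u\subseteq\{1,\ldots,s\}$ let $$P_u^\perp(p,\boldsymbol{q})=\Bigl\{\boldsymbol{k}_u\in\mathbb{N}^{|u|}:\sum_{j\in u}\mathrm{tr}_m(k_j)\,q_j\equiv0 \pmod p\Bigr\},$$ and define (with $p$ suppressed in the notation) $$P_{\alpha,\boldsymbol{\gamma},b^m}(\boldsymbol{q})=\sum_{\emptyset\ne u\subseteq\{1,\ldots,s\}}\ \sum_{\boldsymbol{k}_u\in P_u^\perp(p,\boldsymbol{q})}\gamma_u\,b^{-2\alpha\mu(\boldsymbol{k}_u)}.$$ The same definition is used for vectors of any length $\ell$ (with $s$ replaced by $\ell$). ($P_{\alpha,\boldsymbol{\gamma},b^m}(\boldsymbol{q})$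 is the squared worst-case error of the polynomial lattice rule with modulus $p$ and generating vector $\boldsymbol{q}$ in the weighted Walsh space with smoothness $\alpha$ and weights $\boldsymbol{\gamma}$.) CBC algorithm for polynomial lattice rules (with modulus $p$) based on $P_{\alpha,\boldsymbol{\gamma},b^m}$: set $q^*_1=1\in\mathbb{F}_b[x]$; for $\ell=1,\ldots,s-1$ successively, with $q^*_1,\ldots,q^*_\ell$ kept fixed, let $q^*_{\ell+1}$ be a minimizer of $P_{\alpha,\boldsymbol{\gamma},b^m}(q^*_1,\ldots,q^*_\ell,q_{\ell+1})$ over $q_{\ell+1}\in G_m\setminus\{0\}$. The output is $\boldsymbol{q}=(q^*_1,\ldots,q^*_s)$. Convention: $0/0=0$, and $c/0=+\infty$ for $c>0$, in the ratios of weights. *)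

theory Defs
  imports "HOL-Analysis.Analysis" "Berlekamp_Zassenhaus.Finite_Field"
begin

text \<open>
  The field with \<open>b\<close> elements, \<open>b\<close> prime, is \<open>'b mod_ring\<close> with \<open>'b :: prime_card\<close> and
  \<open>b = CARD('b)\<close>. The identification of \<open>{0, ..., b - 1}\<close> with the field is \<open>of_nat\<close>.
  Positive integers are natural numbers \<open>\<ge> 1\<close>, so vectors of length \<open>l\<close> are indexed by \<open>{1..l}\<close>
  and weights are only ever looked at on finite non-empty sets \<open>u\<close> with \<open>0 \<notin> u\<close>.
\<close>

definition index_set :: "nat set \<Rightarrow> bool" where
  "index_set u \<longleftrightarrow> finite u \<and> u \<noteq> {} \<and> 0 \<notin> u"

definition weights :: "(nat set \<Rightarrow> real) \<Rightarrow> bool" where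
  "weights \<gamma> \<longleftrightarrow> (\<forall>u. index_set u \<longrightarrow> \<gamma> u \<ge> 0)"

definition product_weights :: "(nat set \<Rightarrow> real) \<Rightarrow> (nat \<Rightarrow> real) \<Rightarrow> bool" where
  "product_weights \<gamma> g \<longleftrightarrow>
     (\<forall>j\<ge>1. g j \<ge> 0) \<and> (\<forall>u. index_set u \<longrightarrow> \<gamma> u = (\<Prod>j\<in>u. g j))"

definition nonempty_subsets :: "nat \<Rightarrow> nat set set" where
  "nonempty_subsets s = Pow {1..s} - {{}}"

definition digit :: "nat \<Rightarrow> nat \<Rightarrow> nat \<Rightarrow> nat" where
  "digit b k i = k div b ^ i mod b"

text \<open>For \<open>b \<ge> 2\<close> and \<open>k \<ge> 1\<close> the set below is finite and non-empty, and its maximum is the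
  position of the leading digit (positions start at \<open>0\<close>).\<close>

definition mu :: "nat \<Rightarrow> nat \<Rightarrow> nat" where
  "mu b k = Suc (Max {i. digit b k i \<noteq> 0})"

definition mu_vec :: "nat \<Rightarrow> nat set \<Rightarrow> (nat \<Rightarrow> nat) \<Rightarrow> nat" where
  "mu_vec b u k = (\<Sum>j\<in>u. mu b (k j))"

definition polys_below :: "nat \<Rightarrow> 'b::prime_card mod_ring poly set" where
  "polys_below m = {g. g = 0 \<or> Polynomial.degree g < m}"

definition trunc_poly :: "nat \<Rightarrow> nat \<Rightarrow> 'b::prime_card mod_ring poly" where
  "trunc_poly m k = (\<Sum>i<m. Polynomial.monom (of_nat (digit CARD('b) k i)) i)"

text \<open>The elements of \<open>\<nat>\<^sup>u\<close> are the extensional functions in \<open>u \<rightarrow>\<^sub>E {1..}\<close>,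
  so that each vector is counted exactly once.\<close>

definition dual_net ::
  "nat \<Rightarrow> 'b::prime_card mod_ring poly \<Rightarrow> (nat \<Rightarrow> 'b mod_ring poly) \<Rightarrow> nat set \<Rightarrow> (nat \<Rightarrow> nat) set"
  where
  "dual_net m p q u =
     {k \<in> u \<rightarrow>\<^sub>E {1..}. [(\<Sum>j\<in>u. trunc_poly m (k j) * q j) = 0] (mod p)}"

text \<open>Only \<open>q 1, ..., q l\<close> matter. The inner series has non-negative terms and converges for
  \<open>\<alpha> > 1/2\<close>, the only case in which it is used.\<close>

definition wce_sq ::
  "real \<Rightarrow> (nat set \<Rightarrow> real) \<Rightarrow> nat \<Rightarrow> 'b::prime_card mod_ring poly \<Rightarrow>
     nat \<Rightarrow> (nat \<Rightarrow> 'b mod_ring poly) \<Rightarrow> real"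
  where
  "wce_sq \<alpha> \<gamma> m p l q =
     (\<Sum>u\<in>nonempty_subsets l. \<Sum>\<^sub>\<infinity>k\<in>dual_net m p q u.
        \<gamma> u * real CARD('b) powr (- 2 * \<alpha> * real (mu_vec CARD('b) u k)))"

text \<open>Minimizers need not be unique, hence a predicate: \<open>q\<close> is a possible output of the
  component-by-component algorithm.\<close>

definition cbc_output ::
  "real \<Rightarrow> (nat set \<Rightarrow> real) \<Rightarrow> nat \<Rightarrow> 'b::prime_card mod_ring poly \<Rightarrow>
     nat \<Rightarrow> (nat \<Rightarrow> 'b mod_ring poly) \<Rightarrow> bool"
  where
  "cbc_output \<alpha> \<gamma> m p s q \<longleftrightarrow>
     q \<in> {1..s} \<rightarrow>\<^sub>E polys_below m - {0} \<and> q 1 = 1 \<and>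
     (\<forall>l\<in>{1..<s}.
        is_arg_min (\<lambda>g. wce_sq \<alpha> \<gamma> m p (l + 1) (q(l + 1 := g)))
          (\<lambda>g. g \<in> polys_below m - {0}) (q (l + 1)))"

definition weight_sum :: "nat \<Rightarrow> real \<Rightarrow> real \<Rightarrow> (nat set \<Rightarrow> real) \<Rightarrow> nat \<Rightarrow> real" where
  "weight_sum b \<alpha> lam \<gamma> s =
     (\<Sum>u\<in>nonempty_subsets s.
        \<gamma> u powr lam * ((real b - 1) / (real b powr (2 * \<alpha> * lam) - real b)) ^ card u)"

text \<open>Ratios of weights are taken in \<open>ennreal\<close>, whose division satisfies the conventions
  \<open>0/0 = 0\<close> and \<open>c/0 = \<infinity>\<close> for \<open>c > 0\<close>.\<close>

lemma ennreal_ratio_conventions: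
  shows "(0::ennreal) / 0 = 0" and "\<And>c::ennreal. c > 0 \<Longrightarrow> c / 0 = \<infinity>"
  by (auto simp: divide_ennreal_def ennreal_mult_top)

definition weight_ratio :: "real \<Rightarrow> real \<Rightarrow> real \<Rightarrow> real \<Rightarrow> ennreal" where
  "weight_ratio \<alpha> \<alpha>' x x' = ennreal x' / ennreal (x powr (\<alpha>' / \<alpha>))"

definition ratio_sum ::
  "nat \<Rightarrow> real \<Rightarrow> real \<Rightarrow> (nat set \<Rightarrow> real) \<Rightarrow> (nat set \<Rightarrow> real) \<Rightarrow> nat \<Rightarrow> nat \<Rightarrow> ennreal" where
  "ratio_sum b \<alpha> \<alpha>' \<gamma> \<gamma>' s m =
     (\<Sum>u\<in>nonempty_subsets s.
        weight_ratio \<alpha> \<alpha>' (\<gamma> u) (\<gamma>' u) *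
        ennreal ((real b powr (2 * \<alpha>' - 1) * (real b - 1) / (real b powr (2 * \<alpha>' - 1) - 1)) ^ card u
          * real (m + 1) ^ (card u - 1)))"

end

theory Submission
  imports Defs "HOL-Real_Asymp.Real_Asymp"
begin

text \<open>
  Averaging over the last component and Jensen's inequality give the usual bound
  \<open>P(\<alpha>, \<gamma>) ^ \<lambda> \<le> weight_sum / (b ^ m - 1)\<close> for the CBC vector.

  To change \<open>(\<alpha>, \<gamma>)\<close> to \<open>(\<alpha>', \<gamma>')\<close>, let \<open>\<rho>\<close> be the minimum of \<open>\<mu>\<close> on the dual net of \<open>u\<close> and put
  \<open>n = |u|\<close>. A single term gives \<open>\<gamma> u * b ^ (- 2 \<alpha> \<rho>) \<le> P(\<alpha>, \<gamma>)\<close>, so it suffices to bound the sum of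
  \<open>b ^ (- 2 \<alpha>' \<mu> k)\<close> over the dual net by a constant times \<open>c ^ n (m + 1) ^ (n - 1) b ^ (- 2 \<alpha>' \<rho>)\<close>.
  The number of dual \<open>k\<close> with \<open>\<mu> (k j) = a j\<close> for all \<open>j\<close> may exceed \<open>(b - 1) ^ n b ^ (|a| - \<rho>)\<close>,
  because differences of dual vectors can have zero components and then say nothing about \<open>\<rho>\<close>
  (for \<open>b = 2\<close>, \<open>q = (1, 1, 1)\<close>, \<open>m \<ge> 2\<close> and \<open>a = (2, 2, 1)\<close> there are two of them, but \<open>\<rho> = |a|\<close>).
  The module structure of the dual lattice still gives at most \<open>b ^ n n ^ (n / 2) b ^ (|a| - \<rho>)\<close>. This loss is
  harmless: the number of compositions of \<open>\<rho> \<le> m + n\<close> is smaller than \<open>(m + 1) ^ (n - 1)\<close> by a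
  factor of roughly \<open>n ^ n\<close>, unless \<open>n\<close> is so large compared to \<open>m\<close> that the sum over all \<open>k\<close>
  is already small enough.
\<close>

section \<open>Minimal boxes in polynomial modules\<close>

text \<open>The factor \<open>b ^ n * n ^ (n / 2)\<close> arises as follows. A level is compared
  with the box around a shortest dual vector \<open>k\<close> having no zero component. Minimality
  of \<open>k\<close> is exploited not through differences but through sums of \<open>k\<close> and
  polynomial multiples of other lattice vectors: such a sum may lose a leading coefficient only if
  it also acquires a zero component. Shrinking all sides of the box by 1 repeatedly gives at each
  depth \<open>t\<close> a linear code of length \<open>n\<close> formed by leading coefficients.
  For \<open>t \<ge> 1\<close> a code of dimension above \<open>n / 2\<close> would leave enough
  freedom to repair all zero components, and a nonzero vector at a depth \<open>T\<close> with
  \<open>b ^ T > n\<close> would have more multiples than there are components to vanish. So about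
  \<open>log_b n\<close> depths contribute at most \<open>b ^ (n / 2)\<close> each. The exponents of
  the final bounds come from two powers: the single-term inequality is raised to \<alpha>'/\<alpha>,
  and the estimate of \<open>P powr \<lambda>\<close> to \<alpha>'/(\<alpha>\<lambda>). For product
  weights \<delta> can be arbitrary because a product of factors \<open>1 + t * \<rho> j\<close>
  with summable \<rho> grows subexponentially in \<open>t\<close>.\<close>

lemma card_le_card_image_times:
  assumes "finite G" and "\<And>y. y \<in> f ` G \<Longrightarrow> card {x \<in> G. f x = y} \<le> K"
  shows "card G \<le> card (f ` G) * K"
proof -
  have "card G = (\<Sum>x\<in>G. 1)" by simp
  also have "\<dots> = (\<Sum>y\<in>f ` G. \<Sum>x\<in>{x \<in> G. f x = y}. 1)"
    by (rule sum.image_gen[OF assms(1)])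
  also have "\<dots> \<le> (\<Sum>y\<in>f ` G. K)"
    by (rule sum_mono) (use assms(2) in simp)
  finally show ?thesis by simp
qed

lemma bij_betw_coeffs:
  "bij_betw (\<lambda>q. restrict (Polynomial.coeff q) {..<n})
     {q :: 'a::zero poly. \<forall>i\<ge>n. Polynomial.coeff q i = 0} ({..<n} \<rightarrow>\<^sub>E UNIV)"
proof (intro bij_betwI[where g = "\<lambda>c. Abs_poly (\<lambda>i. if i < n then c i else 0)"])
  have *: "Polynomial.coeff (Abs_poly (\<lambda>i. if i < n then c i else 0)) =
      (\<lambda>i. if i < n then c i else 0)" for c :: "nat \<Rightarrow> 'a"
    by (intro coeff_Abs_poly[of n]) auto
  show "(\<lambda>c. Abs_poly (\<lambda>i. if i < n then c i else 0))
      \<in> ({..<n} \<rightarrow>\<^sub>E UNIV) \<rightarrow> {q :: 'a poly. \<forall>i\<ge>n. Polynomial.coeff q i = 0}"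
    by (auto simp: *)
  show "Abs_poly (\<lambda>i. if i < n then restrict (Polynomial.coeff x) {..<n} i else 0) = x"
    if "x \<in> {q :: 'a poly. \<forall>i\<ge>n. Polynomial.coeff q i = 0}" for x
    using that by (intro poly_eqI) (auto simp: *)
  show "restrict (Polynomial.coeff (Abs_poly (\<lambda>i. if i < n then y i else 0))) {..<n} = y"
    if "y \<in> {..<n} \<rightarrow>\<^sub>E UNIV" for y :: "nat \<Rightarrow> 'a"
    using that by (auto simp: * PiE_def extensional_def)
qed auto

lemma finite_card_polys_coeff_below:
  fixes n :: nat
  defines "P \<equiv> {q :: 'a::{zero,finite} poly. \<forall>i\<ge>n. Polynomial.coeff q i = 0}"
  shows "finite P" and "card P = CARD('a) ^ n"
  using bij_betw_finite[OF bij_betw_coeffs[of n, where 'a='a]]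
    bij_betw_same_card[OF bij_betw_coeffs[of n, where 'a='a]]
  by (auto simp: P_def card_funcsetE finite_PiE)

text \<open>Abstracts the dual lattice. Closure under multiplication by arbitrary polynomials, and
  not only by scalars, is what carries the counting argument.\<close>

locale poly_module =
  fixes u :: "'i set" and L :: "('i \<Rightarrow> 'a::{field,finite} poly) set"
  assumes finite_u: "finite u"
    and supp: "h \<in> L \<Longrightarrow> j \<notin> u \<Longrightarrow> h j = 0"
    and add: "g \<in> L \<Longrightarrow> h \<in> L \<Longrightarrow> (\<lambda>j. g j + h j) \<in> L"
    and mult: "h \<in> L \<Longrightarrow> (\<lambda>j. q * h j) \<in> L"
begin

text \<open>Coefficients are constrained instead of degrees so that a side of length 0 forces the
  component to vanish; the zero polynomial has degree 0, so a degree bound could not express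
  this.\<close>

definition degree_box :: "('i \<Rightarrow> nat) \<Rightarrow> ('i \<Rightarrow> 'a poly) set" where
  "degree_box a = {h \<in> L. \<forall>j\<in>u. \<forall>i\<ge>a j. Polynomial.coeff (h j) i = 0}"

lemma degree_box_coeff: "h \<in> degree_box a \<Longrightarrow> j \<in> u \<Longrightarrow> i \<ge> a j \<Longrightarrow> Polynomial.coeff (h j) i = 0"
  by (simp add: degree_box_def)

lemma degree_box_add: "g \<in> degree_box a \<Longrightarrow> h \<in> degree_box a \<Longrightarrow> (\<lambda>j. g j + h j) \<in> degree_box a"
  by (simp add: degree_box_def add)

lemma degree_box_smult: "h \<in> degree_box a \<Longrightarrow> (\<lambda>j. Polynomial.smult c (h j)) \<in> degree_box a"
  using mult[of h "[:c:]"] by (simp add: degree_box_def)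

lemma degree_box_diff: "g \<in> degree_box a \<Longrightarrow> h \<in> degree_box a \<Longrightarrow> (\<lambda>j. g j - h j) \<in> degree_box a"
  using degree_box_add[OF _ degree_box_smult[of h a "-1"]] by simp

lemma degree_box_mono: "(\<And>j. j \<in> u \<Longrightarrow> a' j \<le> a j) \<Longrightarrow> degree_box a' \<subseteq> degree_box a"
  by (force simp: degree_box_def)

lemma degree_box_mult:
  assumes "h \<in> degree_box (\<lambda>j. a j - t)" and "\<And>i. i > t \<Longrightarrow> Polynomial.coeff q i = 0"
  shows "(\<lambda>j. q * h j) \<in> degree_box a"
proof -
  have "Polynomial.coeff (q * h j) i = 0" if "j \<in> u" "i \<ge> a j" for i j
    unfolding coeff_mult
  proof (intro sum.neutral ballI)
    fix k assume "k \<in> {..i}"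
    show "Polynomial.coeff q k * Polynomial.coeff (h j) (i - k) = 0"
    proof (cases "k > t")
      case False
      then have "i - k \<ge> a j - t" using that by simp
      then show ?thesis using degree_box_coeff[OF assms(1) that(1)] by simp
    qed (simp add: assms)
  qed
  then show ?thesis using assms(1) mult by (simp add: degree_box_def)
qed

lemma degree_box_ext:
  assumes "g \<in> degree_box a" "h \<in> degree_box a" "\<And>j i. j \<in> u \<Longrightarrow> i < a j \<Longrightarrow> Polynomial.coeff (g j) i = Polynomial.coeff (h j) i"
  shows "g = h"
proof
  fix j
  show "g j = h j"
  proof (cases "j \<in> u")
    case True
    show ?thesis
      by (rule poly_eqI) (metis True assms degree_box_coeff not_less)
  next
    case False
    then show ?thesis using assms supp[of g j] supp[of h j] by (simp add: degree_box_def)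
  qed
qed

lemma finite_degree_box: "finite (degree_box a)"
proof (rule finite_imageD)
  let ?I = "SIGMA j:u. {..<a j}"
  let ?f = "\<lambda>h :: 'i \<Rightarrow> 'a poly. restrict (\<lambda>(j, i). Polynomial.coeff (h j) i) ?I"
  have "?f ` degree_box a \<subseteq> ?I \<rightarrow>\<^sub>E UNIV" by (auto split: if_splits)
  then show "finite (?f ` degree_box a)"
    by (rule finite_subset) (intro finite_PiE finite_SigmaI finite_u, auto)
  show "inj_on ?f (degree_box a)"
  proof (rule inj_onI)
    fix g h assume gh: "g \<in> degree_box a" "h \<in> degree_box a" "?f g = ?f h"
    show "g = h"
    proof (rule degree_box_ext[OF gh(1,2)])
      fix j i assume "j \<in> u" "i < a j"
      then show "Polynomial.coeff (g j) i = Polynomial.coeff (h j) i"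
        using fun_cong[OF gh(3), of "(j, i)"] by simp
    qed
  qed
qed

text \<open>Translating a fibre of \<open>f\<close> by one of its members places it injectively into
  the smaller box.\<close>

lemma card_degree_box_le_image_times:
  assumes "\<And>g h. g \<in> degree_box a \<Longrightarrow> h \<in> degree_box a \<Longrightarrow> f g = f h \<Longrightarrow> (\<lambda>j. g j - h j) \<in> degree_box a'"
  shows "card (degree_box a) \<le> card (f ` degree_box a) * card (degree_box a')"
proof (rule card_le_card_image_times[OF finite_degree_box])
  fix y assume "y \<in> f ` degree_box a"
  then obtain h where h: "h \<in> degree_box a" "y = f h" by auto
  show "card {x \<in> degree_box a. f x = y} \<le> card (degree_box a')"
  proof (rule card_inj_on_le[OF _ _ finite_degree_box])
    show "inj_on (\<lambda>g j. g j - h j) {x \<in> degree_box a. f x = y}"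
      by (rule inj_onI) (auto simp: fun_eq_iff)
    show "(\<lambda>g j. g j - h j) ` {x \<in> degree_box a. f x = y} \<subseteq> degree_box a'"
      using assms h by auto
  qed
qed

lemma card_degree_box_le:
  assumes "\<And>j. j \<in> u \<Longrightarrow> a' j \<le> a j"
  shows "card (degree_box a) \<le> CARD('a) ^ (\<Sum>j\<in>u. a j - a' j) * card (degree_box a')"
proof -
  let ?I = "SIGMA j:u. {a' j..<a j}"
  let ?f = "\<lambda>h :: 'i \<Rightarrow> 'a poly. restrict (\<lambda>(j, i). Polynomial.coeff (h j) i) ?I"
  have fI: "finite ?I" by (simp add: finite_u)
  have "card (degree_box a) \<le> card (?f ` degree_box a) * card (degree_box a')"
  proof (rule card_degree_box_le_image_times)
    fix g h assume gh: "g \<in> degree_box a" "h \<in> degree_box a" "?f g = ?f h"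
    have "Polynomial.coeff (g j - h j) i = 0" if "j \<in> u" "i \<ge> a' j" for i j
    proof (cases "i < a j")
      case True
      then show ?thesis using fun_cong[OF gh(3), of "(j, i)"] that by simp
    next
      case False
      then show ?thesis using degree_box_coeff[OF gh(1)] degree_box_coeff[OF gh(2)] that by simp
    qed
    then show "(\<lambda>j. g j - h j) \<in> degree_box a'"
      using degree_box_diff[OF gh(1,2)] by (simp add: degree_box_def)
  qed
  also have "card (?f ` degree_box a) \<le> card (?I \<rightarrow>\<^sub>E (UNIV :: 'a set))"
    by (intro card_mono finite_PiE fI) (auto split: if_splits)
  also have "\<dots> = CARD('a) ^ (\<Sum>j\<in>u. a j - a' j)"
    by (simp add: card_funcsetE fI finite_u)
  finally show ?thesis by simp
qed

end

text \<open>The last assumption says that no vector without zero components fits into the box after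
  one of its sides is shortened. It is the form in which the minimal total length of
  \<open>k\<close> enters.\<close>

locale minimal_box = poly_module u L
  for u :: "'i set" and L :: "('i \<Rightarrow> 'a::{field,finite} poly) set" +
  fixes a :: "'i \<Rightarrow> nat" and k :: "'i \<Rightarrow> 'a poly"
  assumes nonempty: "u \<noteq> {}"
    and k: "k \<in> degree_box a" "\<And>j. j \<in> u \<Longrightarrow> k j \<noteq> 0"
    and minimal: "\<And>e j. e \<in> degree_box a \<Longrightarrow> (\<And>j. j \<in> u \<Longrightarrow> e j \<noteq> 0) \<Longrightarrow> j \<in> u \<Longrightarrow>
        Polynomial.coeff (e j) (a j - 1) \<noteq> 0"
begin

lemma k_lead: "j \<in> u \<Longrightarrow> Polynomial.coeff (k j) (a j - 1) \<noteq> 0"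
  using minimal[OF k] .

lemma a_pos: "j \<in> u \<Longrightarrow> a j > 0"
  using k_lead[of j] degree_box_coeff[OF k(1), of j "a j - 1"] by (cases "a j") auto

text \<open>Adding suitable \<open>(c x^D + q) h\<close> with \<open>deg q < D\<close> to \<open>k\<close> kills a leading coefficient, so by
  minimality some component of the sum vanishes, and distinct \<open>q\<close> vanish at distinct components.\<close>

lemma deep_box_trivial:
  assumes "h \<in> degree_box (\<lambda>j. a j - T)" and "j \<in> u" and "h j \<noteq> 0"
  shows "CARD('a) ^ T \<le> card u"
proof -
  define S where "S = {j\<in>u. h j \<noteq> 0}"
  have S: "finite S" "S \<noteq> {}" "S \<subseteq> u" using assms finite_u by (auto simp: S_def)
  define gap where "gap j = a j - 1 - Polynomial.degree (h j)" for j
  have deg: "Polynomial.degree (h j) + T < a j" if "j \<in> S" for j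
  proof (rule ccontr)
    assume "\<not> ?thesis"
    then have "Polynomial.coeff (h j) (Polynomial.degree (h j)) = 0"
      using degree_box_coeff[OF assms(1), of j "Polynomial.degree (h j)"] that S(3) by (simp add: subset_eq)
    then show False using that by (simp add: S_def)
  qed
  \<comment> \<open>\<open>D\<close> is the largest shift for which \<open>x ^ D\<close> times
    \<open>h\<close> stays in the box \<open>a\<close>; at \<open>j0\<close> the shifted polynomial
    has its leading coefficient exactly at position \<open>a j0 - 1\<close>, where it can cancel
    that of \<open>k\<close>.\<close>
  define D where "D = Min (gap ` S)"
  have "D \<in> gap ` S" using S by (simp add: D_def)
  then obtain j0 where j0: "j0 \<in> S" "D = gap j0" by auto
  have Dle: "D \<le> gap j" if "j \<in> S" for j using S that by (simp add: D_def)
  have TD: "T \<le> D" using deg[OF j0(1)] j0 by (simp add: gap_def)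
  have j0u: "j0 \<in> u" using j0 S by auto
  have hD: "h \<in> degree_box (\<lambda>j. a j - D)"
  proof -
    have "Polynomial.coeff (h j) i = 0" if "j \<in> u" "i \<ge> a j - D" for i j
    proof (cases "j \<in> S")
      case True
      then have "Polynomial.degree (h j) < i" using Dle[OF True] deg[OF True] that by (simp add: gap_def)
      then show ?thesis by (simp add: coeff_eq_0)
    next
      case False then show ?thesis using that by (simp add: S_def)
    qed
    then show ?thesis using assms(1) by (simp add: degree_box_def)
  qed
  define c where "c = - Polynomial.coeff (k j0) (a j0 - 1) / Polynomial.coeff (h j0) (Polynomial.degree (h j0))"
  define P where "P = {q :: 'a poly. \<forall>i\<ge>D. Polynomial.coeff q i = 0}"
  define e where "e q j = k j + (Polynomial.monom c D + q) * h j" for q j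
  have *: "\<exists>j\<in>u. e q j = 0" if "q \<in> P" for q
  proof (rule ccontr)
    assume neg: "\<not> ?thesis"
    have "Polynomial.coeff (Polynomial.monom c D + q) i = 0" if "i > D" for i
      using \<open>q \<in> P\<close> that by (simp add: P_def)
    then have "e q \<in> degree_box a"
      unfolding e_def using degree_box_add[OF k(1) degree_box_mult[OF hD]] by simp
    then have lead_nz: "Polynomial.coeff (e q j0) (a j0 - 1) \<noteq> 0"
      using minimal neg j0u by auto
    have a1: "a j0 - 1 = D + Polynomial.degree (h j0)"
      using j0 deg[OF j0(1)] by (simp add: gap_def)
    have low: "Polynomial.coeff (q * h j0) (a j0 - 1) = 0"
      unfolding coeff_mult
    proof (intro sum.neutral ballI)
      fix i assume "i \<in> {..a j0 - 1}"
      show "Polynomial.coeff q i * Polynomial.coeff (h j0) (a j0 - 1 - i) = 0"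
      proof (cases "i \<ge> D")
        case False
        then have "Polynomial.degree (h j0) < a j0 - 1 - i" using a1 by simp
        then show ?thesis by (simp add: coeff_eq_0)
      qed (use \<open>q \<in> P\<close> in \<open>simp add: P_def\<close>)
    qed
    have "Polynomial.coeff (Polynomial.monom c D * h j0) (a j0 - 1) =
        c * Polynomial.coeff (h j0) (Polynomial.degree (h j0))"
      by (subst a1) (simp add: coeff_monom_mult)
    then have "Polynomial.coeff (e q j0) (a j0 - 1) = 0"
      using j0(1) low by (simp add: e_def distrib_right c_def S_def)
    then show False using lead_nz by simp
  qed
  define z where "z q = (SOME j. j \<in> u \<and> e q j = 0)" for q
  have z: "z q \<in> u" "e q (z q) = 0" if "q \<in> P" for q
    using someI_ex[of "\<lambda>j. j \<in> u \<and> e q j = 0"] *[OF that] by (auto simp: z_def)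
  \<comment> \<open>If \<open>q\<close> and \<open>q'\<close> vanish at the same component
    \<open>j\<close>, two multiples of \<open>h j\<close> both equal \<open>- k j\<close>. This is
    nonzero, so \<open>h j\<close> is nonzero and can be cancelled.\<close>
  have "inj_on z P"
  proof (rule inj_onI)
    fix q q' assume q: "q \<in> P" "q' \<in> P" "z q = z q'"
    have "k (z q) = - ((Polynomial.monom c D + q) * h (z q))"
      using z(2)[OF q(1)] by (simp add: e_def eq_neg_iff_add_eq_0)
    moreover have "k (z q) = - ((Polynomial.monom c D + q') * h (z q))"
      using z(2)[OF q(2)] q(3) by (simp add: e_def eq_neg_iff_add_eq_0)
    moreover have "k (z q) \<noteq> 0" using k(2) z(1) q by simp
    ultimately show "q = q'" by auto
  qed
  then have "card P \<le> card u"
    by (rule card_inj_on_le) (use z(1) finite_u in auto)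
  then have "CARD('a) ^ D \<le> card u"
    by (simp add: P_def finite_card_polys_coeff_below)
  moreover have "CARD('a) ^ T \<le> CARD('a) ^ D"
    by (rule power_increasing[OF TD]) (simp add: Suc_leI)
  ultimately show ?thesis by simp
qed

text \<open>On the box with sides \<open>a j - t\<close> this is the vector of top coefficients, at
  positions \<open>a j - 1 - t\<close>. Multiplying by \<open>x ^ t\<close> avoids a truncated
  subtraction and gives 0 where \<open>a j \<le> t\<close>. The images of boxes are linear codes
  with coordinates in \<open>u\<close>.\<close>

definition lead :: "nat \<Rightarrow> ('i \<Rightarrow> 'a poly) \<Rightarrow> 'i \<Rightarrow> 'a" where
  "lead t h = (\<lambda>j. if j \<in> u then Polynomial.coeff (Polynomial.monom 1 t * h j) (a j - 1) else 0)"

lemma lead_add: "lead t (\<lambda>j. g j + h j) = (\<lambda>j. lead t g j + lead t h j)"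
  by (auto simp: lead_def algebra_simps)

lemma lead_diff: "lead t (\<lambda>j. g j - h j) = (\<lambda>j. lead t g j - lead t h j)"
  by (auto simp: lead_def algebra_simps)

lemma lead_smult: "lead t (\<lambda>j. Polynomial.smult c (h j)) = (\<lambda>j. c * lead t h j)"
  by (auto simp: lead_def)

lemma degree_box_Suc_if_lead_eq_0:
  assumes "h \<in> degree_box (\<lambda>j. a j - t)" "lead t h = (\<lambda>_. 0)"
  shows "h \<in> degree_box (\<lambda>j. a j - Suc t)"
proof -
  have "Polynomial.coeff (h j) i = 0" if "j \<in> u" "i \<ge> a j - Suc t" for i j
  proof (cases "i \<ge> a j - t")
    case True
    then show ?thesis using degree_box_coeff[OF assms(1)] that by simp
  next
    case False
    then have "i = a j - 1 - t" "t \<le> a j - 1" using that by auto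
    then show ?thesis using fun_cong[OF assms(2), of j] that
      by (simp add: lead_def coeff_monom_mult)
  qed
  then show ?thesis using assms(1) by (simp add: degree_box_def)
qed

text \<open>Two vectors with the same code word differ by a vector one level deeper, so the codes
  play the role of the successive quotients of the filtration by shrinking boxes.\<close>

lemma card_degree_box_le_lead:
  "card (degree_box (\<lambda>j. a j - t)) \<le>
     card (lead t ` degree_box (\<lambda>j. a j - t)) * card (degree_box (\<lambda>j. a j - Suc t))"
  by (intro card_degree_box_le_image_times degree_box_Suc_if_lead_eq_0 degree_box_diff)
     (auto simp: lead_diff)

text \<open>If more than half of the coordinates were independent in the code \<open>lead t ` V\<close>, a nonzero code
  word would vanish on all the others. It kills a leading coefficient of \<open>k\<close>, and a code word at
  level \<open>t - 1\<close> makes all independent components nonzero again, contradicting minimality.\<close>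

lemma card_lead_image_le:
  assumes "t \<ge> 1"
  shows "(card (lead t ` degree_box (\<lambda>j. a j - t)))\<^sup>2 \<le> CARD('a) ^ card u"
proof -
  define V where "V = degree_box (\<lambda>j. a j - t)"
  \<comment> \<open>The code projects onto all patterns on \<open>I\<close>. A maximal such
    \<open>I\<close> is an information set, so its cardinality is the dimension of the code.\<close>
  define full where
    "full I \<longleftrightarrow> I \<subseteq> u \<and> (\<forall>w. \<exists>h\<in>V. \<forall>j\<in>I. lead t h j = w j)" for I
  have "(\<lambda>j. Polynomial.smult 0 (k j)) \<in> V"
    using degree_box_smult[OF k(1), of 0] by (simp add: V_def degree_box_def)
  then have "full {}" unfolding full_def by blast
  moreover have "\<forall>I. full I \<longrightarrow> card I < Suc (card u)"
    using card_mono[OF finite_u] by (auto simp: full_def le_imp_less_Suc)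
  ultimately have "\<exists>I. full I \<and> (\<forall>I'. full I' \<longrightarrow> card I' \<le> card I)"
    using ex_has_greatest_nat[of full "{}" card "Suc (card u)"] by simp
  then obtain I where I: "full I" "\<And>I'. full I' \<Longrightarrow> card I' \<le> card I"
    by blast
  have Iu: "I \<subseteq> u" "finite I" using I finite_u finite_subset by (auto simp: full_def)
  \<comment> \<open>a coordinate on which a code word supported off \<open>I\<close> is nonzero could be added to \<open>I\<close>\<close>
  have inj: "lead t h = (\<lambda>_. 0)" if "h \<in> V" "\<forall>j\<in>I. lead t h j = 0" for h
  proof (rule ccontr)
    assume "\<not> ?thesis"
    then obtain j where j: "lead t h j \<noteq> 0" by auto
    then have ju: "j \<in> u" "j \<notin> I" using that by (auto simp: lead_def split: if_splits)
    have "full (insert j I)"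
      unfolding full_def
    proof (intro conjI allI)
      fix w
      obtain g where g: "g \<in> V" "\<forall>j\<in>I. lead t g j = w j"
        using I(1) unfolding full_def by meson
      define c where "c = (w j - lead t g j) / lead t h j"
      have "(\<lambda>j. g j + Polynomial.smult c (h j)) \<in> V"
        using g that by (simp add: V_def degree_box_add degree_box_smult)
      then show "\<exists>h\<in>V. \<forall>j\<in>insert j I. lead t h j = w j"
        by (rule bexI[rotated]) (use g that j in \<open>auto simp: lead_add lead_smult c_def\<close>)
    qed (use Iu ju in auto)
    then have "card (insert j I) \<le> card I" using I by blast
    then show False using ju Iu by simp
  qed
  have card_le: "card (lead t ` V) \<le> CARD('a) ^ card J"
    if "J \<subseteq> u" "\<And>h. h \<in> V \<Longrightarrow> \<forall>j\<in>J. lead t h j = 0 \<Longrightarrow> lead t h = (\<lambda>_. 0)" for J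
  proof -
    have fJ: "finite J" using that finite_u finite_subset by auto
    have "inj_on (\<lambda>w. restrict w J) (lead t ` V)"
    proof (rule inj_onI)
      fix w w' assume "w \<in> lead t ` V" "w' \<in> lead t ` V" and eq: "restrict w J = restrict w' J"
      then obtain g h where gh: "g \<in> V" "h \<in> V" "w = lead t g" "w' = lead t h" by auto
      have "w j = w' j" if "j \<in> J" for j using fun_cong[OF eq, of j] that by simp
      then have "lead t (\<lambda>j. g j - h j) = (\<lambda>_. 0)"
        using gh by (intro that) (auto simp: V_def degree_box_diff lead_diff)
      then show "w = w'" using gh by (simp add: lead_diff fun_eq_iff)
    qed
    then have "card (lead t ` V) \<le> card (J \<rightarrow>\<^sub>E (UNIV :: 'a set))"
      by (rule card_inj_on_le) (auto intro: finite_PiE fJ)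
    then show ?thesis by (simp add: card_funcsetE fJ)
  qed
  have "2 * card I \<le> card u"
  proof (rule ccontr)
    assume neg: "\<not> ?thesis"
    \<comment> \<open>Otherwise the coordinates in \<open>u - I\<close> would determine every code
      word, leaving fewer than \<open>b ^ card I\<close> of them, although all patterns on
      \<open>I\<close> occur.\<close>
    have "\<exists>h\<in>V. (\<forall>j\<in>u - I. lead t h j = 0) \<and> lead t h \<noteq> (\<lambda>_. 0)"
    proof (rule ccontr)
      assume "\<not> ?thesis"
      then have "card (lead t ` V) \<le> CARD('a) ^ card (u - I)" by (intro card_le) auto
      also have "\<dots> < CARD('a) ^ card I"
      proof (rule power_strict_increasing)
        show "card (u - I) < card I" using neg Iu finite_u by (simp add: card_Diff_subset)
        have "card {0, 1 :: 'a} \<le> CARD('a)" by (rule card_mono) auto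
        then show "1 < CARD('a)" by simp
      qed
      also have "\<dots> = card (I \<rightarrow>\<^sub>E (UNIV :: 'a set))" using Iu by (simp add: card_funcsetE)
      also have "\<dots> \<le> card ((\<lambda>w. restrict w I) ` lead t ` V)"
      proof (rule card_mono)
        show "finite ((\<lambda>w. restrict w I) ` lead t ` V)" by (simp add: V_def finite_degree_box)
        show "(I \<rightarrow>\<^sub>E (UNIV :: 'a set)) \<subseteq> (\<lambda>w. restrict w I) ` lead t ` V"
        proof
          fix w :: "'i \<Rightarrow> 'a" assume w: "w \<in> I \<rightarrow>\<^sub>E UNIV"
          obtain h where h: "h \<in> V" "\<forall>j\<in>I. lead t h j = w j"
            using I(1) unfolding full_def by meson
          then have "restrict (lead t h) I = w" using w by (auto simp: PiE_def extensional_def)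
          then show "w \<in> (\<lambda>w. restrict w I) ` lead t ` V" using h by blast
        qed
      qed
      also have "\<dots> \<le> card (lead t ` V)" by (intro card_image_le) (simp add: V_def finite_degree_box)
      finally show False by simp
    qed
    then obtain h0 where h0: "h0 \<in> V" "\<And>j. j \<in> u - I \<Longrightarrow> lead t h0 j = 0" "lead t h0 \<noteq> (\<lambda>_. 0)" by blast
    then obtain j0 where j0: "lead t h0 j0 \<noteq> 0" by auto
    then have j0u: "j0 \<in> u" by (auto simp: lead_def split: if_splits)
    \<comment> \<open>Chosen so that adding \<open>c\<close> times the shifted \<open>h0\<close>
      removes the coefficient of \<open>k j0\<close> at position \<open>a j0 - 1\<close>.\<close>
    define c where "c = - Polynomial.coeff (k j0) (a j0 - 1) / lead t h0 j0"
    define e0 where "e0 j = k j + Polynomial.monom 1 t * Polynomial.smult c (h0 j)" for j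
    \<comment> \<open>Shifted by \<open>t - 1\<close> instead of \<open>t\<close>, the top
      coefficients of \<open>h1\<close> land at position \<open>a j - 2\<close> and leave position
      \<open>a j - 1\<close> untouched. The prescribed values make the coefficient of
      \<open>e j\<close> at \<open>a j - 2\<close> equal to 1 for all \<open>j\<close> in
      \<open>I\<close>; off \<open>I\<close> the leading coefficient of \<open>k j\<close> survives
      because \<open>lead t h0\<close> vanishes there.\<close>
    obtain h1 where h1: "h1 \<in> V" "\<And>j. j \<in> I \<Longrightarrow> lead t h1 j = 1 - Polynomial.coeff (e0 j) (a j - 2)"
      using I by (force simp: full_def)
    define e where "e j = e0 j + Polynomial.monom 1 (t - 1) * h1 j" for j
    have lead1: "Polynomial.coeff (Polynomial.monom 1 (t - 1) * h1 j) (a j - 1) = 0" if "j \<in> u" for j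
      using a_pos[OF that] assms degree_box_coeff[OF h1(1)[unfolded V_def] that, of "a j - 1 - (t - 1)"]
      by (simp add: coeff_monom_mult)
    have lead_e: "Polynomial.coeff (e j) (a j - 1) = Polynomial.coeff (k j) (a j - 1) + c * lead t h0 j"
      if "j \<in> u" for j
      using lead1[OF that] that by (simp add: e_def e0_def lead_def)
    have "e \<in> degree_box a"
      unfolding e_def e0_def
      by (intro degree_box_add k(1) degree_box_mult[of _ _ t] degree_box_smult)
         (use h0 h1 in \<open>auto simp: V_def\<close>)
    moreover have "e j \<noteq> 0" if "j \<in> u" for j
    proof (cases "j \<in> I")
      case True
      \<comment> \<open>A code word that is nonzero at \<open>j\<close> shows
        \<open>a j > t \<ge> 1\<close>, so \<open>a j - 2\<close> is a genuine position and not the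
        result of truncation.\<close>
      have "\<exists>h\<in>V. \<forall>i\<in>I. lead t h i = 1"
        using I(1) unfolding full_def by (elim conjE allE[of _ "\<lambda>_. 1"])
      then obtain g where g: "g \<in> V" "lead t g j = 1" using True by blast
      then have "Polynomial.coeff (Polynomial.monom 1 t * g j) (a j - 1) \<noteq> 0"
        using that by (simp add: lead_def)
      then have ta: "t \<le> a j - 1" by (auto simp: coeff_monom_mult split: if_splits)
      then have "Polynomial.coeff (Polynomial.monom 1 (t - 1) * h1 j) (a j - 2) = lead t h1 j"
        using assms that by (auto simp: lead_def coeff_monom_mult)
      then have "Polynomial.coeff (e j) (a j - 2) = 1"
        using h1(2)[OF True] by (simp add: e_def)
      then show ?thesis by auto
    next
      case False
      then have "Polynomial.coeff (e j) (a j - 1) \<noteq> 0"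
        using lead_e[OF that] h0(2)[of j] k_lead[OF that] that by simp
      then show ?thesis by auto
    qed
    ultimately have "Polynomial.coeff (e j0) (a j0 - 1) \<noteq> 0" using minimal j0u by blast
    then show False using lead_e[OF j0u] j0 by (simp add: c_def)
  qed
  have "(card (lead t ` V))\<^sup>2 \<le> (CARD('a) ^ card I)\<^sup>2"
    using card_le[OF Iu(1) inj] by (intro power_mono) auto
  also have "\<dots> \<le> CARD('a) ^ card u"
    using \<open>2 * card I \<le> card u\<close> by (simp add: power_mult[symmetric] mult.commute power_increasing)
  finally show ?thesis by (simp add: V_def)
qed

text \<open>Passing from depth 0 to depth 1 costs at most \<open>b ^ n\<close>, since the code bound
  is available only for \<open>t \<ge> 1\<close>. Each further depth costs at most
  \<open>b ^ n\<close> after squaring, and the box is trivial at the least depth \<open>T\<close>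
  with \<open>b ^ T > n\<close>. Since \<open>b ^ (T - 1) \<le> n\<close>, these depths together
  cost at most \<open>n ^ n\<close>. Squares avoid half-integral exponents.\<close>

theorem card_minimal_box_le: "(card (degree_box a))\<^sup>2 \<le> CARD('a) ^ (2 * card u) * card u ^ card u"
proof -
  let ?b = "CARD('a)" and ?n = "card u"
  let ?V = "\<lambda>t. card (degree_box (\<lambda>j. a j - t))"
  have b2: "?b \<ge> 2"
  proof -
    have "card {0, 1 :: 'a} \<le> CARD('a)" by (rule card_mono) auto
    then show ?thesis by simp
  qed
  have n0: "?n > 0" using nonempty finite_u by (simp add: card_gt_0_iff)
  have step: "(?V (Suc 0))\<^sup>2 \<le> (?b ^ t) ^ ?n * (?V (Suc t))\<^sup>2" for t
  proof (induction t)
    case (Suc t)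
    have "(?V (Suc t))\<^sup>2 \<le> (card (lead (Suc t) ` degree_box (\<lambda>j. a j - Suc t)) * ?V (Suc (Suc t)))\<^sup>2"
      using card_degree_box_le_lead[of "Suc t"] by (intro power_mono) auto
    also have "\<dots> \<le> ?b ^ ?n * (?V (Suc (Suc t)))\<^sup>2"
      using card_lead_image_le[of "Suc t"] by (simp add: power_mult_distrib)
    finally show ?case
      using mult_le_mono2[of _ _ "(?b ^ t) ^ ?n"] le_trans[OF Suc.IH]
      by (simp add: power_mult_distrib mult.assoc mult.left_commute)
  qed simp
  have "?n < ?b ^ ?n" using less_exp[of ?n] power_mono[OF b2, of ?n] by linarith
  define T where "T = (LEAST T. ?n < ?b ^ T)"
  have T: "?n < ?b ^ T" "\<And>t. t < T \<Longrightarrow> ?b ^ t \<le> ?n"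
    unfolding T_def using LeastI[of "\<lambda>T. ?n < ?b ^ T", OF \<open>?n < ?b ^ ?n\<close>]
      not_less_Least[of _ "\<lambda>T. ?n < ?b ^ T"] by (auto simp: not_less)
  have "T \<noteq> 0" using T(1) n0 by (auto intro: ccontr)
  then obtain T' where T': "T = Suc T'" by (cases T) auto
  have "degree_box (\<lambda>j. a j - T) \<subseteq> {\<lambda>_. 0}"
  proof
    fix h assume h: "h \<in> degree_box (\<lambda>j. a j - T)"
    then have "h j = 0" for j
      using deep_box_trivial[OF h, of j] supp[of h j] T(1) by (cases "j \<in> u") (auto simp: degree_box_def)
    then show "h \<in> {\<lambda>_. 0}" by auto
  qed
  then have "?V T \<le> 1" using card_mono[of "{\<lambda>_::'i. 0::'a poly}"] by fastforce
  have "?V 0 \<le> ?b ^ ?n * ?V (Suc 0)"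
  proof -
    have "?V 0 \<le> ?b ^ (\<Sum>j\<in>u. a j - 0 - (a j - Suc 0)) * ?V (Suc 0)"
      by (rule card_degree_box_le) simp
    also have "(\<Sum>j\<in>u. a j - 0 - (a j - Suc 0)) = (\<Sum>j\<in>u. 1)"
      by (rule sum.cong) (use a_pos in fastforce)+
    finally show ?thesis by simp
  qed
  then have "(?V 0)\<^sup>2 \<le> (?b ^ ?n * ?V (Suc 0))\<^sup>2" by (intro power_mono) auto
  also have "\<dots> \<le> (?b ^ ?n)\<^sup>2 * ((?b ^ T') ^ ?n * (?V T)\<^sup>2)"
    using step[of T'] by (simp add: power_mult_distrib T')
  also have "\<dots> \<le> (?b ^ ?n)\<^sup>2 * (?n ^ ?n * 1\<^sup>2)"
    using \<open>?V T \<le> 1\<close> T(2)[of T'] by (intro mult_le_mono power_mono) (auto simp: T')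
  finally show ?thesis by (simp add: power_mult[symmetric] mult.commute)
qed

end

section \<open>Digits and truncated polynomials\<close>

lemma card_prime_card_ge_2: "CARD('b::prime_card) \<ge> 2"
  using prime_card[where 'a='b] by (rule prime_ge_2_nat)

lemma mu_eq:
  assumes "2 \<le> b" "b ^ i \<le> k" "k < b ^ Suc i"
  shows "mu b k = Suc i"
proof -
  have "Max {j. digit b k j \<noteq> 0} = i"
  proof (rule Max_eqI)
    have *: "j \<le> i" if "digit b k j \<noteq> 0" for j
    proof (rule ccontr)
      assume "\<not> ?thesis"
      then have "b ^ Suc i \<le> b ^ j" using assms by (intro power_increasing) auto
      then have "k div b ^ j = 0" using assms by simp
      then show False using that by (simp add: digit_def)
    qed
    then show "y \<le> i" if "y \<in> {j. digit b k j \<noteq> 0}" for y using that by simp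
    show "finite {j. digit b k j \<noteq> 0}" using * by (auto intro: finite_subset[of _ "{..i}"])
    have "k div b ^ i < b" using assms by (simp add: less_mult_imp_div_less)
    moreover have "k div b ^ i \<noteq> 0" using assms by (auto simp: div_eq_0_iff)
    ultimately show "i \<in> {j. digit b k j \<noteq> 0}" by (simp add: digit_def)
  qed
  then show ?thesis by (simp add: mu_def)
qed

lemma mu_bounds:
  assumes "2 \<le> b" "1 \<le> k"
  shows "b ^ (mu b k - 1) \<le> k" "k < b ^ mu b k" "mu b k \<ge> 1"
proof -
  obtain i where "b ^ i \<le> k" "k < b ^ Suc i" using ex_power_ivl1[OF assms] by auto
  with mu_eq[OF assms(1) this] show "b ^ (mu b k - 1) \<le> k" "k < b ^ mu b k" "mu b k \<ge> 1"
    by auto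
qed

lemma mu_le_iff:
  assumes "2 \<le> b" "1 \<le> k"
  shows "mu b k \<le> a \<longleftrightarrow> k < b ^ a"
proof
  assume "mu b k \<le> a"
  then have "b ^ mu b k \<le> b ^ a" using assms by (intro power_increasing) auto
  then show "k < b ^ a" using mu_bounds[OF assms] by linarith
next
  assume "k < b ^ a"
  then have "b ^ (mu b k - 1) < b ^ a" using mu_bounds[OF assms] by linarith
  then have "mu b k - 1 < a" by (rule power_less_imp_less_exp[rotated]) (use assms in simp)
  then show "mu b k \<le> a" by linarith
qed

lemma mu_power_times:
  assumes "2 \<le> b" "1 \<le> k"
  shows "mu b (b ^ m * k) = m + mu b k"
proof -
  obtain e where e: "mu b k = Suc e" using mu_bounds(3)[OF assms] by (cases "mu b k") auto
  have "mu b (b ^ m * k) = Suc (m + e)"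
  proof (rule mu_eq[OF assms(1)])
    show "b ^ (m + e) \<le> b ^ m * k" using mu_bounds(1)[OF assms] by (simp add: power_add e)
    have "b ^ m * k < b ^ m * b ^ Suc e" using mu_bounds(2)[OF assms] assms(1) by (simp add: e)
    then show "b ^ m * k < b ^ Suc (m + e)" by (simp add: power_add mult.left_commute)
  qed
  then show ?thesis by (simp add: e)
qed

lemma of_nat_mod_ring_inj:
  assumes "x < CARD('b::prime_card)" "y < CARD('b)" "(of_nat x :: 'b mod_ring) = of_nat y"
  shows "x = y"
  using assms by (transfer) (simp)

lemma coeff_trunc_poly:
  "Polynomial.coeff (trunc_poly m k :: 'b::prime_card mod_ring poly) i =
     (if i < m then of_nat (digit CARD('b) k i) else 0)"
  by (auto simp: trunc_poly_def coeff_sum if_distrib cong: if_cong)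

lemma digit_less: "0 < b \<Longrightarrow> digit b k i < b"
  by (simp add: digit_def)

lemma mod_power_eqI:
  assumes "\<And>i. i < m \<Longrightarrow> digit b k i = digit b k' i"
  shows "k mod b ^ m = k' mod b ^ m"
  using assms
proof (induction m)
  case (Suc m)
  have "k mod (b ^ m * b) = b ^ m * digit b k m + k mod b ^ m" for k
    by (simp add: mod_mult2_eq digit_def)
  then show ?case using Suc by (simp add: mult.commute)
qed simp

lemma trunc_poly_eqD:
  assumes "trunc_poly m k = (trunc_poly m k' :: 'b::prime_card mod_ring poly)"
  shows "k mod CARD('b) ^ m = k' mod CARD('b) ^ m"
proof (rule mod_power_eqI)
  fix i assume "i < m"
  then have "(of_nat (digit CARD('b) k i) :: 'b mod_ring) = of_nat (digit CARD('b) k' i)"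
    using arg_cong[OF assms, of "\<lambda>p. Polynomial.coeff p i"] by (simp add: coeff_trunc_poly)
  then show "digit CARD('b) k i = digit CARD('b) k' i"
    by (intro of_nat_mod_ring_inj[where 'b='b] digit_less) auto
qed

lemma digit_mod_power:
  assumes "i < m"
  shows "digit b (k mod b ^ m) i = digit b k i"
proof -
  obtain n where n: "m = i + Suc n" using assms less_iff_Suc_add by auto
  have "k mod b ^ m = b ^ i * (k div b ^ i mod b ^ Suc n) + k mod b ^ i"
    unfolding n power_add by (rule mod_mult2_eq)
  then have "k mod b ^ m div b ^ i = k div b ^ i mod b ^ Suc n"
    by (cases "b = 0") (auto simp: n)
  then show ?thesis by (simp add: digit_def mod_mod_cancel)
qed

lemma trunc_poly_mod [simp]:
  "trunc_poly m (k mod CARD('b) ^ m) = (trunc_poly m k :: 'b::prime_card mod_ring poly)"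
  by (rule poly_eqI) (simp add: coeff_trunc_poly digit_mod_power)

lemma trunc_poly_0 [simp]: "trunc_poly m 0 = 0"
  by (rule poly_eqI) (simp add: coeff_trunc_poly digit_def)

lemma trunc_poly_eq_iff:
  "trunc_poly m k = (trunc_poly m k' :: 'b::prime_card mod_ring poly) \<longleftrightarrow>
     k mod CARD('b) ^ m = k' mod CARD('b) ^ m"
  by (metis trunc_poly_eqD trunc_poly_mod)

lemma trunc_poly_eq_0_iff:
  "trunc_poly m k = (0 :: 'b::prime_card mod_ring poly) \<longleftrightarrow> CARD('b) ^ m dvd k"
  using trunc_poly_eq_iff[of m k 0] by (simp add: dvd_eq_mod_eq_0)

lemma polys_below_eq: "polys_below m = {q :: 'b::prime_card mod_ring poly. \<forall>i\<ge>m. Polynomial.coeff q i = 0}"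
proof (intro Set.set_eqI iffI)
  fix q :: "'b mod_ring poly" assume "q \<in> {q. \<forall>i\<ge>m. Polynomial.coeff q i = 0}"
  then have "m \<le> Polynomial.degree q \<Longrightarrow> Polynomial.coeff q (Polynomial.degree q) = 0" by simp
  then have "m \<le> Polynomial.degree q \<Longrightarrow> q = 0" by (simp only: leading_coeff_0_iff)
  then show "q \<in> polys_below m" unfolding polys_below_def using not_less by blast
qed (auto simp: polys_below_def coeff_eq_0)

lemma trunc_poly_in_polys_below: "trunc_poly m k \<in> polys_below m"
  by (simp add: polys_below_eq coeff_trunc_poly)

lemma polys_below_diff: "g \<in> polys_below m \<Longrightarrow> h \<in> polys_below m \<Longrightarrow> g - h \<in> polys_below m"
  by (simp add: polys_below_eq)

text \<open>When no digit is cut off, the leading digit is a nonzero residue because it is smaller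
  than \<open>b\<close>; hence \<mu> is the polynomial length, one more than the degree.\<close>

lemma Suc_degree_trunc_poly:
  assumes "1 \<le> k" "mu CARD('b) k \<le> m"
  shows "trunc_poly m k \<noteq> (0 :: 'b::prime_card mod_ring poly)"
    "Suc (Polynomial.degree (trunc_poly m k :: 'b mod_ring poly)) = mu CARD('b) k"
    "mu CARD('b) k \<le> i \<Longrightarrow> Polynomial.coeff (trunc_poly m k :: 'b mod_ring poly) i = 0"
proof -
  let ?b = "CARD('b)" and ?t = "trunc_poly m k :: 'b mod_ring poly"
  note b2 = card_prime_card_ge_2[where 'b='b]
  obtain e where e: "mu ?b k = Suc e" using mu_bounds(3)[OF b2 assms(1)] by (cases "mu ?b k") auto
  have eb: "?b ^ e \<le> k" "k < ?b ^ Suc e" using mu_bounds[OF b2 assms(1)] e by auto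
  have "k div ?b ^ e < ?b" "k div ?b ^ e \<noteq> 0"
    using eb b2 by (auto simp: less_mult_imp_div_less div_eq_0_iff)
  then have "digit ?b k e \<noteq> 0" "digit ?b k e < ?b" by (auto simp: digit_def)
  then have "(of_nat (digit ?b k e) :: 'b mod_ring) \<noteq> 0"
    using of_nat_mod_ring_inj[where 'b='b, of "digit ?b k e" 0] by auto
  then have nz: "Polynomial.coeff ?t e \<noteq> 0" using assms e by (simp add: coeff_trunc_poly)
  then show "?t \<noteq> 0" by auto
  have z: "Polynomial.coeff ?t i = 0" if "i > e" for i
  proof -
    have "?b ^ Suc e \<le> ?b ^ i" using that b2 by (intro power_increasing) auto
    then show ?thesis using eb by (simp add: coeff_trunc_poly digit_def)
  qed
  then show "mu CARD('b) k \<le> i \<Longrightarrow> Polynomial.coeff ?t i = 0" using e by simp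
  show "Suc (Polynomial.degree ?t) = mu ?b k"
    using le_degree[OF nz] degree_le[of e ?t] z e by simp
qed

lemma finite_card_polys_below:
  "finite (polys_below m :: 'b::prime_card mod_ring poly set)"
  "card (polys_below m :: 'b mod_ring poly set) = CARD('b) ^ m"
  unfolding polys_below_eq using finite_card_polys_coeff_below[where 'a="'b mod_ring"] by simp_all

lemma trunc_poly_surj:
  assumes "g \<in> polys_below m"
  obtains k where "k < CARD('b) ^ m" "trunc_poly m k = (g :: 'b::prime_card mod_ring poly)"
proof -
  have "trunc_poly m ` {..<CARD('b) ^ m} = (polys_below m :: 'b mod_ring poly set)"
  proof (rule card_subset_eq)
    have "inj_on (trunc_poly m :: nat \<Rightarrow> 'b mod_ring poly) {..<CARD('b) ^ m}"
      by (rule inj_onI) (auto simp: trunc_poly_eq_iff)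
    then show "card ((trunc_poly m :: nat \<Rightarrow> 'b mod_ring poly) ` {..<CARD('b) ^ m}) =
        card (polys_below m :: 'b mod_ring poly set)"
      by (simp add: card_image finite_card_polys_below)
  qed (auto simp: finite_card_polys_below trunc_poly_in_polys_below)
  then show thesis using assms that by (metis (no_types, lifting) imageE lessThan_iff)
qed

text \<open>An irreducible polynomial of degree \<open>m\<close> is prime and divides no nonzero
  polynomial of smaller degree, so it divides neither factor unless \<open>g - h\<close> is
  zero.\<close>

lemma cancel_mod_irreducible:
  fixes p :: "'b::prime_card mod_ring poly"
  assumes "Factorial_Ring.irreducible p" "Polynomial.degree p = m"
    and "g \<in> polys_below m" "h \<in> polys_below m" "q \<in> polys_below m - {0}"
    and "p dvd (g - h) * q"
  shows "g = h"
proof (rule ccontr)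
  assume "g \<noteq> h"
  have *: "\<not> p dvd r" if "r \<in> polys_below m - {0}" for r
    using that dvd_imp_degree_le[of p r] assms(2) by (auto simp: polys_below_def)
  have "prime_elem p" using assms(1) by (rule irreducible_imp_prime_elem)
  then have "p dvd (g - h) \<or> p dvd q" using assms(6) by (simp add: prime_elem_dvd_mult_iff)
  then show False using * assms polys_below_diff[OF assms(3,4)] \<open>g \<noteq> h\<close> by auto
qed

text \<open>Multiplication by \<open>q\<close> modulo \<open>p\<close> is injective on the finite
  set of residues, hence surjective.\<close>

lemma solve_mod_irreducible:
  fixes p :: "'b::prime_card mod_ring poly"
  assumes "Factorial_Ring.irreducible p" "Polynomial.degree p = m" "q \<in> polys_below m - {0}"
  obtains g where "g \<in> polys_below m" "p dvd (r + g * q)"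
proof -
  have p0: "p \<noteq> 0" using assms by auto
  have mod_below: "x mod p \<in> polys_below m" for x
    using degree_mod_less[OF p0, of x] assms(2) by (auto simp: polys_below_def)
  have "(\<lambda>g. g * q mod p) ` polys_below m = polys_below m"
  proof (rule endo_inj_surj)
    show "inj_on (\<lambda>g. g * q mod p) (polys_below m)"
    proof (rule inj_onI)
      fix g h assume "g \<in> polys_below m" "h \<in> polys_below m" "g * q mod p = h * q mod p"
      then show "g = h" using cancel_mod_irreducible[OF assms(1,2) _ _ assms(3), of g h]
        by (simp add: mod_eq_dvd_iff algebra_simps)
    qed
  qed (use mod_below finite_card_polys_below in auto)
  then obtain g where "g \<in> polys_below m" "g * q mod p = (- r) mod p"
    using mod_below[of "-r"] by (metis (no_types, lifting) imageE)
  then have "p dvd g * q - - r" by (subst (asm) mod_eq_dvd_iff)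
  then show thesis using that \<open>g \<in> polys_below m\<close> by (simp add: add.commute)
qed

section \<open>Counting dual vectors\<close>

lemma dual_net_iff:
  "k \<in> dual_net m p q u \<longleftrightarrow> k \<in> u \<rightarrow>\<^sub>E {1..} \<and> p dvd (\<Sum>j\<in>u. trunc_poly m (k j) * q j)"
  by (simp add: dual_net_def cong_0_iff)

locale generating_vector =
  fixes m :: nat and p :: "'b::prime_card mod_ring poly" and q :: "nat \<Rightarrow> 'b mod_ring poly"
    and u :: "nat set"
  assumes irred: "Factorial_Ring.irreducible p" and deg: "Polynomial.degree p = m"
    and finite_u: "finite u" and nonempty_u: "u \<noteq> {}"
    and q: "\<And>j. j \<in> u \<Longrightarrow> q j \<in> polys_below m - {0}"
begin

lemma b2: "2 \<le> CARD('b)" by (rule card_prime_card_ge_2)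

text \<open>The minimum Niederreiter-Rosenbloom-Tsfasman weight of dual vectors all of whose
  components are positive; it is the quantity \<rho> of the overview.\<close>

definition merit :: nat where
  "merit = (LEAST t. \<exists>k\<in>dual_net m p q u. mu_vec CARD('b) u k = t)"

lemma mu_vec_ge_card: "k \<in> u \<rightarrow>\<^sub>E {1..} \<Longrightarrow> card u \<le> mu_vec CARD('b) u k"
  using sum_mono[of u "\<lambda>_. 1" "\<lambda>j. mu CARD('b) (k j)"] mu_bounds(3)[OF b2]
  by (fastforce simp: mu_vec_def PiE_iff)

lemma exists_short_dual: "\<exists>k\<in>dual_net m p q u. mu_vec CARD('b) u k = m + card u"
proof -
  obtain i where i: "i \<in> u" using nonempty_u by auto
  obtain g where g: "g \<in> polys_below m"
    "p dvd ((\<Sum>j\<in>u - {i}. trunc_poly m 1 * q j) + g * q i)"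
    by (rule solve_mod_irreducible[OF irred deg q[OF i]])
  obtain r where r: "r < CARD('b) ^ m" "trunc_poly m r = g" by (rule trunc_poly_surj[OF g(1)])
  \<comment> \<open>All components but one are 1, and the congruence is solved for the truncation of
    the remaining one. Adding \<open>b ^ m\<close> does not change this truncation, and makes the
    component positive with \<mu> equal to \<open>m + 1\<close> whatever \<open>r\<close>
    is.\<close>
  define k where "k = (\<lambda>j\<in>u. if j = i then CARD('b) ^ m + r else 1)"
  have m1: "mu CARD('b) (CARD('b) ^ m + r) = Suc m"
    using r(1) b2 by (intro mu_eq) (auto intro: less_le_trans[of _ "2 * CARD('b) ^ m"])
  have "trunc_poly m (CARD('b) ^ m + r) = (trunc_poly m r :: 'b mod_ring poly)"
    by (simp add: trunc_poly_eq_iff)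
  then have "(\<Sum>j\<in>u. trunc_poly m (k j) * q j) = g * q i + (\<Sum>j\<in>u - {i}. trunc_poly m 1 * q j)"
    using i r by (subst sum.remove[OF finite_u i]) (auto simp: k_def intro!: sum.cong)
  then have "k \<in> dual_net m p q u"
    using g(2) b2 by (auto simp: dual_net_iff k_def add.commute Suc_le_eq)
  moreover have "mu_vec CARD('b) u k = m + card u"
  proof -
    have "mu CARD('b) 1 = 1" using mu_eq[OF b2, of 0 1] b2 by simp
    then have "mu_vec CARD('b) u k = Suc m + (\<Sum>j\<in>u - {i}. 1)"
      unfolding mu_vec_def using i m1
      by (subst sum.remove[OF finite_u i]) (auto simp: k_def intro!: sum.cong)
    then show ?thesis using card_Suc_Diff1[OF finite_u i] by simp
  qed
  ultimately show ?thesis by blast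
qed

lemma merit_le: "k \<in> dual_net m p q u \<Longrightarrow> merit \<le> mu_vec CARD('b) u k"
  unfolding merit_def by (rule Least_le) auto

lemma merit_attained: "\<exists>k\<in>dual_net m p q u. mu_vec CARD('b) u k = merit"
  unfolding merit_def by (rule LeastI_ex) (use exists_short_dual in blast)

lemma merit_bounds: "card u \<le> merit" "merit \<le> m + card u"
proof -
  obtain k where "k \<in> dual_net m p q u" "mu_vec CARD('b) u k = merit" using merit_attained by blast
  then show "card u \<le> merit" using mu_vec_ge_card[of k] by (simp add: dual_net_iff)
  show "merit \<le> m + card u" using exists_short_dual merit_le by force
qed

text \<open>Unlike \<open>dual_net\<close>, this admits zero components and polynomials of any
  degree. Only thus is it a module over the polynomial ring.\<close>

definition dual_lattice :: "(nat \<Rightarrow> 'b mod_ring poly) set" where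
  "dual_lattice = {h. (\<forall>j. j \<notin> u \<longrightarrow> h j = 0) \<and> p dvd (\<Sum>j\<in>u. h j * q j)}"

sublocale poly_module u dual_lattice
proof
  show "finite u" by (rule finite_u)
  fix g h :: "nat \<Rightarrow> 'b mod_ring poly" and r j
  assume h: "h \<in> dual_lattice"
  show "j \<notin> u \<Longrightarrow> h j = 0" using h by (simp add: dual_lattice_def)
  have "(\<Sum>j\<in>u. r * h j * q j) = r * (\<Sum>j\<in>u. h j * q j)"
    by (simp add: sum_distrib_left mult.assoc)
  then show "(\<lambda>j. r * h j) \<in> dual_lattice" using h by (simp add: dual_lattice_def)
  assume g: "g \<in> dual_lattice"
  show "(\<lambda>j. g j + h j) \<in> dual_lattice"
    using g h by (simp add: dual_lattice_def distrib_right sum.distrib)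
qed

definition level :: "(nat \<Rightarrow> nat) \<Rightarrow> (nat \<Rightarrow> nat) set" where
  "level a = {k \<in> dual_net m p q u. \<forall>j\<in>u. mu CARD('b) (k j) = a j}"

lemma levelD:
  assumes "k \<in> level a" "j \<in> u"
  shows "1 \<le> k j" "mu CARD('b) (k j) = a j" "k j < CARD('b) ^ a j"
proof -
  show "1 \<le> k j" "mu CARD('b) (k j) = a j"
    using assms by (auto simp: level_def dual_net_iff PiE_iff)
  then show "k j < CARD('b) ^ a j" using mu_bounds(2)[OF b2, of "k j"] by simp
qed

lemma level_PiE: "k \<in> level a \<Longrightarrow> k \<in> u \<rightarrow>\<^sub>E {1..}"
  by (simp add: level_def dual_net_iff)

lemma finite_level: "finite (level a)"
proof (rule finite_subset)
  show "level a \<subseteq> (\<Pi>\<^sub>E j\<in>u. {..<CARD('b) ^ a j})"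
  proof
    fix k assume k: "k \<in> level a"
    show "k \<in> (\<Pi>\<^sub>E j\<in>u. {..<CARD('b) ^ a j})"
      using level_PiE[OF k] levelD(3)[OF k] by (simp add: PiE_iff)
  qed
qed (auto intro: finite_PiE finite_u)

text \<open>The other components determine \<open>trunc_poly m (k i)\<close>, hence the lowest
  \<open>m\<close> digits of \<open>k i\<close>. Only the quotient of \<open>k i\<close> by
  \<open>b ^ m\<close> remains free, which saves the factor \<open>b ^ m\<close>.\<close>

lemma card_level_le_of_large:
  assumes "i \<in> u" "m < a i"
  shows "card (level a) \<le> CARD('b) ^ ((\<Sum>j\<in>u. a j) - m)"
proof -
  let ?a' = "\<lambda>j. if j = i then a i - m else a j"
  let ?T = "\<Pi>\<^sub>E j\<in>u. {..<CARD('b) ^ ?a' j}"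
  let ?f = "\<lambda>k :: nat \<Rightarrow> nat. k(i := k i div CARD('b) ^ m)"
  have "card (level a) \<le> card ?T"
  proof (rule card_inj_on_le)
    show "finite ?T" by (auto intro: finite_PiE finite_u)
    show "?f ` level a \<subseteq> ?T"
    proof (rule image_subsetI)
      fix k assume k: "k \<in> level a"
      have "k i < CARD('b) ^ (a i - m) * CARD('b) ^ m"
        using levelD(3)[OF k assms(1)] assms(2) by (simp add: power_add[symmetric])
      then have "k i div CARD('b) ^ m < CARD('b) ^ (a i - m)" by (rule less_mult_imp_div_less)
      then show "?f k \<in> ?T" using level_PiE[OF k] levelD(3)[OF k] assms(1)
        by (auto simp: PiE_iff extensional_def)
    qed
    show "inj_on ?f (level a)"
    proof (rule inj_onI)
      fix k l assume kl: "k \<in> level a" "l \<in> level a" "?f k = ?f l"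
      have eq: "k j = l j" if "j \<noteq> i" for j using fun_cong[OF kl(3), of j] that by simp
      have eqi: "k i div CARD('b) ^ m = l i div CARD('b) ^ m" using fun_cong[OF kl(3), of i] by simp
      have "p dvd (\<Sum>j\<in>u. trunc_poly m (k j) * q j) - (\<Sum>j\<in>u. trunc_poly m (l j) * q j)"
        using kl by (intro dvd_diff) (auto simp: level_def dual_net_iff)
      also have "\<dots> = trunc_poly m (k i) * q i - trunc_poly m (l i) * q i"
      proof -
        have "(\<Sum>j\<in>u - {i}. trunc_poly m (k j) * q j) = (\<Sum>j\<in>u - {i}. trunc_poly m (l j) * q j)"
          by (rule sum.cong) (auto simp: eq)
        then show ?thesis
          by (simp add: sum.remove[OF finite_u assms(1), of "\<lambda>j. trunc_poly m (k j) * q j"]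
              sum.remove[OF finite_u assms(1), of "\<lambda>j. trunc_poly m (l j) * q j"])
      qed
      finally have "p dvd (trunc_poly m (k i) - trunc_poly m (l i)) * q i"
        by (simp add: left_diff_distrib)
      then have "(trunc_poly m (k i) :: 'b mod_ring poly) = trunc_poly m (l i)"
        by (intro cancel_mod_irreducible[OF irred deg _ _ q[OF assms(1)]] trunc_poly_in_polys_below)
      then have "k i mod CARD('b) ^ m = l i mod CARD('b) ^ m" by (simp add: trunc_poly_eq_iff)
      then have "k i = l i" using eqi by (metis div_mult_mod_eq)
      then show "k = l" using eq by (metis ext)
    qed
  qed
  also have "card ?T = (\<Prod>j\<in>u. CARD('b) ^ ?a' j)" by (simp add: card_PiE finite_u)
  also have "\<dots> = CARD('b) ^ (\<Sum>j\<in>u. ?a' j)" by (simp add: power_sum)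
  also have "(\<Sum>j\<in>u. ?a' j) = (\<Sum>j\<in>u. a j) - m"
  proof -
    have "(\<Sum>j\<in>u. ?a' j) = a i - m + (\<Sum>j\<in>u - {i}. a j)"
      by (subst sum.remove[OF finite_u assms(1)]) (auto intro!: sum.cong)
    then show ?thesis using assms by (simp add: sum.remove[OF finite_u assms(1), of a])
  qed
  finally show ?thesis .
qed

text \<open>Shrinking the box around a shortest dual vector without zero components loses at most a
  factor \<open>b\<close> per unit of length, and the minimal box that remains contains few points.\<close>

lemma card_level_le_of_small:
  assumes small: "\<And>j. j \<in> u \<Longrightarrow> a j \<le> m" and ne: "level a \<noteq> {}"
  obtains r where "merit \<le> r" "r \<le> (\<Sum>j\<in>u. a j)"
    "(card (level a))\<^sup>2 \<le> (CARD('b) ^ ((\<Sum>j\<in>u. a j) - r))\<^sup>2 * (CARD('b) ^ (2 * card u) * card u ^ card u)"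
proof -
  let ?t = "\<lambda>k :: nat \<Rightarrow> nat. (\<lambda>j. if j \<in> u then trunc_poly m (k j) else 0) :: nat \<Rightarrow> 'b mod_ring poly"
  have kj: "1 \<le> k j" "mu CARD('b) (k j) = a j" "mu CARD('b) (k j) \<le> m" "k j < CARD('b) ^ m" if "k \<in> level a" "j \<in> u" for k j
    using levelD[OF that] small[OF that(2)] mu_le_iff[OF b2, of "k j" m] by simp_all
  have t_box: "?t k \<in> degree_box a" if "k \<in> level a" for k
  proof -
    have "?t k \<in> dual_lattice" using that by (simp add: dual_lattice_def level_def dual_net_iff)
    then show ?thesis using Suc_degree_trunc_poly(3)[where 'b='b, OF kj(1)[OF that] kj(3)[OF that]] kj(2)[OF that]
      by (auto simp: degree_box_def)
  qed
  have t_nz: "?t k j \<noteq> 0" if "k \<in> level a" "j \<in> u" for k j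
    using Suc_degree_trunc_poly(1)[where 'b='b, OF kj(1)[OF that] kj(3)[OF that]] that by simp
  have "card (level a) \<le> card (degree_box a)"
  proof (rule card_inj_on_le[OF _ _ finite_degree_box])
    show "inj_on ?t (level a)"
    proof (rule inj_onI)
      fix k l assume kl: "k \<in> level a" "l \<in> level a" "?t k = ?t l"
      show "k = l"
      proof (rule PiE_ext)
        show "k \<in> u \<rightarrow>\<^sub>E {1..}" "l \<in> u \<rightarrow>\<^sub>E {1..}" by (rule level_PiE[OF kl(1)], rule level_PiE[OF kl(2)])
        fix j assume j: "j \<in> u"
        then show "k j = l j" using fun_cong[OF kl(3), of j] kj(4)[OF kl(1) j] kj(4)[OF kl(2) j]
          by (simp add: trunc_poly_eq_iff)
      qed
    qed
  qed (use t_box in blast)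
  define full where "full e \<longleftrightarrow> e \<in> degree_box a \<and> (\<forall>j\<in>u. e j \<noteq> 0)" for e
  define len where "len e = (\<Sum>j\<in>u. Suc (Polynomial.degree (e j)))" for e :: "nat \<Rightarrow> 'b mod_ring poly"
  obtain k where "k \<in> level a" using ne by auto
  then have "full (?t k)" unfolding full_def using t_box t_nz by blast
  then have "\<exists>e. full e \<and> (\<forall>e'. full e' \<longrightarrow> len e \<le> len e')"
    using ex_has_least_nat[of full "?t k" len] by simp
  then obtain e where e: "full e" "\<And>e'. full e' \<Longrightarrow> len e \<le> len e'" by blast
  define a' where "a' j = Suc (Polynomial.degree (e j))" for j
  have deg_less: "Polynomial.degree (e' j) < c j" if "e' \<in> degree_box c" "j \<in> u" "e' j \<noteq> 0" for e' c j
    using degree_box_coeff[OF that(1,2), of "Polynomial.degree (e' j)"] that(3) by (meson leading_coeff_0_iff not_le)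
  have a'a: "a' j \<le> a j" if "j \<in> u" for j
    using deg_less[of e a j] e(1) that by (auto simp: a'_def full_def)
  interpret M: minimal_box u dual_lattice a' e
  proof
    show "u \<noteq> {}" by (rule nonempty_u)
    show "e \<in> degree_box a'" using e(1) by (auto simp: full_def degree_box_def a'_def coeff_eq_0)
    show "e j \<noteq> 0" if "j \<in> u" for j using e(1) that by (simp add: full_def)
    fix e' j assume e': "e' \<in> degree_box a'" "\<And>j. j \<in> u \<Longrightarrow> e' j \<noteq> 0" and j: "j \<in> u"
    have "full e'" using e' degree_box_mono[of a' a] a'a by (auto simp: full_def)
    then have "len e \<le> len e'" by (rule e(2))
    moreover have le: "Suc (Polynomial.degree (e' i)) \<le> a' i" if "i \<in> u" for i
      using deg_less[OF e'(1) that e'(2)[OF that]] by simp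
    ultimately have "Suc (Polynomial.degree (e' j)) = a' j"
      using sum_mono_inv[of "\<lambda>i. Suc (Polynomial.degree (e' i))" u a' j] sum_mono[of u "\<lambda>i. Suc (Polynomial.degree (e' i))" a'] j finite_u
      by (simp add: len_def a'_def)
    then have "a' j - 1 = Polynomial.degree (e' j)" by simp
    then show "Polynomial.coeff (e' j) (a' j - 1) \<noteq> 0" using e'(2)[OF j] by simp
  qed
  let ?r = "\<Sum>j\<in>u. a' j"
  have sum_diff: "(\<Sum>j\<in>u. a j - a' j) = (\<Sum>j\<in>u. a j) - ?r"
    using a'a by (rule sum_subtractf_nat)
  have "card (level a) \<le> CARD('b) ^ ((\<Sum>j\<in>u. a j) - ?r) * card (degree_box a')"
    using \<open>card (level a) \<le> card (degree_box a)\<close> card_degree_box_le[of a' a, OF a'a] sum_diff by simp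
  then have "(card (level a))\<^sup>2 \<le> (CARD('b) ^ ((\<Sum>j\<in>u. a j) - ?r) * card (degree_box a'))\<^sup>2"
    by (intro power_mono) auto
  also have "\<dots> \<le> (CARD('b) ^ ((\<Sum>j\<in>u. a j) - ?r))\<^sup>2 * (CARD('b) ^ (2 * card u) * card u ^ card u)"
    using M.card_minimal_box_le by (simp add: power_mult_distrib)
  finally have bound: "(card (level a))\<^sup>2 \<le> \<dots>" .
  \<comment> \<open>The shortest polynomial vector is turned back into an integer vector of the dual
    net, so that its length is at least \<open>merit\<close>.\<close>
  have "\<exists>c. c < CARD('b) ^ m \<and> trunc_poly m c = e j" if "j \<in> u" for j
  proof -
    have "e j \<in> polys_below m"
      using deg_less[of e a j] e(1) small[OF that] that by (force simp: full_def polys_below_def)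
    then show ?thesis by (rule trunc_poly_surj) blast
  qed
  then obtain c where c: "\<And>j. j \<in> u \<Longrightarrow> c j < CARD('b) ^ m" "\<And>j. j \<in> u \<Longrightarrow> trunc_poly m (c j) = e j"
    by metis
  have c1: "1 \<le> c j" if "j \<in> u" for j
    using c(2)[OF that] e(1) that by (cases "c j") (auto simp: full_def)
  have "restrict c u \<in> dual_net m p q u"
  proof -
    have "e \<in> dual_lattice" using e(1) by (simp add: full_def degree_box_def)
    then show ?thesis using c c1 by (auto simp: dual_net_iff dual_lattice_def)
  qed
  moreover have "mu_vec CARD('b) u (restrict c u) = ?r"
    unfolding mu_vec_def
  proof (rule sum.cong)
    fix j assume j: "j \<in> u"
    have "mu CARD('b) (c j) \<le> m" using mu_le_iff[OF b2 c1[OF j]] c(1)[OF j] by simp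
    from Suc_degree_trunc_poly(2)[where 'b='b, OF c1[OF j] this] show "mu CARD('b) (restrict c u j) = a' j"
      using c(2)[OF j] j by (simp add: a'_def)
  qed simp
  ultimately have "merit \<le> ?r" using merit_le by force
  then show thesis using that bound sum_mono[of u a' a] a'a by blast
qed

text \<open>If some side exceeds \<open>m\<close>, the saving is \<open>b ^ m\<close> instead of
  \<open>b ^ merit\<close>, and \<open>merit \<le> m + n\<close> lets the factor
  \<open>b ^ n\<close> make up the difference. Otherwise the bound for minimal boxes
  applies.\<close>

lemma card_level_le:
  "real (card (level a)) \<le> real CARD('b) powr (real (\<Sum>j\<in>u. a j) - real merit) *
     (real CARD('b) ^ card u * real (card u) powr (real (card u) / 2))"
proof (cases "level a = {}")
  case False
  let ?s = "\<Sum>j\<in>u. a j" and ?n = "card u"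
  have n1: "1 \<le> ?n" using nonempty_u finite_u by (simp add: card_gt_0_iff Suc_leI)
  have b0: "real CARD('b) > 0" using b2 by simp
  show ?thesis
  proof (cases "\<exists>i\<in>u. m < a i")
    case True
    then obtain i where i: "i \<in> u" "m < a i" by auto
    have "m \<le> ?s" using member_le_sum[of i u a] i finite_u by simp
    have "real (card (level a)) \<le> real (CARD('b) ^ (?s - m))"
      using card_level_le_of_large[of i a, OF i] by (simp only: of_nat_le_iff)
    also have "\<dots> = real CARD('b) powr (real ?s - real m)"
      using \<open>m \<le> ?s\<close> b0 by (simp add: powr_realpow[symmetric] of_nat_diff)
    also have "\<dots> \<le> real CARD('b) powr (real ?s - real merit + real ?n)"
      using merit_bounds(2) b2 by (intro powr_mono) auto
    also have "\<dots> = real CARD('b) powr (real ?s - real merit) * real CARD('b) ^ ?n * 1"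
      using b0 by (simp add: powr_add powr_realpow)
    also have "\<dots> \<le> real CARD('b) powr (real ?s - real merit) * real CARD('b) ^ ?n * real ?n powr (real ?n / 2)"
      using n1 by (intro mult_left_mono) (auto intro: ge_one_powr_ge_zero)
    finally show ?thesis by (simp add: mult.assoc)
  next
    case False
    then have "\<And>j. j \<in> u \<Longrightarrow> a j \<le> m" by (auto simp: not_less)
    from card_level_le_of_small[OF this \<open>level a \<noteq> {}\<close>]
    obtain r where r: "merit \<le> r" "r \<le> ?s"
      "(card (level a))\<^sup>2 \<le> (CARD('b) ^ (?s - r))\<^sup>2 * (CARD('b) ^ (2 * ?n) * ?n ^ ?n)" by blast
    have "(real ?n powr (real ?n / 2))\<^sup>2 = real ?n ^ ?n"
      using n1 by (simp add: powr_realpow[symmetric] power2_eq_square powr_add[symmetric])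
    then have "real ((CARD('b) ^ (?s - r))\<^sup>2 * (CARD('b) ^ (2 * ?n) * ?n ^ ?n)) =
        (real CARD('b) ^ (?s - r) * (real CARD('b) ^ ?n * real ?n powr (real ?n / 2)))\<^sup>2"
      by (simp add: power_mult_distrib power_mult[symmetric] mult.commute)
    then have "(real (card (level a)))\<^sup>2 \<le> \<dots>"
      using r(3) by (metis of_nat_le_iff of_nat_power)
    then have "real (card (level a)) \<le> real CARD('b) ^ (?s - r) * (real CARD('b) ^ ?n * real ?n powr (real ?n / 2))"
      by (rule power2_le_imp_le) simp
    also have "real CARD('b) ^ (?s - r) = real CARD('b) powr (real ?s - real r)"
      using r b0 by (simp add: powr_realpow[symmetric] of_nat_diff)
    also have "\<dots> \<le> real CARD('b) powr (real ?s - real merit)"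
      using r b2 by (intro powr_mono) auto
    finally show ?thesis by (simp add: mult_right_mono)
  qed
qed simp

end

section \<open>Walsh weights and compositions\<close>

definition walsh_weight :: "nat \<Rightarrow> real \<Rightarrow> nat set \<Rightarrow> (nat \<Rightarrow> nat) \<Rightarrow> real" where
  "walsh_weight b \<beta> u k = real b powr (- 2 * \<beta> * real (mu_vec b u k))"

text \<open>The value of the series of \<open>b powr (- 2 * \<beta> * mu b k)\<close> over all
  \<open>k \<ge> 1\<close>: there are \<open>(b - 1) * b ^ T\<close> numbers with \<mu> equal to
  \<open>T + 1\<close>, so the series is geometric with ratio
  \<open>b powr (1 - 2 * \<beta>)\<close>.\<close>

definition walsh_sum :: "nat \<Rightarrow> real \<Rightarrow> real" where
  "walsh_sum b \<beta> = (real b - 1) / (real b powr (2 * \<beta>) - real b)"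

lemma walsh_weight_nonneg [simp]: "walsh_weight b \<beta> u k \<ge> 0"
  by (simp add: walsh_weight_def)

lemma walsh_weight_prod:
  assumes "2 \<le> b" "finite u"
  shows "walsh_weight b \<beta> u k = (\<Prod>j\<in>u. real b powr (- 2 * \<beta> * real (mu b (k j))))"
  using assms by (simp add: walsh_weight_def mu_vec_def sum_distrib_left powr_sum)

lemma base_less_powr:
  assumes "2 \<le> b" "\<beta> > 1/2"
  shows "real b < real b powr (2 * \<beta>)"
  using powr_less_mono[of 1 "2 * \<beta>" "real b"] assms by simp

lemma walsh_sum_pos: "2 \<le> b \<Longrightarrow> \<beta> > 1/2 \<Longrightarrow> walsh_sum b \<beta> > 0"
  using base_less_powr[of b \<beta>] by (simp add: walsh_sum_def)

lemma sum_walsh_weight_le: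
  assumes "2 \<le> b" "\<beta> > 1/2"
  shows "(\<Sum>k\<in>{1..<b ^ T}. real b powr (- 2 * \<beta> * real (mu b k))) \<le> walsh_sum b \<beta>"
proof -
  let ?w = "\<lambda>k. real b powr (- 2 * \<beta> * real (mu b k))"
  define x where "x = real b powr (1 - 2 * \<beta>)"
  have b0: "real b > 0" using assms by simp
  have S: "walsh_sum b \<beta> * (1 - x) = (real b - 1) * real b powr (- 2 * \<beta>)"
  proof -
    define P where "P = real b powr (2 * \<beta>)"
    have "x = real b / P" using b0 by (simp add: x_def P_def powr_diff)
    moreover have "P > real b" using base_less_powr[OF assms] by (simp add: P_def)
    ultimately have "1 - x = (P - real b) / P" using b0 by (simp add: diff_divide_distrib)
    then have "walsh_sum b \<beta> * (1 - x) = (real b - 1) / (P - real b) * ((P - real b) / P)"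
      by (simp add: walsh_sum_def P_def)
    also have "\<dots> = (real b - 1) * (1 / P)" using \<open>P > real b\<close> by simp
    also have "1 / P = real b powr (- 2 * \<beta>)" by (simp add: P_def powr_minus_divide)
    finally show ?thesis .
  qed
  have "(\<Sum>k\<in>{1..<b ^ T}. ?w k) = walsh_sum b \<beta> * (1 - x ^ T)"
  proof (induction T)
    case (Suc T)
    have "1 \<le> b ^ T" "b ^ T \<le> b ^ Suc T" using assms by simp_all
    then have "(\<Sum>k\<in>{1..<b ^ Suc T}. ?w k) = (\<Sum>k\<in>{1..<b ^ T}. ?w k) + (\<Sum>k\<in>{b ^ T..<b ^ Suc T}. ?w k)"
      by (rule sum.atLeastLessThan_concat[symmetric])
    also have "(\<Sum>k\<in>{b ^ T..<b ^ Suc T}. ?w k) = (\<Sum>k\<in>{b ^ T..<b ^ Suc T}. real b powr (- 2 * \<beta> * real (Suc T)))"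
    proof (rule sum.cong)
      fix k assume "k \<in> {b ^ T..<b ^ Suc T}"
      then show "?w k = real b powr (- 2 * \<beta> * real (Suc T))"
        using mu_eq[OF assms(1), of T k] by simp
    qed simp
    also have "\<dots> = ((real b - 1) * real b ^ T) * real b powr (- 2 * \<beta> * real (Suc T))"
      using \<open>b ^ T \<le> b ^ Suc T\<close> by (simp add: of_nat_diff left_diff_distrib del: of_nat_Suc)
    also have "\<dots> = (real b - 1) * real b powr (- 2 * \<beta>) * x ^ T"
      using b0 by (simp add: x_def powr_realpow[symmetric] powr_powr powr_add[symmetric] algebra_simps)
    also have "\<dots> = walsh_sum b \<beta> * (1 - x) * x ^ T" by (simp add: S)
    finally show ?case using Suc by (simp add: algebra_simps)
  qed simp
  also have "\<dots> \<le> walsh_sum b \<beta>"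
    using walsh_sum_pos[OF assms] by (simp add: x_def mult_le_cancel_left1)
  finally show ?thesis .
qed

lemma finite_subset_PiE_power:
  fixes u :: "'i set" and F :: "('i \<Rightarrow> nat) set" and b :: nat
  assumes "2 \<le> b" "finite u" "finite F" "F \<subseteq> u \<rightarrow>\<^sub>E {1..}"
  obtains T where "F \<subseteq> u \<rightarrow>\<^sub>E {1..<b ^ T}"
proof
  let ?T = "\<Sum>k\<in>F. \<Sum>j\<in>u. k j"
  show "F \<subseteq> u \<rightarrow>\<^sub>E {1..<b ^ ?T}"
  proof
    fix k assume k: "k \<in> F"
    have "k j < b ^ ?T" if "j \<in> u" for j
    proof -
      have "k j \<le> (\<Sum>j\<in>u. k j)" using member_le_sum[of j u k] that assms by simp
      also have "\<dots> \<le> ?T" using member_le_sum[of k F "\<lambda>k. \<Sum>j\<in>u. k j"] k assms by simp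
      also have "?T < 2 ^ ?T" by (rule less_exp)
      also have "\<dots> \<le> b ^ ?T" using assms by (intro power_mono) auto
      finally show ?thesis .
    qed
    then show "k \<in> u \<rightarrow>\<^sub>E {1..<b ^ ?T}" using k assms(4) by (auto simp: PiE_iff subset_eq)
  qed
qed

lemma sum_walsh_weight_PiE_le:
  assumes "2 \<le> b" "\<beta> > 1/2" "finite u"
  shows "(\<Sum>k\<in>u \<rightarrow>\<^sub>E {1..<b ^ T}. walsh_weight b \<beta> u k) \<le> walsh_sum b \<beta> ^ card u"
proof -
  have "(\<Sum>k\<in>u \<rightarrow>\<^sub>E {1..<b ^ T}. walsh_weight b \<beta> u k) =
      (\<Prod>j\<in>u. \<Sum>k\<in>{1..<b ^ T}. real b powr (- 2 * \<beta> * real (mu b k)))"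
    using assms by (subst prod_sum_PiE) (auto simp: walsh_weight_prod)
  also have "\<dots> \<le> (\<Prod>j\<in>u. walsh_sum b \<beta>)"
    by (intro prod_mono conjI sum_nonneg sum_walsh_weight_le assms(1,2)) auto
  finally show ?thesis by simp
qed

lemma finite_sum_walsh_weight_le:
  assumes "2 \<le> b" "\<beta> > 1/2" "finite u" "finite F" "F \<subseteq> u \<rightarrow>\<^sub>E {1..}"
  shows "(\<Sum>k\<in>F. walsh_weight b \<beta> u k) \<le> walsh_sum b \<beta> ^ card u"
proof -
  obtain T where "F \<subseteq> u \<rightarrow>\<^sub>E {1..<b ^ T}"
    by (rule finite_subset_PiE_power[OF assms(1,3,4,5)])
  then have "(\<Sum>k\<in>F. walsh_weight b \<beta> u k) \<le> (\<Sum>k\<in>u \<rightarrow>\<^sub>E {1..<b ^ T}. walsh_weight b \<beta> u k)"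
    using assms(3) by (intro sum_mono2 finite_PiE) auto
  then show ?thesis using sum_walsh_weight_PiE_le[OF assms(1,2,3), of T] by linarith
qed

lemma walsh_weight_summable:
  assumes "2 \<le> b" "\<beta> > 1/2" "finite u" "A \<subseteq> u \<rightarrow>\<^sub>E {1..}"
  shows "walsh_weight b \<beta> u summable_on A"
  using finite_sum_walsh_weight_le[OF assms(1-3)] assms(4)
  by (intro nonneg_bdd_above_summable_on bdd_aboveI2[where M = "walsh_sum b \<beta> ^ card u"]) auto

section \<open>Compositions and geometric sums over level vectors\<close>

lemma sum_power_le_geometric:
  fixes x :: real
  assumes "0 \<le> x" "x < 1"
  shows "(\<Sum>i\<in>{c..d}. x ^ (i - c)) \<le> 1 / (1 - x)"
proof -
  have "(\<Sum>i\<in>{c..d}. x ^ (i - c)) = (\<Sum>i\<in>(\<lambda>i. i - c) ` {c..d}. x ^ i)"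
    by (rule sum.reindex_cong[symmetric, of "\<lambda>i. i - c"]) (auto simp: inj_on_def)
  also have "\<dots> \<le> (\<Sum>i. x ^ i)"
    using assms by (intro sum_le_suminf summable_geometric) auto
  also have "\<dots> = 1 / (1 - x)" using assms by (intro suminf_geometric) auto
  finally show ?thesis .
qed

definition compositions :: "nat set \<Rightarrow> nat \<Rightarrow> (nat \<Rightarrow> nat) set" where
  "compositions u r = {c \<in> u \<rightarrow>\<^sub>E {1..}. sum c u = r}"

lemma finite_PiE_sum_le:
  assumes "finite u"
  shows "finite {c \<in> u \<rightarrow>\<^sub>E {1..}. sum c u \<le> (r::nat)}"
proof (rule finite_subset)
  show "{c \<in> u \<rightarrow>\<^sub>E {1..}. sum c u \<le> r} \<subseteq> u \<rightarrow>\<^sub>E {1..r}"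
  proof (rule subsetI)
    fix c assume "c \<in> {c \<in> u \<rightarrow>\<^sub>E {1..}. sum c u \<le> r}"
    then have c: "c \<in> u \<rightarrow>\<^sub>E {1..}" "sum c u \<le> r" by auto
    have "c j \<le> r" if "j \<in> u" for j using member_le_sum[of j u c] that assms c by simp
    then show "c \<in> u \<rightarrow>\<^sub>E {1..r}" using c by (auto simp: PiE_iff)
  qed
qed (use assms in \<open>auto intro: finite_PiE\<close>)

text \<open>Chernoff bound: \<open>c\<close> gets the weight \<open>y ^ (sum c v - card v)\<close> with \<open>y = m / (m + card v)\<close>.
  For \<open>v = {}\<close> the right-hand side is \<open>1\<close>, since \<open>(m / 0) ^ 0 = 1\<close>.\<close>

lemma card_PiE_sum_le:
  assumes "finite v" "m \<ge> 1"
  shows "real (card {c \<in> v \<rightarrow>\<^sub>E {1..}. sum c v \<le> m + card v}) \<le>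
    exp (real (card v)) * (real (m + card v) / real (card v)) ^ card v"
proof (cases "v = {}")
  case True
  then have "{c \<in> v \<rightarrow>\<^sub>E {1..}. sum c v \<le> m + card v} = {\<lambda>_. undefined}" by auto
  then show ?thesis using True by simp
next
  case False
  define N where "N = card v"
  define Y where "Y = {c \<in> v \<rightarrow>\<^sub>E {1..}. sum c v \<le> m + N}"
  \<comment> \<open>The bound has the form \<open>(1 / y) ^ m * (1 / (1 - y)) ^ N\<close>, and this
    \<open>y\<close> minimises it. The first factor is then \<open>(1 + N / m) ^ m\<close>, at most
    \<open>exp N\<close>.\<close>
  define y where "y = real m / real (m + N)"
  have N: "N \<ge> 1" using False assms by (simp add: N_def card_gt_0_iff Suc_leI)
  have y: "0 < y" "y < 1" using assms N by (auto simp: y_def)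
  have fY: "finite Y" using finite_PiE_sum_le assms by (simp add: Y_def)
  have Ysub: "Y \<subseteq> v \<rightarrow>\<^sub>E {1..m + N}"
  proof
    fix c assume c: "c \<in> Y"
    have "c j \<le> m + N" if "j \<in> v" for j using member_le_sum[of j v c] that assms c by (simp add: Y_def)
    then show "c \<in> v \<rightarrow>\<^sub>E {1..m + N}" using c by (auto simp: PiE_iff Y_def)
  qed
  have "real (card Y) * y ^ m = (\<Sum>c\<in>Y. y ^ m)" by simp
  also have "\<dots> \<le> (\<Sum>c\<in>Y. \<Prod>j\<in>v. y ^ (c j - 1))"
  proof (rule sum_mono)
    fix c assume c: "c \<in> Y"
    have "(\<Sum>j\<in>v. c j - 1) + N = sum c v"
    proof -
      have "(\<Sum>j\<in>v. c j - 1) + N = (\<Sum>j\<in>v. (c j - 1) + 1)" by (simp only: sum.distrib) (simp add: N_def)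
      also have "\<dots> = sum c v" using c by (intro sum.cong) (auto simp: Y_def PiE_iff)
      finally show ?thesis .
    qed
    then have "(\<Sum>j\<in>v. c j - 1) \<le> m" using c by (simp add: Y_def)
    then have "y ^ m \<le> y ^ (\<Sum>j\<in>v. c j - 1)" using y by (intro power_decreasing) auto
    then show "y ^ m \<le> (\<Prod>j\<in>v. y ^ (c j - 1))" by (simp add: power_sum)
  qed
  also have "\<dots> \<le> (\<Sum>c\<in>v \<rightarrow>\<^sub>E {1..m + N}. \<Prod>j\<in>v. y ^ (c j - 1))"
    using Ysub y assms by (intro sum_mono2 finite_PiE) (auto intro!: prod_nonneg)
  also have "\<dots> = (\<Prod>j\<in>v. \<Sum>i\<in>{1..m + N}. y ^ (i - 1))"
    using assms by (subst prod_sum_PiE) auto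
  also have "\<dots> \<le> (\<Prod>j\<in>v. 1 / (1 - y))"
    using y by (intro prod_mono conjI sum_nonneg sum_power_le_geometric) auto
  also have "\<dots> = (1 / (1 - y)) ^ N" by (simp add: N_def)
  finally have "real (card Y) \<le> (1 / y) ^ m * (1 / (1 - y)) ^ N"
    using y by (simp add: field_simps power_divide)
  also have "1 / (1 - y) = real (m + N) / real N" using assms N by (simp add: y_def field_simps)
  also have "1 / y = 1 + real N / real m" using assms N by (simp add: y_def field_simps)
  also have "(1 + real N / real m) ^ m \<le> exp (real N / real m) ^ m"
    by (intro power_mono exp_ge_add_one_self) auto
  also have "\<dots> = exp (real N)" using assms by (simp add: exp_of_nat_mult[symmetric])
  finally show ?thesis by (simp add: Y_def N_def mult_right_mono)
qed

text \<open>One part is determined by the others. It is at least 1, so the other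
  \<open>card u - 1\<close> parts sum to at most \<open>m + (card u - 1)\<close>. This is the origin
  of the exponent \<open>card u - 1\<close>.\<close>

lemma card_compositions_le:
  assumes "finite u" "u \<noteq> {}" "m \<ge> 1" "r \<le> m + card u"
  shows "finite (compositions u r)"
    and "real (card (compositions u r)) \<le>
      exp (real (card u - 1)) * (real (m + (card u - 1)) / real (card u - 1)) ^ (card u - 1)"
proof -
  show "finite (compositions u r)"
    by (rule finite_subset[OF _ finite_PiE_sum_le[OF assms(1), of r]]) (auto simp: compositions_def)
  obtain i where i: "i \<in> u" using assms by auto
  let ?v = "u - {i}"
  have cv: "card ?v = card u - 1" "card u \<ge> 1" using i assms by (auto simp: card_gt_0_iff Suc_leI)
  let ?Y = "{c \<in> ?v \<rightarrow>\<^sub>E {1..}. sum c ?v \<le> m + card ?v}"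
  have "card (compositions u r) \<le> card ?Y"
  proof (rule card_inj_on_le)
    show "inj_on (\<lambda>c. restrict c ?v) (compositions u r)"
    proof (rule inj_onI)
      fix c d assume cd: "c \<in> compositions u r" "d \<in> compositions u r" "restrict c ?v = restrict d ?v"
      have eq: "c j = d j" if "j \<in> ?v" for j using fun_cong[OF cd(3), of j] that by simp
      then have "sum c ?v = sum d ?v" by (intro sum.cong) auto
      then have "c i = d i" using cd sum.remove[OF assms(1) i, of c] sum.remove[OF assms(1) i, of d]
        by (simp add: compositions_def)
      then have "c j = d j" if "j \<in> u" for j using eq that by (cases "j = i") auto
      then show "c = d" using cd by (intro PiE_ext[of c u "\<lambda>_. {1..}" d]) (auto simp: compositions_def)
    qed
    show "(\<lambda>c. restrict c ?v) ` compositions u r \<subseteq> ?Y"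
    proof (rule image_subsetI)
      fix c assume c: "c \<in> compositions u r"
      then have "c i \<ge> 1" "sum c u = c i + sum c ?v"
        using i sum.remove[OF assms(1) i, of c] by (auto simp: compositions_def PiE_iff)
      then show "restrict c ?v \<in> ?Y" using c assms(4) cv by (auto simp: compositions_def PiE_iff)
    qed
    show "finite ?Y" using assms by (intro finite_PiE_sum_le) auto
  qed
  then have "real (card (compositions u r)) \<le> real (card ?Y)" by simp
  also note card_PiE_sum_le[of ?v m]
  finally show "real (card (compositions u r)) \<le>
      exp (real (card u - 1)) * (real (m + (card u - 1)) / real (card u - 1)) ^ (card u - 1)"
    using assms unfolding cv by simp
qed

text \<open>Parts larger than 1 are lowered one unit at a time; as long as the sum exceeds
  \<open>r \<ge> card u\<close>, such a part exists.\<close>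

lemma composition_below:
  assumes "finite u" "a \<in> u \<rightarrow>\<^sub>E {1..}" "card u \<le> r" "r \<le> sum a u"
  shows "\<exists>c\<in>compositions u r. \<forall>j\<in>u. c j \<le> a j"
  using assms(2,4)
proof (induction "sum a u" arbitrary: a)
  case (Suc s)
  show ?case
  proof (cases "sum a u = r")
    case False
    then have "card u < sum a u" using Suc assms(3) by simp
    have "\<exists>j\<in>u. 1 < a j"
    proof (rule ccontr)
      assume "\<not> ?thesis"
      then have "sum a u \<le> (\<Sum>j\<in>u. 1)" by (intro sum_mono) (simp add: not_less)
      then show False using \<open>card u < sum a u\<close> by simp
    qed
    then obtain j where j: "j \<in> u" "1 < a j" by blast
    let ?a = "a(j := a j - 1)"
    have "sum ?a (u - {j}) = sum a (u - {j})" by (rule sum.cong) auto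
    then have sum: "sum ?a u = s"
      using Suc(2) j sum.remove[OF assms(1) j(1), of a] sum.remove[OF assms(1) j(1), of ?a] by simp
    have "\<exists>c\<in>compositions u r. \<forall>i\<in>u. c i \<le> ?a i"
    proof (rule Suc(1))
      show "s = sum ?a u" by (rule sum[symmetric])
      show "?a \<in> u \<rightarrow>\<^sub>E {1..}" using Suc(3) j by (auto simp: PiE_iff extensional_def)
      show "r \<le> sum ?a u" using Suc(2,4) False sum by simp
    qed
    then obtain c where c: "c \<in> compositions u r" "\<forall>i\<in>u. c i \<le> ?a i" by blast
    have "c i \<le> a i" if "i \<in> u" for i using bspec[OF c(2) that] by (cases "i = j") simp_all
    then show ?thesis using c(1) by blast
  qed (use Suc in \<open>auto simp: compositions_def\<close>)
qed (auto simp: compositions_def)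

text \<open>Each vector \<open>a\<close> of \<open>X\<close> lies above some composition
  \<open>c\<close> of \<open>r\<close>, and its excess is the sum of the differences
  \<open>a j - c j\<close>. Summing over all \<open>a\<close> above a fixed \<open>c\<close>
  factorises into geometric series; vectors above several compositions are merely counted
  repeatedly.\<close>

lemma sum_power_excess_le:
  fixes x :: real
  assumes "finite u" "0 < x" "x < 1" "finite X" "X \<subseteq> u \<rightarrow>\<^sub>E {1..}" "card u \<le> r"
    and "\<And>a. a \<in> X \<Longrightarrow> r \<le> sum a u" and fin: "finite (compositions u r)"
  shows "(\<Sum>a\<in>X. x ^ (sum a u - r)) \<le> real (card (compositions u r)) * (1 / (1 - x)) ^ card u"
proof -
  let ?C = "compositions u r"
  define below where "below c a \<longleftrightarrow> (\<forall>j\<in>u. c j \<le> a j)" for c a :: "nat \<Rightarrow> nat"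
  define M where "M = (\<Sum>a\<in>X. sum a u)"
  have XM: "a j \<le> M" if "a \<in> X" "j \<in> u" for a j
  proof -
    have "a j \<le> sum a u" using member_le_sum[of j u a] that assms by simp
    also have "\<dots> \<le> M" unfolding M_def using member_le_sum[of a X "\<lambda>a. sum a u"] that assms by simp
    finally show ?thesis .
  qed
  have eq: "x ^ (sum a u - r) = (\<Prod>j\<in>u. x ^ (a j - c j))" if "c \<in> ?C" "below c a" for a c
  proof -
    have "(\<Sum>j\<in>u. a j - c j) = sum a u - sum c u" using that by (intro sum_subtractf_nat) (simp add: below_def)
    then show ?thesis using that by (simp add: power_sum[symmetric] compositions_def)
  qed
  have "(\<Sum>a\<in>X. x ^ (sum a u - r)) \<le> (\<Sum>a\<in>X. \<Sum>c\<in>?C. if below c a then \<Prod>j\<in>u. x ^ (a j - c j) else 0)"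
  proof (rule sum_mono)
    fix a assume a: "a \<in> X"
    then obtain c where c: "c \<in> ?C" "below c a"
      using composition_below[of u a r] assms by (auto simp: below_def)
    then have "x ^ (sum a u - r) = (\<Sum>c\<in>{c}. if below c a then \<Prod>j\<in>u. x ^ (a j - c j) else 0)"
      using eq by simp
    also have "\<dots> \<le> (\<Sum>c\<in>?C. if below c a then \<Prod>j\<in>u. x ^ (a j - c j) else 0)"
      using c assms(2) by (intro sum_mono2 fin) (auto intro!: prod_nonneg)
    finally show "x ^ (sum a u - r) \<le> \<dots>" .
  qed
  also have "\<dots> = (\<Sum>c\<in>?C. \<Sum>a\<in>X. if below c a then \<Prod>j\<in>u. x ^ (a j - c j) else 0)"
    by (rule sum.swap)
  also have "\<dots> \<le> (\<Sum>c\<in>?C. (1 / (1 - x)) ^ card u)"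
  proof (rule sum_mono)
    fix c assume c: "c \<in> ?C"
    have "(\<Sum>a\<in>X. if below c a then \<Prod>j\<in>u. x ^ (a j - c j) else 0) =
        (\<Sum>a\<in>{a\<in>X. below c a}. \<Prod>j\<in>u. x ^ (a j - c j))"
      using assms by (simp add: sum.inter_filter)
    also have "\<dots> \<le> (\<Sum>a\<in>(\<Pi>\<^sub>E j\<in>u. {c j..M}). \<Prod>j\<in>u. x ^ (a j - c j))"
    proof (rule sum_mono2)
      show "finite (\<Pi>\<^sub>E j\<in>u. {c j..M})" using assms by (intro finite_PiE) auto
      show "{a\<in>X. below c a} \<subseteq> (\<Pi>\<^sub>E j\<in>u. {c j..M})"
        using XM assms(5) by (auto simp: below_def PiE_iff subset_eq)
    qed (use assms in \<open>auto intro!: prod_nonneg\<close>)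
    also have "\<dots> = (\<Prod>j\<in>u. \<Sum>i\<in>{c j..M}. x ^ (i - c j))"
      using assms by (subst prod_sum_PiE) auto
    also have "\<dots> \<le> (\<Prod>j\<in>u. 1 / (1 - x))"
      using assms by (intro prod_mono conjI sum_nonneg sum_power_le_geometric) auto
    finally show "(\<Sum>a\<in>X. if below c a then \<Prod>j\<in>u. x ^ (a j - c j) else 0) \<le> (1 / (1 - x)) ^ card u"
      by simp
  qed
  finally show ?thesis by simp
qed

section \<open>Change of smoothness and weights\<close>

definition ratio_base :: "nat \<Rightarrow> real \<Rightarrow> real" where
  "ratio_base b \<alpha> = real b powr (2 * \<alpha> - 1) * (real b - 1) / (real b powr (2 * \<alpha> - 1) - 1)"

text \<open>The base of the ratio sum serves twice: it dominates the geometric factor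
  \<open>1 / (1 - x)\<close>, with equality for \<open>b = 2\<close>, and it is
  \<open>b powr (2 * \<alpha>)\<close> times the full one-dimensional sum.\<close>

lemma ratio_base_props:
  assumes "2 \<le> b" "\<alpha> > 1/2"
  defines "x \<equiv> real b powr (1 - 2 * \<alpha>)"
  shows "0 < x" "x < 1" "1 / (1 - x) \<le> ratio_base b \<alpha>" "ratio_base b \<alpha> > 0"
    "walsh_sum b \<alpha> = ratio_base b \<alpha> * real b powr (- 2 * \<alpha>)"
proof -
  define P where "P = real b powr (2 * \<alpha> - 1)"
  have b: "real b \<ge> 2" using assms by simp
  have P: "P > 1" using powr_less_mono[of 0 "2 * \<alpha> - 1" "real b"] assms by (simp add: P_def)
  have x: "x = 1 / P" unfolding x_def P_def using powr_minus_divide[of "real b" "2 * \<alpha> - 1"] by simp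
  show "0 < x" "x < 1" using P by (auto simp: x)
  have c: "ratio_base b \<alpha> = (real b - 1) * (P / (P - 1))" by (simp add: ratio_base_def P_def)
  have g: "1 / (1 - x) = P / (P - 1)" using P by (simp add: x field_simps)
  have "1 * (P / (P - 1)) \<le> (real b - 1) * (P / (P - 1))"
    using P b by (intro mult_right_mono) auto
  then show "1 / (1 - x) \<le> ratio_base b \<alpha>" by (simp add: c g)
  show "ratio_base b \<alpha> > 0" using P b by (simp add: c)
  have bP: "real b powr (2 * \<alpha>) = real b * P"
    using b by (simp add: P_def powr_diff)
  have "real b powr (- 2 * \<alpha>) = 1 / (real b * P)"
    unfolding bP[symmetric] by (simp add: powr_minus_divide)
  moreover have "walsh_sum b \<alpha> = (real b - 1) / (real b * P - real b)"
    by (simp only: walsh_sum_def bP)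
  moreover have "(real b - 1) / (real b * P - real b) = (real b - 1) * (P / (P - 1)) * (1 / (real b * P))"
  proof -
    have "real b * P - real b = real b * (P - 1)" by (simp add: algebra_simps)
    then show ?thesis using P b by simp
  qed
  ultimately show "walsh_sum b \<alpha> = ratio_base b \<alpha> * real b powr (- 2 * \<alpha>)"
    by (simp only: c)
qed

context generating_vector
begin

lemma dual_subset: "dual_net m p q u \<subseteq> u \<rightarrow>\<^sub>E {1..}"
  by (auto simp: dual_net_iff)

lemma finite_dual_sum_le:
  assumes \<alpha>: "\<alpha> > 1/2" and m: "m \<ge> 1" and F: "finite F" "F \<subseteq> dual_net m p q u"
  defines "N \<equiv> card u - 1"
  shows "(\<Sum>k\<in>F. walsh_weight CARD('b) \<alpha> u k) \<le>
    real CARD('b) powr (- 2 * \<alpha> * real merit) * (real CARD('b) ^ card u * real (card u) powr (real (card u) / 2)) *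
    (exp (real N) * (real (m + N) / real N) ^ N * (1 / (1 - real CARD('b) powr (1 - 2 * \<alpha>))) ^ card u)"
proof -
  let ?b = "CARD('b)"
  define x where "x = real ?b powr (1 - 2 * \<alpha>)"
  define B where "B = real ?b ^ card u * real (card u) powr (real (card u) / 2)"
  define lev where "lev k = restrict (\<lambda>j. mu ?b (k j)) u" for k
  have x: "0 < x" "x < 1" using ratio_base_props[OF b2 \<alpha>] by (auto simp: x_def)
  have b0: "real ?b > 0" using b2 by simp
  have sum_lev: "sum (lev k) u = mu_vec ?b u k" for k by (simp add: lev_def mu_vec_def)
  have lev_ge: "merit \<le> sum (lev k) u" if "k \<in> F" for k using merit_le F that by (auto simp: sum_lev)
  have "(\<Sum>k\<in>F. walsh_weight ?b \<alpha> u k) = (\<Sum>a\<in>lev ` F. \<Sum>k\<in>{k\<in>F. lev k = a}. walsh_weight ?b \<alpha> u k)"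
    by (rule sum.image_gen[OF F(1)])
  also have "\<dots> \<le> (\<Sum>a\<in>lev ` F. real ?b powr (- 2 * \<alpha> * real merit) * B * x ^ (sum a u - merit))"
  proof (rule sum_mono)
    fix a assume "a \<in> lev ` F"
    then have a: "merit \<le> sum a u" using lev_ge by auto
    have sub: "{k\<in>F. lev k = a} \<subseteq> level a"
      using F(2) by (auto simp: level_def lev_def)
    have "(\<Sum>k\<in>{k\<in>F. lev k = a}. walsh_weight ?b \<alpha> u k) =
        real (card {k\<in>F. lev k = a}) * real ?b powr (- 2 * \<alpha> * real (sum a u))"
      by (simp add: walsh_weight_def sum_lev[symmetric])
    also have "\<dots> \<le> real (card (level a)) * real ?b powr (- 2 * \<alpha> * real (sum a u))"
      using card_mono[OF finite_level sub] by (intro mult_right_mono) auto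
    also have "\<dots> \<le> real ?b powr (real (sum a u) - real merit) * B * real ?b powr (- 2 * \<alpha> * real (sum a u))"
      using card_level_le[of a] by (intro mult_right_mono) (auto simp: B_def)
    also have "\<dots> = real ?b powr (- 2 * \<alpha> * real merit) * B * x ^ (sum a u - merit)"
    proof -
      have "x ^ (sum a u - merit) = real ?b powr ((1 - 2 * \<alpha>) * (real (sum a u) - real merit))"
        using b0 a by (simp add: x_def powr_realpow[symmetric] powr_powr of_nat_diff)
      then show ?thesis by (simp add: powr_add[symmetric] algebra_simps)
    qed
    finally show "(\<Sum>k\<in>{k\<in>F. lev k = a}. walsh_weight ?b \<alpha> u k) \<le> \<dots>" .
  qed
  also have "\<dots> = real ?b powr (- 2 * \<alpha> * real merit) * B * (\<Sum>a\<in>lev ` F. x ^ (sum a u - merit))"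
    by (simp add: sum_distrib_left)
  also have "\<dots> \<le> real ?b powr (- 2 * \<alpha> * real merit) * B *
      (exp (real N) * (real (m + N) / real N) ^ N * (1 / (1 - x)) ^ card u)"
  proof (rule mult_left_mono)
    have fin: "finite (compositions u merit)"
      and card: "real (card (compositions u merit)) \<le> exp (real N) * (real (m + N) / real N) ^ N"
      using card_compositions_le[OF finite_u nonempty_u m merit_bounds(2)] by (auto simp: N_def)
    have "(\<Sum>a\<in>lev ` F. x ^ (sum a u - merit)) \<le> real (card (compositions u merit)) * (1 / (1 - x)) ^ card u"
    proof (rule sum_power_excess_le[OF finite_u x _ _ merit_bounds(1) _ fin])
      show "lev ` F \<subseteq> u \<rightarrow>\<^sub>E {1..}"
      proof (rule image_subsetI)
        fix k assume "k \<in> F"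
        then have "k \<in> u \<rightarrow>\<^sub>E {1..}" using F(2) dual_subset by blast
        then show "lev k \<in> u \<rightarrow>\<^sub>E {1..}" using mu_bounds(3)[OF b2] by (simp add: lev_def PiE_iff)
      qed
    qed (use F lev_ge in auto)
    also have "\<dots> \<le> exp (real N) * (real (m + N) / real N) ^ N * (1 / (1 - x)) ^ card u"
      using card x by (intro mult_right_mono) auto
    finally show "(\<Sum>a\<in>lev ` F. x ^ (sum a u - merit)) \<le> \<dots>" .
  qed (simp add: B_def)
  finally show ?thesis by (simp add: B_def x_def)
qed

end

text \<open>The loss \<open>n ^ (n / 2)\<close> in the level count, together with any exponential
  factor, is dominated by the denominator \<open>N ^ N\<close> from the number of compositions. For
  \<open>N = 0\<close> that denominator is \<open>0 ^ 0 = 1\<close>.\<close>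

lemma bounded_growth:
  fixes D :: real
  assumes "D > 1"
  obtains K where "K > 0" "\<And>N::nat. D ^ N * real (Suc N) powr (real (Suc N) / 2) / real N ^ N \<le> K"
proof -
  have "((\<lambda>N::nat. D ^ N * real (Suc N) powr (real (Suc N) / 2) / real N ^ N) \<longlongrightarrow> 0) at_top"
    using assms by real_asymp
  then have "Bseq (\<lambda>N::nat. D ^ N * real (Suc N) powr (real (Suc N) / 2) / real N ^ N)"
    by (intro convergent_imp_Bseq convergentI)
  then obtain K where "K > 0" "\<And>N::nat. norm (D ^ N * real (Suc N) powr (real (Suc N) / 2) / real N ^ N) \<le> K"
    by (auto elim!: BseqE)
  then show thesis using that[of K] by (metis abs_ge_self order_trans real_norm_def)
qed

text \<open>With \<open>N = card u - 1\<close>: if \<open>(m + 1) ^ N \<ge> b powr (2 \<alpha> m)\<close>, the bound by the sum over all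
  \<open>k\<close> suffices because the merit is at most \<open>m + card u\<close>. Otherwise \<open>N \<le> L m\<close>, and the division by
  \<open>N ^ N\<close> in the number of compositions absorbs the loss in \<open>card_level_le\<close>.\<close>

lemma exists_dual_sum_const:
  fixes \<alpha> :: real
  assumes \<alpha>: "\<alpha> > 1/2"
  obtains K where "K > 0"
    "\<And>m (p :: 'b::prime_card mod_ring poly) q u. generating_vector m p q u \<Longrightarrow> m \<ge> 1 \<Longrightarrow>
       \<exists>k\<in>dual_net m p q u. infsum (walsh_weight CARD('b) \<alpha> u) (dual_net m p q u) \<le>
         K * (ratio_base CARD('b) \<alpha> ^ card u * real (m + 1) ^ (card u - 1)) * walsh_weight CARD('b) \<alpha> u k"
proof -
  let ?b = "CARD('b)" and ?c = "ratio_base CARD('b) \<alpha>"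
  note b2 = card_prime_card_ge_2[where 'b='b]
  note rb = ratio_base_props[OF b2 \<alpha>]
  \<comment> \<open>Since \<open>m + 1 \<ge> 2\<close>, the inequality
    \<open>(m + 1) ^ N < b powr (2 * \<alpha> * m)\<close> gives
    \<open>2 ^ N < b powr (2 * \<alpha> * m)\<close>; logarithms turn this into
    \<open>N \<le> L * m\<close>.\<close>
  define L where "L = 2 * \<alpha> * ln (real ?b) / ln 2"
  have L: "L > 0" using b2 \<alpha> by (simp add: L_def)
  \<comment> \<open>Collects what is raised to the power \<open>N\<close>: \<open>b\<close> from the
    level count, \<open>exp 1\<close> from the Chernoff bound and \<open>1 + L\<close> from
    \<open>m + N \<le> (1 + L) * (m + 1)\<close>.\<close>
  define D where "D = real ?b * exp 1 * (1 + L)"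
  have "D > 1"
  proof -
    have "1 * 1 < real ?b * exp 1" using b2 by (intro mult_strict_mono) auto
    then have "1 * 1 < (real ?b * exp 1) * (1 + L)" using L by (intro mult_strict_mono) auto
    then show ?thesis by (simp add: D_def)
  qed
  then obtain K where K: "K > 0" "\<And>N::nat. D ^ N * real (Suc N) powr (real (Suc N) / 2) / real N ^ N \<le> K"
    by (rule bounded_growth) blast
  \<comment> \<open>The summand 1 serves the case of large \<open>N\<close>. In the other case
    \<open>b ^ n = b * b ^ N\<close> leaves one factor \<open>b\<close> outside
    \<open>D ^ N\<close>.\<close>
  define K' where "K' = 1 + real ?b * K"
  have K': "1 \<le> K'" "real ?b * K \<le> K'" using K b2 by (auto simp: K'_def)
  show thesis
  proof (rule that)
    show "K' > 0" using K' by simp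
    fix m and p :: "'b mod_ring poly" and q u
    assume gv: "generating_vector m p q u" and m: "m \<ge> 1"
    interpret generating_vector m p q u by (rule gv)
    obtain k where k: "k \<in> dual_net m p q u" "mu_vec ?b u k = merit" using merit_attained by blast
    define n where "n = card u"
    define N where "N = n - 1"
    have n: "n = Suc N" using nonempty_u finite_u by (simp add: n_def N_def card_gt_0_iff)
    define w where "w = real ?b powr (- 2 * \<alpha> * real merit)"
    have w: "w = walsh_weight ?b \<alpha> u k" "w \<ge> 0" by (auto simp: w_def walsh_weight_def k)
    have summable: "walsh_weight ?b \<alpha> u summable_on dual_net m p q u"
      by (rule walsh_weight_summable[OF b2 \<alpha> finite_u dual_subset])
    have "infsum (walsh_weight ?b \<alpha> u) (dual_net m p q u) \<le> K' * (?c ^ n * real (m + 1) ^ N) * w"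
    proof (rule infsum_le_finite_sums[OF summable])
      fix F assume F: "finite F" "F \<subseteq> dual_net m p q u"
      show "(\<Sum>k\<in>F. walsh_weight ?b \<alpha> u k) \<le> K' * (?c ^ n * real (m + 1) ^ N) * w"
      proof (cases "real ?b powr (2 * \<alpha> * real m) \<le> real (m + 1) ^ N")
        case True
        have "(\<Sum>k\<in>F. walsh_weight ?b \<alpha> u k) \<le> walsh_sum ?b \<alpha> ^ n"
          unfolding n_def using F dual_subset by (intro finite_sum_walsh_weight_le[OF b2 \<alpha> finite_u]) auto
        also have "\<dots> = ?c ^ n * real ?b powr (- 2 * \<alpha> * real n)"
          using b2 by (simp add: rb(5) power_mult_distrib powr_realpow[symmetric] powr_powr)
        also have "\<dots> \<le> ?c ^ n * (real ?b powr (2 * \<alpha> * real m) * w)"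
        proof -
          have "real merit \<le> real m + real n" using merit_bounds(2) unfolding n_def by linarith
          then have "2 * \<alpha> * real merit \<le> 2 * \<alpha> * (real m + real n)" using \<alpha> by (intro mult_left_mono) auto
          then have "real ?b powr (- 2 * \<alpha> * real n) \<le> real ?b powr (2 * \<alpha> * real m + - 2 * \<alpha> * real merit)"
            using b2 by (intro powr_mono) (auto simp: algebra_simps)
          also have "\<dots> = real ?b powr (2 * \<alpha> * real m) * w" by (simp only: powr_add w_def)
          finally show ?thesis using rb(4) by (intro mult_left_mono) auto
        qed
        also have "\<dots> \<le> ?c ^ n * (real (m + 1) ^ N * w)"
          using rb(4) w(2) True by (intro mult_left_mono mult_right_mono) auto
        also have "\<dots> = 1 * (?c ^ n * real (m + 1) ^ N) * w" by simp
        also have "\<dots> \<le> K' * (?c ^ n * real (m + 1) ^ N) * w"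
          using K' rb(4) w(2) by (intro mult_right_mono) auto
        finally show ?thesis .
      next
        case False
        have "(2::real) ^ N \<le> real (m + 1) ^ N" using m by (intro power_mono) auto
        then have "(2::real) ^ N < real ?b powr (2 * \<alpha> * real m)" using False by linarith
        then have "ln ((2::real) ^ N) < ln (real ?b powr (2 * \<alpha> * real m))"
          using b2 by (subst ln_less_cancel_iff) auto
        then have "real N * ln 2 < 2 * \<alpha> * real m * ln (real ?b)"
          using b2 by (simp add: ln_realpow ln_powr)
        then have "real N \<le> L * real m" by (simp add: L_def field_simps)
        then have "real (m + N) \<le> (1 + L) * real (m + 1)" using L by (simp add: algebra_simps)
        then have "(real (m + N) / real N) ^ N \<le> ((1 + L) * real (m + 1) / real N) ^ N"
          by (intro power_mono divide_right_mono) auto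
        also have "\<dots> = (1 + L) ^ N * real (m + 1) ^ N / real N ^ N"
          by (simp add: power_mult_distrib power_divide)
        finally have ratio: "(real (m + N) / real N) ^ N \<le> \<dots>" .
        have geom: "(1 / (1 - real ?b powr (1 - 2 * \<alpha>))) ^ n \<le> ?c ^ n"
          using rb by (intro power_mono) auto
        have "(\<Sum>k\<in>F. walsh_weight ?b \<alpha> u k) \<le> w * (real ?b ^ n * real n powr (real n / 2)) *
            (exp (real N) * (real (m + N) / real N) ^ N * (1 / (1 - real ?b powr (1 - 2 * \<alpha>))) ^ n)"
          using finite_dual_sum_le[OF \<alpha> m F] by (simp add: w_def n_def N_def)
        also have "\<dots> \<le> w * (real ?b ^ n * real n powr (real n / 2)) *
            (exp (real N) * ((1 + L) ^ N * real (m + 1) ^ N / real N ^ N) * ?c ^ n)"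
          using w(2) rb L by (intro mult_left_mono mult_mono ratio geom) auto
        also have "\<dots> = (real ?b * (D ^ N * real (Suc N) powr (real (Suc N) / 2) / real N ^ N)) *
            (?c ^ n * real (m + 1) ^ N) * w"
          by (simp add: D_def n power_mult_distrib exp_of_nat_mult[symmetric] mult_ac)
        also have "\<dots> \<le> K' * (?c ^ n * real (m + 1) ^ N) * w"
          using K(2)[of N] K'(2) b2 rb(4) w(2)
          by (intro mult_right_mono order_trans[OF mult_left_mono K'(2)]) auto
        finally show ?thesis .
      qed
    qed
    then show "\<exists>k\<in>dual_net m p q u. infsum (walsh_weight ?b \<alpha> u) (dual_net m p q u) \<le>
         K' * (?c ^ card u * real (m + 1) ^ (card u - 1)) * walsh_weight ?b \<alpha> u k"
      using k(1) w(1) by (auto simp: n_def N_def)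
  qed
qed

section \<open>Transfer between two smoothness parameters and families of weights\<close>

lemma wce_sq_eq:
  "wce_sq \<alpha> \<gamma> m p l q = (\<Sum>u\<in>nonempty_subsets l.
     \<gamma> u * infsum (walsh_weight CARD('b) \<alpha> u) (dual_net m (p :: 'b::prime_card mod_ring poly) q u))"
  by (simp add: wce_sq_def infsum_cmult_right' walsh_weight_def[abs_def])

lemma finite_nonempty_subsets: "finite (nonempty_subsets s)"
  by (simp add: nonempty_subsets_def)

lemma nonempty_subsetsD:
  assumes "u \<in> nonempty_subsets s"
  shows "finite u" "u \<noteq> {}" "u \<subseteq> {1..s}" "index_set u"
  using assms finite_subset[of u "{1..s}"] by (auto simp: nonempty_subsets_def index_set_def)

lemma weightsD: "weights \<gamma> \<Longrightarrow> u \<in> nonempty_subsets s \<Longrightarrow> \<gamma> u \<ge> 0"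
  using nonempty_subsetsD(4) by (auto simp: weights_def)

lemma generating_vector_subset:
  assumes "Factorial_Ring.irreducible p" "Polynomial.degree p = m"
    and "q \<in> {1..s} \<rightarrow>\<^sub>E polys_below m - {0}" "u \<in> nonempty_subsets s"
  shows "generating_vector m p q u"
  using assms nonempty_subsetsD[OF assms(4)] by unfold_locales (auto simp: PiE_iff)

lemma infsum_walsh_weight_nonneg: "infsum (walsh_weight b \<alpha> u) A \<ge> 0"
  by (intro infsum_nonneg) simp

lemma wce_sq_nonneg: "weights \<gamma> \<Longrightarrow> wce_sq \<alpha> \<gamma> m p l q \<ge> 0"
  unfolding wce_sq_eq by (intro sum_nonneg mult_nonneg_nonneg infsum_walsh_weight_nonneg weightsD)

text \<open>Raising \<open>walsh_weight b \<alpha> u k \<le> W / \<gamma> u\<close> to the power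
  \<alpha>'/\<alpha> replaces the smoothness on the left by \<alpha>' and produces the weight ratio
  on the right. The constant is fixed before the weights, \<open>m\<close>, \<open>s\<close>,
  \<open>p\<close> and \<open>q\<close>. Real division by 0 yields 0, so the last hypothesis
  excludes the terms that should be infinite.\<close>

lemma exists_transfer_const:
  fixes \<alpha> \<alpha>' :: real
  assumes \<alpha>: "\<alpha> > 1/2" and \<alpha>': "\<alpha>' > 1/2"
  obtains K where "K > 0"
    "\<And>\<gamma> \<gamma>' m s (p :: 'b::prime_card mod_ring poly) q. \<lbrakk>weights \<gamma>; weights \<gamma>'; m \<ge> 1;
       Factorial_Ring.irreducible p; Polynomial.degree p = m; q \<in> {1..s} \<rightarrow>\<^sub>E polys_below m - {0};
       \<And>u. u \<in> nonempty_subsets s \<Longrightarrow> \<gamma> u = 0 \<Longrightarrow> \<gamma>' u = 0\<rbrakk> \<Longrightarrow>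
       wce_sq \<alpha>' \<gamma>' m p s q \<le> K * wce_sq \<alpha> \<gamma> m p s q powr (\<alpha>' / \<alpha>) *
         (\<Sum>u\<in>nonempty_subsets s. \<gamma>' u / \<gamma> u powr (\<alpha>' / \<alpha>) *
           (ratio_base CARD('b) \<alpha>' ^ card u * real (m + 1) ^ (card u - 1)))"
proof -
  let ?b = "CARD('b)"
  note b2 = card_prime_card_ge_2[where 'b='b]
  obtain K where K: "K > 0"
    "\<And>m (p :: 'b mod_ring poly) q u. generating_vector m p q u \<Longrightarrow> m \<ge> 1 \<Longrightarrow>
       \<exists>k\<in>dual_net m p q u. infsum (walsh_weight ?b \<alpha>' u) (dual_net m p q u) \<le>
         K * (ratio_base ?b \<alpha>' ^ card u * real (m + 1) ^ (card u - 1)) * walsh_weight ?b \<alpha>' u k"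
    by (rule exists_dual_sum_const[OF \<alpha>', where 'b='b]) blast
  show thesis
  proof (rule that[OF K(1)])
    fix \<gamma> \<gamma>' m s and p :: "'b mod_ring poly" and q :: "nat \<Rightarrow> 'b mod_ring poly"
    assume \<gamma>: "weights \<gamma>" and \<gamma>': "weights \<gamma>'" and m: "m \<ge> 1"
      and p: "Factorial_Ring.irreducible p" "Polynomial.degree p = m"
      and q: "q \<in> {1..s} \<rightarrow>\<^sub>E polys_below m - {0}"
      and zero: "\<And>u. u \<in> nonempty_subsets s \<Longrightarrow> \<gamma> u = 0 \<Longrightarrow> \<gamma>' u = 0"
    define W where "W = wce_sq \<alpha> \<gamma> m p s q"
    have summand: "\<gamma>' u * infsum (walsh_weight ?b \<alpha>' u) (dual_net m p q u) \<le>
        K * W powr (\<alpha>' / \<alpha>) * (\<gamma>' u / \<gamma> u powr (\<alpha>' / \<alpha>) *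
           (ratio_base ?b \<alpha>' ^ card u * real (m + 1) ^ (card u - 1)))"
      if u: "u \<in> nonempty_subsets s" for u
    proof (cases "\<gamma> u = 0")
      case False
      define R where "R = ratio_base ?b \<alpha>' ^ card u * real (m + 1) ^ (card u - 1)"
      have R: "R \<ge> 0" using ratio_base_props(4)[OF b2 \<alpha>'] by (simp add: R_def)
      have \<gamma>u: "\<gamma> u > 0" "\<gamma>' u \<ge> 0" using weightsD[OF \<gamma> u] weightsD[OF \<gamma>' u] False by auto
      interpret generating_vector m p q u by (rule generating_vector_subset[OF p q u])
      obtain k where k: "k \<in> dual_net m p q u"
        "infsum (walsh_weight ?b \<alpha>' u) (dual_net m p q u) \<le> K * R * walsh_weight ?b \<alpha>' u k"
        using K(2)[OF generating_vector_axioms m] by (auto simp: R_def)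
      have "(\<Sum>k\<in>{k}. walsh_weight ?b \<alpha> u k) \<le> infsum (walsh_weight ?b \<alpha> u) (dual_net m p q u)"
        using k(1) by (intro finite_sum_le_infsum walsh_weight_summable[OF b2 \<alpha> finite_u dual_subset]) auto
      then have "\<gamma> u * walsh_weight ?b \<alpha> u k \<le> \<gamma> u * infsum (walsh_weight ?b \<alpha> u) (dual_net m p q u)"
        using \<gamma>u by simp
      also have "\<dots> \<le> W"
        unfolding W_def wce_sq_eq using u weightsD[OF \<gamma>]
        by (intro member_le_sum[where f = "\<lambda>u. \<gamma> u * infsum (walsh_weight ?b \<alpha> u) (dual_net m p q u)"])
           (auto simp: finite_nonempty_subsets infsum_walsh_weight_nonneg)
      finally have "walsh_weight ?b \<alpha> u k \<le> W / \<gamma> u" using \<gamma>u by (simp add: field_simps)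
      then have "walsh_weight ?b \<alpha> u k powr (\<alpha>' / \<alpha>) \<le> (W / \<gamma> u) powr (\<alpha>' / \<alpha>)"
        using \<alpha> \<alpha>' by (intro powr_mono2) auto
      moreover have "walsh_weight ?b \<alpha>' u k = walsh_weight ?b \<alpha> u k powr (\<alpha>' / \<alpha>)"
        using \<alpha> by (simp add: walsh_weight_def powr_powr mult_ac)
      moreover have "W \<ge> 0" unfolding W_def by (rule wce_sq_nonneg[OF \<gamma>])
      ultimately have "walsh_weight ?b \<alpha>' u k \<le> W powr (\<alpha>' / \<alpha>) / \<gamma> u powr (\<alpha>' / \<alpha>)"
        using \<gamma>u by (simp add: powr_divide)
      then have "K * R * walsh_weight ?b \<alpha>' u k \<le> K * R * (W powr (\<alpha>' / \<alpha>) / \<gamma> u powr (\<alpha>' / \<alpha>))"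
        using K(1) R by (intro mult_left_mono) auto
      with k(2) have "\<gamma>' u * infsum (walsh_weight ?b \<alpha>' u) (dual_net m p q u) \<le>
          \<gamma>' u * (K * R * (W powr (\<alpha>' / \<alpha>) / \<gamma> u powr (\<alpha>' / \<alpha>)))"
        using \<gamma>u by (intro mult_left_mono) auto
      then show ?thesis by (simp add: R_def mult_ac)
    qed (simp add: zero[OF u])
    show "wce_sq \<alpha>' \<gamma>' m p s q \<le> K * W powr (\<alpha>' / \<alpha>) *
         (\<Sum>u\<in>nonempty_subsets s. \<gamma>' u / \<gamma> u powr (\<alpha>' / \<alpha>) *
           (ratio_base CARD('b) \<alpha>' ^ card u * real (m + 1) ^ (card u - 1)))"
      unfolding wce_sq_eq sum_distrib_left by (intro sum_mono summand)
  qed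
qed

section \<open>The component-by-component bound\<close>

lemma powr_add_le_add_powr:
  fixes x y r :: real
  assumes "x \<ge> 0" "y \<ge> 0" "0 < r" "r \<le> 1"
  shows "(x + y) powr r \<le> x powr r + y powr r"
proof (cases "x + y = 0")
  case False
  then have s: "x + y > 0" using assms by simp
  have *: "t / (x + y) \<le> (t / (x + y)) powr r" if "0 \<le> t" "t \<le> x + y" for t
  proof (cases "t = 0")
    case False
    then have "(t / (x + y)) powr 1 \<le> (t / (x + y)) powr r"
      using that s assms by (intro powr_mono') auto
    then show ?thesis using that s by simp
  qed simp
  have "1 = x / (x + y) + y / (x + y)" using s by (simp flip: add_divide_distrib)
  also have "\<dots> \<le> (x / (x + y)) powr r + (y / (x + y)) powr r"
    using assms by (intro add_mono *) auto
  also have "\<dots> = (x powr r + y powr r) / (x + y) powr r"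
    using assms s by (simp add: powr_divide add_divide_distrib)
  finally show ?thesis using s by (simp add: field_simps)
qed (use assms in simp)

lemma powr_sum_le_sum_powr:
  fixes f :: "'a \<Rightarrow> real"
  assumes "finite A" "\<And>x. x \<in> A \<Longrightarrow> f x \<ge> 0" "0 < r" "r \<le> 1"
  shows "(\<Sum>x\<in>A. f x) powr r \<le> (\<Sum>x\<in>A. f x powr r)"
  using assms(1,2)
proof (induction A rule: finite_induct)
  case (insert a A)
  have "(f a + sum f A) powr r \<le> f a powr r + sum f A powr r"
    using insert assms(3,4) by (intro powr_add_le_add_powr sum_nonneg) auto
  then show ?case using insert by force
qed (use assms in simp)

text \<open>Taking roots puts the finite inequality into the form
  \<open>sum f F \<le> I powr (1 / r)\<close>, a bound on partial sums that passes to the infinite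
  sum.\<close>

lemma powr_infsum_le_infsum_powr:
  fixes f :: "'a \<Rightarrow> real"
  assumes "f summable_on A" "(\<lambda>x. f x powr r) summable_on A" "\<And>x. x \<in> A \<Longrightarrow> f x \<ge> 0"
    and r: "0 < r" "r \<le> 1"
  shows "infsum f A powr r \<le> infsum (\<lambda>x. f x powr r) A"
proof -
  let ?I = "infsum (\<lambda>x. f x powr r) A"
  have I: "?I \<ge> 0" by (intro infsum_nonneg) simp
  have "infsum f A \<le> ?I powr (1 / r)"
  proof (rule infsum_le_finite_sums[OF assms(1)])
    fix F assume F: "finite F" "F \<subseteq> A"
    have f: "sum f F \<ge> 0" using F assms(3) by (intro sum_nonneg) auto
    have "sum f F powr r \<le> (\<Sum>x\<in>F. f x powr r)"
      using F assms(3) r by (intro powr_sum_le_sum_powr) auto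
    also have "\<dots> \<le> ?I" using F by (intro finite_sum_le_infsum assms) auto
    finally have "(sum f F powr r) powr (1 / r) \<le> ?I powr (1 / r)"
      using r by (intro powr_mono2) auto
    then show "sum f F \<le> ?I powr (1 / r)" using f r by (simp add: powr_powr)
  qed
  then have "infsum f A powr r \<le> (?I powr (1 / r)) powr r"
    using r assms(3) by (intro powr_mono2 infsum_nonneg) auto
  then show ?thesis using I r by (simp add: powr_powr)
qed

text \<open>The index sets depend on \<open>g\<close>. Extending \<open>f\<close> by 0 to the common
  set \<open>X\<close> lets all the series converge along the same finite subsets, so the bound on
  partial sums survives the limit.\<close>

lemma sum_infsum_le:
  fixes f :: "'a \<Rightarrow> real"
  assumes "\<And>g. g \<in> G \<Longrightarrow> f summable_on A g" "\<And>g. g \<in> G \<Longrightarrow> A g \<subseteq> X"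
    and bound: "\<And>F. finite F \<Longrightarrow> F \<subseteq> X \<Longrightarrow> (\<Sum>g\<in>G. \<Sum>k\<in>F. if k \<in> A g then f k else 0) \<le> B"
  shows "(\<Sum>g\<in>G. infsum f (A g)) \<le> B"
proof -
  have "((\<lambda>F. \<Sum>k\<in>F. if k \<in> A g then f k else 0) \<longlongrightarrow> infsum f (A g)) (finite_subsets_at_top X)" if "g \<in> G" for g
  proof -
    have "(f has_sum infsum f (A g)) (A g)" using assms(1)[OF that] by (rule has_sum_infsum)
    moreover have "(f has_sum infsum f (A g)) (A g) \<longleftrightarrow>
        ((\<lambda>k. if k \<in> A g then f k else 0) has_sum infsum f (A g)) X"
      by (rule has_sum_cong_neutral) (use assms(2)[OF that] in auto)
    ultimately have "((\<lambda>k. if k \<in> A g then f k else 0) has_sum infsum f (A g)) X" by blast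
    then show ?thesis by (simp add: has_sum_def)
  qed
  then have "((\<lambda>F. \<Sum>g\<in>G. \<Sum>k\<in>F. if k \<in> A g then f k else 0) \<longlongrightarrow> (\<Sum>g\<in>G. infsum f (A g)))
      (finite_subsets_at_top X)" by (rule tendsto_sum)
  then show ?thesis
    by (rule tendsto_upperbound) (auto intro!: eventually_finite_subsets_at_top_weakI bound)
qed

text \<open>Averaging over one component: a nonzero truncation \<open>trunc_poly m (k i)\<close> admits at most one
  \<open>g\<close>, and vanishing truncations are compensated by their weight \<open>b powr (- 2 \<beta> m)\<close>.\<close>

lemma sum_over_component_fixed:
  fixes p :: "'b::prime_card mod_ring poly"
  assumes irred: "Factorial_Ring.irreducible p" "Polynomial.degree p = m" and \<beta>: "\<beta> > 1/2"
  defines "\<omega> \<equiv> \<lambda>y. real CARD('b) powr (- 2 * \<beta> * real (mu CARD('b) y))"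
  defines "G \<equiv> polys_below m - {0 :: 'b mod_ring poly}"
  shows "(\<Sum>y\<in>{1..<CARD('b) ^ T}. \<omega> y * real (card {g \<in> G. p dvd (trunc_poly m y * g + r)}))
    \<le> walsh_sum CARD('b) \<beta>"
proof -
  let ?b = "CARD('b)"
  note b2 = card_prime_card_ge_2[where 'b='b]
  have \<omega>_nonneg: "\<omega> y \<ge> 0" for y by (simp add: \<omega>_def)
  have sum_\<omega>: "(\<Sum>y\<in>{1..<?b ^ T}. \<omega> y) \<le> walsh_sum ?b \<beta>"
    unfolding \<omega>_def by (rule sum_walsh_weight_le[OF b2 \<beta>])
  have fin: "finite G" by (simp add: G_def finite_card_polys_below)
  show ?thesis
  \<comment> \<open>If \<open>p\<close> divides \<open>r\<close>, a nonzero truncation admits no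
    \<open>g\<close> and a vanishing one admits all \<open>b ^ m - 1\<close>. If not, a vanishing
    truncation admits none and a nonzero one at most one. In both cases the sum is at most the sum
    of \<omega>.\<close>
  proof (cases "p dvd r")
    case True
    have cnt: "card {g \<in> G. p dvd (trunc_poly m y * g + r)} = (if ?b ^ m dvd y then ?b ^ m - 1 else 0)" for y
    proof (cases "?b ^ m dvd y")
      case True
      then have "(trunc_poly m y :: 'b mod_ring poly) = 0" by (simp add: trunc_poly_eq_0_iff)
      then have "{g \<in> G. p dvd (trunc_poly m y * g + r)} = G" using \<open>p dvd r\<close> by simp
      then show ?thesis using True
        by (simp add: G_def card_Diff_singleton finite_card_polys_below polys_below_def[of m, symmetric])
           (simp add: card_Diff_singleton_if polys_below_eq finite_card_polys_below[unfolded polys_below_eq])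
    next
      case False
      have "\<not> p dvd (trunc_poly m y * g + r)" if "g \<in> G" for g
      proof
        assume "p dvd (trunc_poly m y * g + r)"
        then have "p dvd (trunc_poly m y - 0) * g" using \<open>p dvd r\<close> by (simp add: dvd_add_left_iff)
        then have "trunc_poly m y = (0 :: 'b mod_ring poly)"
          using that by (intro cancel_mod_irreducible[OF irred trunc_poly_in_polys_below])
            (auto simp: G_def polys_below_eq)
        then show False using False by (simp add: trunc_poly_eq_0_iff)
      qed
      then have "{g \<in> G. p dvd (trunc_poly m y * g + r)} = {}" by blast
      then show ?thesis using False by (simp only: card.empty if_False)
    qed
    have "(\<Sum>y\<in>{1..<?b ^ T}. \<omega> y * real (card {g \<in> G. p dvd (trunc_poly m y * g + r)})) =
        (\<Sum>y\<in>{y\<in>{1..<?b ^ T}. ?b ^ m dvd y}. \<omega> y * real (?b ^ m - 1))"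
      unfolding cnt by (subst sum.inter_filter) (auto intro!: sum.cong)
    also have "\<dots> \<le> (\<Sum>y\<in>(\<lambda>z. ?b ^ m * z) ` {1..<?b ^ T}. \<omega> y * real (?b ^ m - 1))"
    proof (rule sum_mono2)
      show "{y\<in>{1..<?b ^ T}. ?b ^ m dvd y} \<subseteq> (\<lambda>z. ?b ^ m * z) ` {1..<?b ^ T}"
      proof
        fix y assume "y \<in> {y\<in>{1..<?b ^ T}. ?b ^ m dvd y}"
        then obtain z where z: "y = ?b ^ m * z" "1 \<le> y" "y < ?b ^ T" by auto
        have "z \<le> ?b ^ m * z" using b2 by simp
        then have "z \<in> {1..<?b ^ T}" using z by (cases z) auto
        then show "y \<in> (\<lambda>z. ?b ^ m * z) ` {1..<?b ^ T}" using z(1) by blast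
      qed
    qed (auto simp: \<omega>_nonneg)
    also have "\<dots> = (\<Sum>z\<in>{1..<?b ^ T}. \<omega> (?b ^ m * z) * real (?b ^ m - 1))"
      using b2 by (subst sum.reindex) (auto simp: inj_on_def)
    also have "\<dots> \<le> (\<Sum>z\<in>{1..<?b ^ T}. \<omega> z)"
    proof (rule sum_mono)
      fix z assume "z \<in> {1..<?b ^ T}"
      then have "mu ?b (?b ^ m * z) = m + mu ?b z" by (intro mu_power_times b2) auto
      then have eq: "\<omega> (?b ^ m * z) = real ?b powr (- 2 * \<beta> * real m) * \<omega> z"
        by (simp add: \<omega>_def powr_add[symmetric] algebra_simps)
      have "real (?b ^ m - 1) \<le> real ?b powr real m" using b2 by (simp add: powr_realpow)
      then have "real ?b powr (- 2 * \<beta> * real m) * real (?b ^ m - 1) \<le>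
          real ?b powr (- 2 * \<beta> * real m) * real ?b powr real m" by (intro mult_left_mono) auto
      also have "\<dots> = real ?b powr (- (2 * \<beta> - 1) * real m)" by (simp add: powr_add[symmetric] algebra_simps)
      also have "\<dots> \<le> real ?b powr 0" using b2 \<beta> by (intro powr_mono) (auto simp: mult_nonpos_nonneg)
      finally have "real ?b powr (- 2 * \<beta> * real m) * real (?b ^ m - 1) \<le> 1" using b2 by simp
      then have "(real ?b powr (- 2 * \<beta> * real m) * real (?b ^ m - 1)) * \<omega> z \<le> 1 * \<omega> z"
        using \<omega>_nonneg by (intro mult_right_mono) auto
      then show "\<omega> (?b ^ m * z) * real (?b ^ m - 1) \<le> \<omega> z"
        unfolding eq by (simp only: mult_ac mult_1_left)
    qed
    finally show ?thesis using sum_\<omega> by linarith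
  next
    case False
    have cnt: "card {g \<in> G. p dvd (trunc_poly m y * g + r)} \<le> 1" for y
    proof (rule ccontr)
      assume neg: "\<not> ?thesis"
      then obtain g h where gh: "g \<in> G" "h \<in> G" "p dvd (trunc_poly m y * g + r)"
        "p dvd (trunc_poly m y * h + r)" "g \<noteq> h"
        using card_le_Suc0_iff_eq[of "{g \<in> G. p dvd (trunc_poly m y * g + r)}"] fin by fastforce
      have "trunc_poly m y \<noteq> (0 :: 'b mod_ring poly)" using gh(3) False by auto
      moreover have "p dvd (trunc_poly m y * g + r) - (trunc_poly m y * h + r)" using gh by (intro dvd_diff)
      then have "p dvd (g - h) * trunc_poly m y" by (simp add: algebra_simps)
      ultimately have "g = h"
        using gh by (intro cancel_mod_irreducible[OF irred, of g h "trunc_poly m y"])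
          (auto simp: G_def trunc_poly_in_polys_below)
      then show False using gh by simp
    qed
    have "\<omega> y * real (card {g \<in> G. p dvd (trunc_poly m y * g + r)}) \<le> \<omega> y" for y
      using mult_left_mono[OF _ \<omega>_nonneg, of "real (card {g \<in> G. p dvd (trunc_poly m y * g + r)})" 1 y] cnt[of y]
      by simp
    then show ?thesis using sum_\<omega> sum_mono order_trans by (metis (no_types, lifting))
  qed
qed

text \<open>The sum over all \<open>b ^ m - 1\<close> candidates is no larger than the full sum over
  \<open>k\<close> without any congruence, so the average gains the factor
  \<open>1 / (b ^ m - 1)\<close>. For the proof \<open>k\<close> is split into its component
  \<open>i\<close> and the rest \<open>h\<close>; for fixed \<open>h\<close> the congruence has the
  constant term \<open>r h\<close>.\<close>

lemma sum_over_component: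
  fixes p :: "'b::prime_card mod_ring poly"
  assumes irred: "Factorial_Ring.irreducible p" "Polynomial.degree p = m" and \<beta>: "\<beta> > 1/2"
    and u: "finite u" "i \<in> u"
  defines "G \<equiv> polys_below m - {0 :: 'b mod_ring poly}"
  shows "(\<Sum>g\<in>G. infsum (walsh_weight CARD('b) \<beta> u) (dual_net m p (q(i := g)) u))
    \<le> walsh_sum CARD('b) \<beta> ^ card u"
proof (rule sum_infsum_le)
  let ?b = "CARD('b)"
  note b2 = card_prime_card_ge_2[where 'b='b]
  show sub: "dual_net m p (q(i := g)) u \<subseteq> u \<rightarrow>\<^sub>E {1..}" for g by (auto simp: dual_net_def)
  show "walsh_weight ?b \<beta> u summable_on dual_net m p (q(i := g)) u" for g
    by (rule walsh_weight_summable[OF b2 \<beta> u(1) sub])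
  fix F :: "(nat \<Rightarrow> nat) set" assume F: "finite F" "F \<subseteq> u \<rightarrow>\<^sub>E {1..}"
  obtain T where T: "F \<subseteq> u \<rightarrow>\<^sub>E {1..<?b ^ T}"
    by (rule finite_subset_PiE_power[OF b2 u(1) F])
  define v where "v = u - {i}"
  have v: "finite v" "i \<notin> v" "u = insert i v" "card u = Suc (card v)"
    using u card_Suc_Diff1[OF u] by (auto simp: v_def)
  have fin: "finite G" by (simp add: G_def finite_card_polys_below)
  define w where "w = walsh_weight ?b \<beta>"
  define \<omega> where "\<omega> y = real ?b powr (- 2 * \<beta> * real (mu ?b y))" for y
  define r where "r h = (\<Sum>j\<in>v. trunc_poly m (h j) * q j)" for h :: "nat \<Rightarrow> nat"
  have w_upd: "w u (h(i := y)) = \<omega> y * w v h" for h y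
  proof -
    have "(\<Prod>j\<in>v. real ?b powr (- 2 * \<beta> * real (mu ?b ((h(i := y)) j)))) =
        (\<Prod>j\<in>v. real ?b powr (- 2 * \<beta> * real (mu ?b (h j))))"
      using v(2) by (intro prod.cong) auto
    then show ?thesis using v by (simp add: w_def walsh_weight_prod[OF b2] \<omega>_def)
  qed
  have dual_upd: "h(i := y) \<in> dual_net m p (q(i := g)) u \<longleftrightarrow> p dvd (trunc_poly m y * g + r h)"
    if "h \<in> v \<rightarrow>\<^sub>E {1..<?b ^ T}" "y \<in> {1..<?b ^ T}" for h y g
  proof -
    have "h(i := y) \<in> u \<rightarrow>\<^sub>E {1..}" using that by (auto simp: v(3) PiE_iff extensional_def)
    moreover have "(\<Sum>j\<in>v. trunc_poly m ((h(i := y)) j) * (q(i := g)) j) = r h"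
      unfolding r_def using v(2) by (intro sum.cong) auto
    ultimately show ?thesis using v by (simp add: dual_net_iff)
  qed
  have "(\<Sum>g\<in>G. \<Sum>k\<in>F. if k \<in> dual_net m p (q(i := g)) u then w u k else 0) \<le>
      (\<Sum>g\<in>G. \<Sum>k\<in>u \<rightarrow>\<^sub>E {1..<?b ^ T}. if k \<in> dual_net m p (q(i := g)) u then w u k else 0)"
    using T u(1) by (intro sum_mono sum_mono2 finite_PiE) (auto simp: w_def)
  also have "\<dots> = (\<Sum>g\<in>G. \<Sum>(y, h)\<in>{1..<?b ^ T} \<times> (v \<rightarrow>\<^sub>E {1..<?b ^ T}).
      if p dvd (trunc_poly m y * g + r h) then \<omega> y * w v h else 0)"
  proof (rule sum.cong)
    fix g
    show "(\<Sum>k\<in>u \<rightarrow>\<^sub>E {1..<?b ^ T}. if k \<in> dual_net m p (q(i := g)) u then w u k else 0) =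
      (\<Sum>(y, h)\<in>{1..<?b ^ T} \<times> (v \<rightarrow>\<^sub>E {1..<?b ^ T}). if p dvd (trunc_poly m y * g + r h) then \<omega> y * w v h else 0)"
      unfolding v(3) PiE_insert_eq
      by (subst sum.reindex[OF inj_combinator[OF v(2)]])
         (intro sum.cong refl, clarsimp simp: dual_upd[unfolded v(3)] w_upd[unfolded v(3)] simp del: fun_upd_apply)
  qed simp
  also have "\<dots> = (\<Sum>(y, h)\<in>{1..<?b ^ T} \<times> (v \<rightarrow>\<^sub>E {1..<?b ^ T}).
      \<Sum>g\<in>G. if p dvd (trunc_poly m y * g + r h) then \<omega> y * w v h else 0)"
    by (subst sum.swap) (simp add: case_prod_unfold)
  also have "\<dots> = (\<Sum>(y, h)\<in>{1..<?b ^ T} \<times> (v \<rightarrow>\<^sub>E {1..<?b ^ T}).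
      w v h * (\<omega> y * real (card {g \<in> G. p dvd (trunc_poly m y * g + r h)})))"
    using fin by (intro sum.cong) (auto simp: sum.inter_filter[symmetric] mult_ac)
  also have "\<dots> = (\<Sum>y\<in>{1..<?b ^ T}. \<Sum>h\<in>v \<rightarrow>\<^sub>E {1..<?b ^ T}.
      w v h * (\<omega> y * real (card {g \<in> G. p dvd (trunc_poly m y * g + r h)})))"
    by (simp add: sum.cartesian_product)
  also have "\<dots> = (\<Sum>h\<in>v \<rightarrow>\<^sub>E {1..<?b ^ T}. \<Sum>y\<in>{1..<?b ^ T}.
      w v h * (\<omega> y * real (card {g \<in> G. p dvd (trunc_poly m y * g + r h)})))"
    by (rule sum.swap)
  also have "\<dots> = (\<Sum>h\<in>v \<rightarrow>\<^sub>E {1..<?b ^ T}. w v h *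
      (\<Sum>y\<in>{1..<?b ^ T}. \<omega> y * real (card {g \<in> G. p dvd (trunc_poly m y * g + r h)})))"
    by (simp add: sum_distrib_left)
  also have "\<dots> \<le> (\<Sum>h\<in>v \<rightarrow>\<^sub>E {1..<?b ^ T}. w v h * walsh_sum ?b \<beta>)"
    using sum_over_component_fixed[OF irred \<beta>]
    by (intro sum_mono mult_left_mono) (auto simp: \<omega>_def G_def w_def)
  also have "\<dots> = (\<Sum>h\<in>v \<rightarrow>\<^sub>E {1..<?b ^ T}. w v h) * walsh_sum ?b \<beta>"
    by (simp add: sum_distrib_right)
  also have "\<dots> \<le> walsh_sum ?b \<beta> ^ card v * walsh_sum ?b \<beta>"
    using walsh_sum_pos[OF b2 \<beta>] sum_walsh_weight_PiE_le[OF b2 \<beta> v(1), of T]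
    by (intro mult_right_mono) (auto simp: w_def)
  finally show "(\<Sum>g\<in>G. \<Sum>k\<in>F. if k \<in> dual_net m p (q(i := g)) u then walsh_weight ?b \<beta> u k else 0)
      \<le> walsh_sum ?b \<beta> ^ card u"
    unfolding w_def v(4) by (simp only: power_Suc mult.commute)
qed


section \<open>Induction over the components\<close>

definition last_component_sum ::
  "real \<Rightarrow> (nat set \<Rightarrow> real) \<Rightarrow> nat \<Rightarrow> 'b::prime_card mod_ring poly \<Rightarrow> nat \<Rightarrow> (nat \<Rightarrow> 'b mod_ring poly) \<Rightarrow> real"
  where
  "last_component_sum \<alpha> \<gamma> m p l q = (\<Sum>u\<in>{u \<in> nonempty_subsets l. l \<in> u}.
     \<gamma> u * infsum (walsh_weight CARD('b) \<alpha> u) (dual_net m p q u))"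

lemma nonempty_subsets_Suc:
  "nonempty_subsets (Suc l) = nonempty_subsets l \<union> {u \<in> nonempty_subsets (Suc l). Suc l \<in> u}"
  "nonempty_subsets l \<inter> {u \<in> nonempty_subsets (Suc l). Suc l \<in> u} = {}"
  by (auto simp: nonempty_subsets_def atLeastAtMostSuc_conv)

lemma sum_nonempty_subsets_Suc:
  "(\<Sum>u\<in>nonempty_subsets (Suc l). f u) =
     (\<Sum>u\<in>nonempty_subsets l. f u) + (\<Sum>u\<in>{u \<in> nonempty_subsets (Suc l). Suc l \<in> u}. f u)"
  using nonempty_subsets_Suc(2)[of l] finite_nonempty_subsets
  by (subst nonempty_subsets_Suc(1), subst sum.union_disjoint) auto

lemma wce_sq_Suc: "wce_sq \<alpha> \<gamma> m p (Suc l) q = wce_sq \<alpha> \<gamma> m p l q + last_component_sum \<alpha> \<gamma> m p (Suc l) q"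
  unfolding wce_sq_eq last_component_sum_def by (rule sum_nonempty_subsets_Suc)

lemma wce_sq_fun_upd: "wce_sq \<alpha> \<gamma> m p l (q(Suc l := g)) = wce_sq \<alpha> \<gamma> m p l q"
  unfolding wce_sq_eq
proof (rule sum.cong)
  fix u assume "u \<in> nonempty_subsets l"
  then have "Suc l \<notin> u" using nonempty_subsetsD(3) by fastforce
  then have "(\<Sum>j\<in>u. trunc_poly m (k j) * (q(Suc l := g)) j) = (\<Sum>j\<in>u. trunc_poly m (k j) * q j)" for k
    by (intro sum.cong) auto
  then have "dual_net m p (q(Suc l := g)) u = dual_net m p q u" by (simp add: dual_net_def)
  then show "\<gamma> u * infsum (walsh_weight CARD('a) \<alpha> u) (dual_net m p (q(Suc l := g)) u) =
    \<gamma> u * infsum (walsh_weight CARD('a) \<alpha> u) (dual_net m p q u)" by simp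
qed simp

text \<open>Subsets without the new component contribute the same for every candidate, so minimising
  the criterion minimises the increment. The first component is prescribed to be 1 and not
  minimised, but every nonzero choice gives the same dual net, namely the \<open>k\<close> with
  vanishing truncation.\<close>

lemma last_component_sum_minimal:
  fixes p :: "'b::prime_card mod_ring poly"
  assumes irred: "Factorial_Ring.irreducible p" "Polynomial.degree p = m"
    and cbc: "cbc_output \<alpha> \<gamma> m p s q" and l: "Suc l \<le> s" and g: "g \<in> polys_below m - {0}"
  shows "last_component_sum \<alpha> \<gamma> m p (Suc l) q \<le> last_component_sum \<alpha> \<gamma> m p (Suc l) (q(Suc l := g))"
proof (cases "l = 0")
  case True
  have dual: "dual_net m p q' u = {k \<in> u \<rightarrow>\<^sub>E {1..}. trunc_poly m (k 1) = (0 :: 'b mod_ring poly)}"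
    if "q' 1 \<in> polys_below m - {0}" "u \<in> {u \<in> nonempty_subsets (Suc 0). Suc 0 \<in> u}" for q' u
  proof -
    have u: "u = {1}" using that(2) by (auto simp: nonempty_subsets_def)
    have single: "p dvd trunc_poly m (k 1) * q' 1 \<longleftrightarrow> trunc_poly m (k 1) = (0 :: 'b mod_ring poly)" for k :: "nat \<Rightarrow> nat"
    proof
      assume "p dvd trunc_poly m (k 1) * q' 1"
      then have "p dvd (trunc_poly m (k 1) - 0) * q' 1" by simp
      then show "trunc_poly m (k 1) = (0 :: 'b mod_ring poly)"
        by (intro cancel_mod_irreducible[OF irred trunc_poly_in_polys_below _ that(1)])
           (simp_all add: polys_below_def)
    qed simp
    have "(\<Sum>j\<in>u. trunc_poly m (k j) * q' j) = trunc_poly m (k 1) * q' 1" for k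
      unfolding u by simp
    then show ?thesis
      by (intro Set.set_eqI) (simp only: dual_net_iff single mem_Collect_eq)
  qed
  have "q \<in> {1..s} \<rightarrow>\<^sub>E polys_below m - {0}" using cbc by (simp only: cbc_output_def)
  moreover have "1 \<in> {1..s}" using l by simp
  ultimately have "q 1 \<in> polys_below m - {0}" by (rule PiE_mem)
  then show ?thesis using dual[of q] dual[of "q(1 := g)"] g
    by (simp add: last_component_sum_def True)
next
  case False
  then have "is_arg_min (\<lambda>g. wce_sq \<alpha> \<gamma> m p (l + 1) (q(l + 1 := g)))
          (\<lambda>g. g \<in> polys_below m - {0}) (q (l + 1))"
    using cbc l by (auto simp: cbc_output_def)
  then have "wce_sq \<alpha> \<gamma> m p (Suc l) q \<le> wce_sq \<alpha> \<gamma> m p (Suc l) (q(Suc l := g))"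
    using g unfolding is_arg_min_linorder by simp
  then show ?thesis by (simp add: wce_sq_Suc wce_sq_fun_upd)
qed

text \<open>Each increment, raised to the power \<open>lam\<close>, is at most its average over all
  candidates, and subadditivity of this power adds the increments up. Jensen replaces the smoothness
  by \<open>\<alpha> * lam\<close>; this exceeds 1/2 exactly because of the lower bound on
  \<open>lam\<close>, so the resulting series converge.\<close>

theorem cbc_error_bound:
  fixes p :: "'b::prime_card mod_ring poly"
  assumes irred: "Factorial_Ring.irreducible p" "Polynomial.degree p = m" and m: "m \<ge> 1"
    and cbc: "cbc_output \<alpha> \<gamma> m p s q" and \<gamma>: "weights \<gamma>"
    and \<alpha>: "\<alpha> > 1/2" and lam: "1 / (2 * \<alpha>) < lam" "lam \<le> 1"
  shows "wce_sq \<alpha> \<gamma> m p s q powr lam \<le> weight_sum CARD('b) \<alpha> lam \<gamma> s / (real CARD('b) ^ m - 1)"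
proof -
  let ?b = "CARD('b)"
  note b2 = card_prime_card_ge_2[where 'b='b]
  define G where "G = polys_below m - {0 :: 'b mod_ring poly}"
  define M where "M = real ?b ^ m - 1"
  have "1 < ?b ^ m" using b2 m by (intro one_less_power) auto
  then have M: "M > 0" unfolding M_def by (metis diff_gt_0_iff_gt of_nat_1 of_nat_less_iff of_nat_power)
  have fin: "finite G" by (simp add: G_def finite_card_polys_below)
  have "(0 :: 'b mod_ring poly) \<in> polys_below m" by (simp add: polys_below_def)
  then have cardG: "real (card G) = M"
    using \<open>1 < ?b ^ m\<close> by (simp add: G_def M_def card_Diff_singleton finite_card_polys_below of_nat_diff)
  have "1 / (2 * \<alpha>) > 0" using \<alpha> by simp
  then have lam0: "lam > 0" using lam(1) by linarith
  have \<beta>: "\<alpha> * lam > 1/2" using lam(1) \<alpha> by (simp add: field_simps)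
  have ws: "weight_sum ?b \<alpha> lam \<gamma> l = (\<Sum>u\<in>nonempty_subsets l. \<gamma> u powr lam * walsh_sum ?b (\<alpha> * lam) ^ card u)" for l
    by (simp add: weight_sum_def walsh_sum_def mult.assoc)
  have step: "last_component_sum \<alpha> \<gamma> m p (Suc l) q powr lam * M \<le>
      (\<Sum>u\<in>{u \<in> nonempty_subsets (Suc l). Suc l \<in> u}. \<gamma> u powr lam * walsh_sum ?b (\<alpha> * lam) ^ card u)"
    if l: "Suc l \<le> s" for l
  proof -
    let ?U = "{u \<in> nonempty_subsets (Suc l). Suc l \<in> u}"
    let ?d = "\<lambda>\<beta> g u. infsum (walsh_weight ?b \<beta> u) (dual_net m p (q(Suc l := g)) u)"
    have finU: "finite ?U" by (simp add: finite_nonempty_subsets)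
    have U: "finite u" "Suc l \<in> u" "\<gamma> u \<ge> 0" if "u \<in> ?U" for u
      using that nonempty_subsetsD(1) weightsD[OF \<gamma>] by auto
    have nonneg: "last_component_sum \<alpha> \<gamma> m p (Suc l) q' \<ge> 0" for q' :: "nat \<Rightarrow> 'b mod_ring poly"
      unfolding last_component_sum_def
      by (intro sum_nonneg mult_nonneg_nonneg infsum_walsh_weight_nonneg U(3))
    have "last_component_sum \<alpha> \<gamma> m p (Suc l) q powr lam * M =
        (\<Sum>g\<in>G. last_component_sum \<alpha> \<gamma> m p (Suc l) q powr lam)" by (simp add: cardG)
    also have "\<dots> \<le> (\<Sum>g\<in>G. last_component_sum \<alpha> \<gamma> m p (Suc l) (q(Suc l := g)) powr lam)"
      using lam0 nonneg by (intro sum_mono powr_mono2 last_component_sum_minimal[OF irred cbc l]) (auto simp: G_def)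
    also have "\<dots> \<le> (\<Sum>g\<in>G. \<Sum>u\<in>?U. \<gamma> u powr lam * ?d (\<alpha> * lam) g u)"
    proof (rule sum_mono)
      fix g
      have "last_component_sum \<alpha> \<gamma> m p (Suc l) (q(Suc l := g)) powr lam \<le> (\<Sum>u\<in>?U. (\<gamma> u * ?d \<alpha> g u) powr lam)"
        unfolding last_component_sum_def using lam0 lam(2)
        by (intro powr_sum_le_sum_powr finU mult_nonneg_nonneg infsum_walsh_weight_nonneg U(3))
      also have "\<dots> \<le> (\<Sum>u\<in>?U. \<gamma> u powr lam * ?d (\<alpha> * lam) g u)"
      proof (rule sum_mono)
        fix u assume u: "u \<in> ?U"
        have sub: "dual_net m p (q(Suc l := g)) u \<subseteq> u \<rightarrow>\<^sub>E {1..}" by (auto simp: dual_net_def)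
        have eq: "(\<lambda>k. walsh_weight ?b \<alpha> u k powr lam) = walsh_weight ?b (\<alpha> * lam) u"
          by (simp add: fun_eq_iff walsh_weight_def powr_powr mult_ac)
        have "?d \<alpha> g u powr lam \<le> infsum (\<lambda>k. walsh_weight ?b \<alpha> u k powr lam) (dual_net m p (q(Suc l := g)) u)"
        proof (rule powr_infsum_le_infsum_powr)
          show "walsh_weight ?b \<alpha> u summable_on dual_net m p (q(Suc l := g)) u"
            by (rule walsh_weight_summable[OF b2 \<alpha> U(1)[OF u] sub])
          show "(\<lambda>k. walsh_weight ?b \<alpha> u k powr lam) summable_on dual_net m p (q(Suc l := g)) u"
            unfolding eq by (rule walsh_weight_summable[OF b2 \<beta> U(1)[OF u] sub])
        qed (use lam0 lam in auto)
        then have "?d \<alpha> g u powr lam \<le> ?d (\<alpha> * lam) g u" by (simp add: eq)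
        then show "(\<gamma> u * ?d \<alpha> g u) powr lam \<le> \<gamma> u powr lam * ?d (\<alpha> * lam) g u"
          using U(3)[OF u] by (simp add: powr_mult infsum_walsh_weight_nonneg mult_left_mono)
      qed
      finally show "last_component_sum \<alpha> \<gamma> m p (Suc l) (q(Suc l := g)) powr lam \<le> \<dots>" .
    qed
    also have "\<dots> = (\<Sum>u\<in>?U. \<gamma> u powr lam * (\<Sum>g\<in>G. ?d (\<alpha> * lam) g u))"
      by (subst sum.swap) (simp add: sum_distrib_left)
    also have "\<dots> \<le> (\<Sum>u\<in>?U. \<gamma> u powr lam * walsh_sum ?b (\<alpha> * lam) ^ card u)"
      unfolding G_def by (intro sum_mono mult_left_mono sum_over_component[OF irred \<beta>] U) auto
    finally show ?thesis .
  qed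
  have "wce_sq \<alpha> \<gamma> m p l q powr lam * M \<le> weight_sum ?b \<alpha> lam \<gamma> l" if "l \<le> s" for l
    using that
  proof (induction l)
    case 0
    then show ?case by (simp add: wce_sq_def ws nonempty_subsets_def)
  next
    case (Suc l)
    have "last_component_sum \<alpha> \<gamma> m p (Suc l) q \<ge> 0"
      unfolding last_component_sum_def
      by (intro sum_nonneg mult_nonneg_nonneg infsum_walsh_weight_nonneg weightsD[OF \<gamma>, of _ "Suc l"]) auto
    then have "wce_sq \<alpha> \<gamma> m p (Suc l) q powr lam \<le>
        wce_sq \<alpha> \<gamma> m p l q powr lam + last_component_sum \<alpha> \<gamma> m p (Suc l) q powr lam"
      unfolding wce_sq_Suc using lam0 lam(2)
      by (intro powr_add_le_add_powr wce_sq_nonneg[OF \<gamma>])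
    then have "wce_sq \<alpha> \<gamma> m p (Suc l) q powr lam * M \<le>
        wce_sq \<alpha> \<gamma> m p l q powr lam * M + last_component_sum \<alpha> \<gamma> m p (Suc l) q powr lam * M"
      using M by (simp flip: distrib_right)
    also have "\<dots> \<le> weight_sum ?b \<alpha> lam \<gamma> l +
      (\<Sum>u\<in>{u \<in> nonempty_subsets (Suc l). Suc l \<in> u}. \<gamma> u powr lam * walsh_sum ?b (\<alpha> * lam) ^ card u)"
      using Suc step[of l] by (intro add_mono) auto
    also have "\<dots> = weight_sum ?b \<alpha> lam \<gamma> (Suc l)"
      unfolding ws by (rule sum_nonempty_subsets_Suc[symmetric])
    finally show ?case .
  qed
  from this[of s] show ?thesis using M by (simp add: M_def[symmetric] field_simps)
qed

section \<open>Stability\<close>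

text \<open>Here a ratio \<open>c / 0\<close> is 0, so for \<open>c > 0\<close> it differs from the
  extended ratio in \<open>ratio_sum\<close>. The two sums are identified once finiteness has ruled
  out such terms.\<close>

definition real_ratio_sum ::
  "nat \<Rightarrow> real \<Rightarrow> real \<Rightarrow> (nat set \<Rightarrow> real) \<Rightarrow> (nat set \<Rightarrow> real) \<Rightarrow> nat \<Rightarrow> nat \<Rightarrow> real" where
  "real_ratio_sum b \<alpha> \<alpha>' \<gamma> \<gamma>' s m = (\<Sum>u\<in>nonempty_subsets s.
     \<gamma>' u / \<gamma> u powr (\<alpha>' / \<alpha>) * (ratio_base b \<alpha>' ^ card u * real (m + 1) ^ (card u - 1)))"

lemma weight_ratio_eq:
  assumes "x \<ge> 0" "x' \<ge> 0"
  shows "weight_ratio \<alpha> \<alpha>' x x' = (if x = 0 \<and> x' \<noteq> 0 then \<infinity> else ennreal (x' / x powr (\<alpha>' / \<alpha>)))"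
proof (cases "x = 0")
  case True
  then show ?thesis using assms ennreal_ratio_conventions
    by (cases "x' = 0") (simp_all add: weight_ratio_def)
next
  case False
  then show ?thesis using assms by (simp add: weight_ratio_def divide_ennreal)
qed

lemma real_ratio_sum_nonneg:
  assumes "2 \<le> b" "\<alpha>' > 1/2" "weights \<gamma>'"
  shows "real_ratio_sum b \<alpha> \<alpha>' \<gamma> \<gamma>' s m \<ge> 0"
  unfolding real_ratio_sum_def using ratio_base_props(4)[OF assms(1,2)]
  by (intro sum_nonneg mult_nonneg_nonneg divide_nonneg_nonneg weightsD[OF assms(3)]) auto

text \<open>A positive weight over a zero weight would give an infinite term, which its positive
  factor cannot cancel.\<close>

lemma ratio_sum_finiteD:
  assumes b: "2 \<le> b" and \<alpha>': "\<alpha>' > 1/2" and w: "weights \<gamma>" "weights \<gamma>'"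
    and fin: "ratio_sum b \<alpha> \<alpha>' \<gamma> \<gamma>' s m < \<infinity>"
  shows "\<And>u. u \<in> nonempty_subsets s \<Longrightarrow> \<gamma> u = 0 \<Longrightarrow> \<gamma>' u = 0"
    and "ratio_sum b \<alpha> \<alpha>' \<gamma> \<gamma>' s m = ennreal (real_ratio_sum b \<alpha> \<alpha>' \<gamma> \<gamma>' s m)"
proof -
  define R where "R u = ratio_base b \<alpha>' ^ card u * real (m + 1) ^ (card u - 1)" for u :: "nat set"
  have R: "R u > 0" for u using ratio_base_props(4)[OF b \<alpha>'] by (simp add: R_def)
  have rs: "ratio_sum b \<alpha> \<alpha>' \<gamma> \<gamma>' s m =
      (\<Sum>u\<in>nonempty_subsets s. weight_ratio \<alpha> \<alpha>' (\<gamma> u) (\<gamma>' u) * ennreal (R u))"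
    by (simp add: ratio_sum_def R_def ratio_base_def)
  show zero: "\<gamma>' u = 0" if u: "u \<in> nonempty_subsets s" "\<gamma> u = 0" for u
  proof (rule ccontr)
    assume "\<gamma>' u \<noteq> 0"
    then have "weight_ratio \<alpha> \<alpha>' (\<gamma> u) (\<gamma>' u) * ennreal (R u) = \<infinity>"
      using u R[of u] weightsD[OF w(1) u(1)] weightsD[OF w(2) u(1)]
      by (simp add: weight_ratio_eq ennreal_top_mult)
    moreover have "weight_ratio \<alpha> \<alpha>' (\<gamma> u) (\<gamma>' u) * ennreal (R u) \<le> ratio_sum b \<alpha> \<alpha>' \<gamma> \<gamma>' s m"
      unfolding rs using u(1) finite_nonempty_subsets
      by (intro member_le_sum[where f = "\<lambda>u. weight_ratio \<alpha> \<alpha>' (\<gamma> u) (\<gamma>' u) * ennreal (R u)"]) auto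
    ultimately show False using fin by (simp add: top_unique)
  qed
  have "ratio_sum b \<alpha> \<alpha>' \<gamma> \<gamma>' s m =
      (\<Sum>u\<in>nonempty_subsets s. ennreal (\<gamma>' u / \<gamma> u powr (\<alpha>' / \<alpha>) * R u))"
    unfolding rs
  proof (rule sum.cong)
    fix u assume u: "u \<in> nonempty_subsets s"
    show "weight_ratio \<alpha> \<alpha>' (\<gamma> u) (\<gamma>' u) * ennreal (R u) = ennreal (\<gamma>' u / \<gamma> u powr (\<alpha>' / \<alpha>) * R u)"
      using weightsD[OF w(1) u] weightsD[OF w(2) u] zero[OF u] R[of u]
      by (simp add: weight_ratio_eq ennreal_mult'' del: times_divide_eq_left)
  qed simp
  also have "\<dots> = ennreal (real_ratio_sum b \<alpha> \<alpha>' \<gamma> \<gamma>' s m)"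
    unfolding real_ratio_sum_def R_def[symmetric]
    using weightsD[OF w(2)] less_imp_le[OF R] by (intro sum_ennreal mult_nonneg_nonneg divide_nonneg_nonneg) auto
  finally show "ratio_sum b \<alpha> \<alpha>' \<gamma> \<gamma>' s m = ennreal (real_ratio_sum b \<alpha> \<alpha>' \<gamma> \<gamma>' s m)" .
qed

lemma weight_sum_nonneg:
  assumes "2 \<le> b" "\<alpha> * lam > 1/2"
  shows "weight_sum b \<alpha> lam \<gamma> s \<ge> 0"
  unfolding weight_sum_def using base_less_powr[OF assms] assms(1)
  by (intro sum_nonneg mult_nonneg_nonneg zero_le_power divide_nonneg_nonneg) (auto simp: mult.assoc)

lemma exists_stability_const:
  fixes \<alpha> \<alpha>' lam :: real
  assumes \<alpha>: "\<alpha> > 1/2" and \<alpha>': "\<alpha>' > 1/2" and lam: "1 / (2 * \<alpha>) < lam" "lam \<le> 1"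
  obtains K where "K > 0"
    "\<And>\<gamma> \<gamma>' m s (p :: 'b::prime_card mod_ring poly) q. \<lbrakk>weights \<gamma>; weights \<gamma>'; m \<ge> 1;
       Factorial_Ring.irreducible p; Polynomial.degree p = m; cbc_output \<alpha> \<gamma> m p s q;
       \<And>u. u \<in> nonempty_subsets s \<Longrightarrow> \<gamma> u = 0 \<Longrightarrow> \<gamma>' u = 0\<rbrakk> \<Longrightarrow>
       wce_sq \<alpha>' \<gamma>' m p s q \<le> K * weight_sum CARD('b) \<alpha> lam \<gamma> s powr (\<alpha>' / (\<alpha> * lam)) *
         real CARD('b) powr (- (\<alpha>' / (\<alpha> * lam)) * real m) * real_ratio_sum CARD('b) \<alpha> \<alpha>' \<gamma> \<gamma>' s m"
proof -
  let ?b = "CARD('b)" and ?e = "\<alpha>' / (\<alpha> * lam)"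
  note b2 = card_prime_card_ge_2[where 'b='b]
  have "1 / (2 * \<alpha>) > 0" using \<alpha> by simp
  then have lam0: "lam > 0" using lam(1) by linarith
  have e0: "?e > 0" using \<alpha> \<alpha>' lam0 by simp
  have \<beta>: "\<alpha> * lam > 1/2" using lam(1) \<alpha> by (simp add: field_simps)
  obtain K where K: "K > 0"
    "\<And>\<gamma> \<gamma>' m s (p :: 'b mod_ring poly) q. \<lbrakk>weights \<gamma>; weights \<gamma>'; m \<ge> 1;
       Factorial_Ring.irreducible p; Polynomial.degree p = m; q \<in> {1..s} \<rightarrow>\<^sub>E polys_below m - {0};
       \<And>u. u \<in> nonempty_subsets s \<Longrightarrow> \<gamma> u = 0 \<Longrightarrow> \<gamma>' u = 0\<rbrakk> \<Longrightarrow>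
       wce_sq \<alpha>' \<gamma>' m p s q \<le> K * wce_sq \<alpha> \<gamma> m p s q powr (\<alpha>' / \<alpha>) * real_ratio_sum ?b \<alpha> \<alpha>' \<gamma> \<gamma>' s m"
    unfolding real_ratio_sum_def by (rule exists_transfer_const[OF \<alpha> \<alpha>', where 'b='b]) blast
  show thesis
  proof (rule that)
    \<comment> \<open>The factor 2 comes from \<open>b ^ m - 1 \<ge> b ^ m / 2\<close>. The exponent
      is chosen so that \<open>(W powr lam) powr ?e\<close> equals
      \<open>W powr (\<alpha>' / \<alpha>)\<close>.\<close>
    show "K * 2 powr ?e > 0" using K(1) by simp
    fix \<gamma> \<gamma>' m s and p :: "'b mod_ring poly" and q :: "nat \<Rightarrow> 'b mod_ring poly"
    assume \<gamma>: "weights \<gamma>" and \<gamma>': "weights \<gamma>'" and m: "m \<ge> 1"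
      and p: "Factorial_Ring.irreducible p" "Polynomial.degree p = m"
      and cbc: "cbc_output \<alpha> \<gamma> m p s q"
      and zero: "\<And>u. u \<in> nonempty_subsets s \<Longrightarrow> \<gamma> u = 0 \<Longrightarrow> \<gamma>' u = 0"
    define W where "W = wce_sq \<alpha> \<gamma> m p s q"
    define ws where "ws = weight_sum ?b \<alpha> lam \<gamma> s"
    have W: "W \<ge> 0" unfolding W_def by (rule wce_sq_nonneg[OF \<gamma>])
    have ws: "ws \<ge> 0" unfolding ws_def by (rule weight_sum_nonneg[OF b2 \<beta>])
    have "real ?b \<ge> 2" using b2 by simp
    moreover have "real ?b ^ 1 \<le> real ?b ^ m" using m b2 by (intro power_increasing) auto
    ultimately have bm: "real ?b ^ m \<ge> 2" unfolding power_one_right by (rule order_trans)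
    have "W powr lam \<le> ws / (real ?b ^ m - 1)"
      unfolding W_def ws_def by (rule cbc_error_bound[OF p m cbc \<gamma> \<alpha> lam])
    also have "\<dots> \<le> ws / (real ?b ^ m / 2)"
      using bm ws by (intro divide_left_mono) auto
    also have "\<dots> = 2 * ws * real ?b powr (- real m)"
      using b2 by (simp add: powr_minus_divide powr_realpow)
    finally have "(W powr lam) powr ?e \<le> (2 * ws * real ?b powr (- real m)) powr ?e"
      using e0 by (intro powr_mono2) auto
    also have "(W powr lam) powr ?e = W powr (\<alpha>' / \<alpha>)"
      using lam0 by (simp add: powr_powr)
    also have "(2 * ws * real ?b powr (- real m)) powr ?e =
        2 powr ?e * ws powr ?e * real ?b powr (- ?e * real m)"
      using ws by (simp add: powr_mult powr_powr mult.commute)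
    finally have *: "W powr (\<alpha>' / \<alpha>) \<le> 2 powr ?e * ws powr ?e * real ?b powr (- ?e * real m)" .
    have "q \<in> {1..s} \<rightarrow>\<^sub>E polys_below m - {0}" using cbc by (simp only: cbc_output_def)
    then have "wce_sq \<alpha>' \<gamma>' m p s q \<le> K * W powr (\<alpha>' / \<alpha>) * real_ratio_sum ?b \<alpha> \<alpha>' \<gamma> \<gamma>' s m"
      unfolding W_def using K(2) \<gamma> \<gamma>' m p zero by blast
    also have "\<dots> \<le> K * (2 powr ?e * ws powr ?e * real ?b powr (- ?e * real m)) * real_ratio_sum ?b \<alpha> \<alpha>' \<gamma> \<gamma>' s m"
      using K(1) * by (intro mult_right_mono mult_left_mono real_ratio_sum_nonneg[OF b2 \<alpha>' \<gamma>']) auto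
    finally show "wce_sq \<alpha>' \<gamma>' m p s q \<le> K * 2 powr ?e * ws powr ?e *
         real ?b powr (- ?e * real m) * real_ratio_sum ?b \<alpha> \<alpha>' \<gamma> \<gamma>' s m"
      by (simp only: mult.assoc)
  qed
qed

section \<open>General weights\<close>

lemma stability_general_weights:
  fixes \<alpha> \<alpha>' lam \<delta> r r' :: real
  assumes \<alpha>: "\<alpha> > 1/2" and \<alpha>': "\<alpha>' > 1/2" and \<gamma>: "weights \<gamma>" and \<gamma>': "weights \<gamma>'"
    and lam: "1 / (2 * \<alpha>) < lam" "lam \<le> 1"
    and sup: "(SUP s\<in>{1..}. ennreal (1 / real s powr r * weight_sum CARD('b) \<alpha> lam \<gamma> s)) < \<infinity>"
    and sup': "(SUP (s, m)\<in>{1..} \<times> {1..}.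
      ennreal (1 / (real s powr r' * real CARD('b) powr (\<delta> * real m))) *
        ratio_sum CARD('b) \<alpha> \<alpha>' \<gamma> \<gamma>' s m) < \<infinity>"
  shows "\<exists>C>0. \<forall>s\<ge>1. \<forall>m\<ge>1. \<forall>(p :: 'b::prime_card mod_ring poly) q.
    Factorial_Ring.irreducible p \<and> Polynomial.degree p = m \<and> cbc_output \<alpha> \<gamma> m p s q \<longrightarrow>
      wce_sq \<alpha>' \<gamma>' m p s q
        \<le> C * real s powr (r * \<alpha>' / (\<alpha> * lam) + r') * real CARD('b) powr (- (\<alpha>' / (\<alpha> * lam) - \<delta>) * real m)"
proof -
  let ?b = "CARD('b)" and ?e = "\<alpha>' / (\<alpha> * lam)"
  note b2 = card_prime_card_ge_2[where 'b='b]
  have \<beta>: "\<alpha> * lam > 1/2" using lam(1) \<alpha> by (simp add: field_simps)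
  then have "\<alpha> * lam > 0" by linarith
  then have e0: "?e > 0" using \<alpha>' by simp
  obtain K where K: "K > 0"
    "\<And>m s (p :: 'b mod_ring poly) q. \<lbrakk>m \<ge> 1; Factorial_Ring.irreducible p; Polynomial.degree p = m;
       cbc_output \<alpha> \<gamma> m p s q; \<And>u. u \<in> nonempty_subsets s \<Longrightarrow> \<gamma> u = 0 \<Longrightarrow> \<gamma>' u = 0\<rbrakk> \<Longrightarrow>
       wce_sq \<alpha>' \<gamma>' m p s q \<le> K * weight_sum ?b \<alpha> lam \<gamma> s powr ?e *
         real ?b powr (- ?e * real m) * real_ratio_sum ?b \<alpha> \<alpha>' \<gamma> \<gamma>' s m"
    using exists_stability_const[OF \<alpha> \<alpha>' lam, where 'b='b] \<gamma> \<gamma>' by metis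
  obtain C1 where C1: "C1 \<ge> 0"
    "(SUP s\<in>{1..}. ennreal (1 / real s powr r * weight_sum ?b \<alpha> lam \<gamma> s)) = ennreal C1"
    using sup by (cases rule: ennreal_cases) auto
  obtain C2 where C2: "C2 \<ge> 0"
    "(SUP (s, m)\<in>{1..} \<times> {1..}. ennreal (1 / (real s powr r' * real ?b powr (\<delta> * real m))) *
        ratio_sum ?b \<alpha> \<alpha>' \<gamma> \<gamma>' s m) = ennreal C2"
    using sup' by (cases rule: ennreal_cases) auto
  have ws: "weight_sum ?b \<alpha> lam \<gamma> s \<le> C1 * real s powr r" if "s \<ge> 1" for s
  proof -
    have "ennreal (1 / real s powr r * weight_sum ?b \<alpha> lam \<gamma> s) \<le> ennreal C1"
      unfolding C1(2)[symmetric] using that by (intro SUP_upper) auto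
    then have "1 / real s powr r * weight_sum ?b \<alpha> lam \<gamma> s \<le> C1" using C1(1) by (simp only: ennreal_le_iff)
    then show ?thesis using that by (simp add: field_simps)
  qed
  \<comment> \<open>The finite supremum is used twice: it excludes infinite ratios, and it bounds
    the sum of the remaining real ones.\<close>
  have rs: "(\<forall>u\<in>nonempty_subsets s. \<gamma> u = 0 \<longrightarrow> \<gamma>' u = 0) \<and>
      real_ratio_sum ?b \<alpha> \<alpha>' \<gamma> \<gamma>' s m \<le> C2 * (real s powr r' * real ?b powr (\<delta> * real m))"
    if "s \<ge> 1" "m \<ge> 1" for s m
  proof -
    define d where "d = real s powr r' * real ?b powr (\<delta> * real m)"
    have d: "d > 0" using that b2 by (simp add: d_def)
    have "(case (s, m) of (s, m) \<Rightarrow> ennreal (1 / (real s powr r' * real ?b powr (\<delta> * real m))) *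
        ratio_sum ?b \<alpha> \<alpha>' \<gamma> \<gamma>' s m) \<le> ennreal C2"
      unfolding C2(2)[symmetric] using that by (intro SUP_upper) auto
    then have le: "ennreal (1 / d) * ratio_sum ?b \<alpha> \<alpha>' \<gamma> \<gamma>' s m \<le> ennreal C2" by (simp add: d_def)
    also have "\<dots> < \<infinity>" by simp
    finally have fin: "ratio_sum ?b \<alpha> \<alpha>' \<gamma> \<gamma>' s m < \<infinity>"
      using d by (auto simp: ennreal_mult_less_top)
    note rs = ratio_sum_finiteD[OF b2 \<alpha>' \<gamma> \<gamma>' fin]
    have "ennreal (1 / d * real_ratio_sum ?b \<alpha> \<alpha>' \<gamma> \<gamma>' s m) \<le> ennreal C2"
      using le d real_ratio_sum_nonneg[OF b2 \<alpha>' \<gamma>', of \<alpha> \<gamma> s m]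
      by (subst ennreal_mult) (simp_all add: rs(2))
    then have "1 / d * real_ratio_sum ?b \<alpha> \<alpha>' \<gamma> \<gamma>' s m \<le> C2" using C2(1) by (simp only: ennreal_le_iff)
    then have "real_ratio_sum ?b \<alpha> \<alpha>' \<gamma> \<gamma>' s m \<le> C2 * d" using d by (simp add: field_simps)
    then show ?thesis using rs(1) by (auto simp: d_def)
  qed
  \<comment> \<open>The summand 1 keeps the constant positive when \<open>C1\<close> or
    \<open>C2\<close> is 0.\<close>
  define C where "C = K * C1 powr ?e * C2 + 1"
  show ?thesis
  proof (intro exI[of _ C] conjI allI impI)
    show "C > 0" using K(1) C2(1) by (simp add: C_def add_nonneg_pos)
    fix s m :: nat and p :: "'b mod_ring poly" and q
    assume s: "1 \<le> s" and m: "1 \<le> m"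
      and pq: "Factorial_Ring.irreducible p \<and> Polynomial.degree p = m \<and> cbc_output \<alpha> \<gamma> m p s q"
    let ?B = "real ?b powr (- ?e * real m)"
    have "wce_sq \<alpha>' \<gamma>' m p s q \<le> K * weight_sum ?b \<alpha> lam \<gamma> s powr ?e * ?B * real_ratio_sum ?b \<alpha> \<alpha>' \<gamma> \<gamma>' s m"
      using K(2)[OF m] pq rs[OF s m] by blast
    also have "\<dots> \<le> K * (C1 * real s powr r) powr ?e * ?B * (C2 * (real s powr r' * real ?b powr (\<delta> * real m)))"
    proof -
      have "weight_sum ?b \<alpha> lam \<gamma> s powr ?e \<le> (C1 * real s powr r) powr ?e"
        using ws[OF s] e0 weight_sum_nonneg[OF b2 \<beta>] by (intro powr_mono2) auto
      then show ?thesis using K(1) C2(1) rs[OF s m]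
        by (intro mult_mono mult_nonneg_nonneg real_ratio_sum_nonneg[OF b2 \<alpha>' \<gamma>']) auto
    qed
    also have "\<dots> = K * C1 powr ?e * C2 * (real s powr (r * ?e) * real s powr r') *
        (real ?b powr (\<delta> * real m) * ?B)"
      using C1(1) by (simp add: powr_mult powr_powr mult_ac)
    also have "\<dots> = (K * C1 powr ?e * C2) * (real s powr (r * \<alpha>' / (\<alpha> * lam) + r') * real ?b powr (- (?e - \<delta>) * real m))"
      by (simp add: powr_add[symmetric] algebra_simps)
    also have "\<dots> \<le> C * (real s powr (r * \<alpha>' / (\<alpha> * lam) + r') * real ?b powr (- (?e - \<delta>) * real m))"
      by (intro mult_right_mono) (auto simp: C_def)
    finally show "wce_sq \<alpha>' \<gamma>' m p s q
        \<le> C * real s powr (r * \<alpha>' / (\<alpha> * lam) + r') * real ?b powr (- (?e - \<delta>) * real m)"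
      by (simp only: mult.assoc)
  qed
qed

section \<open>Product weights\<close>

lemma sum_nonempty_subsets_prod_le:
  fixes f :: "nat \<Rightarrow> real"
  assumes "\<And>j. j \<ge> 1 \<Longrightarrow> f j \<ge> 0"
  shows "(\<Sum>u\<in>nonempty_subsets s. \<Prod>j\<in>u. f j) \<le> (\<Prod>i<s. 1 + f (Suc i))"
proof -
  have "(\<Sum>u\<in>nonempty_subsets s. \<Prod>j\<in>u. f j) \<le> (\<Sum>u\<in>Pow {1..s}. \<Prod>j\<in>u. f j)"
    using assms by (intro sum_mono2 prod_nonneg) (auto simp: nonempty_subsets_def)
  also have "\<dots> = (\<Prod>j\<in>{1..s}. f j + 1)"
    by (subst prod_add) simp_all
  also have "\<dots> = (\<Prod>i<s. 1 + f (Suc i))"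
    by (simp add: prod.atLeast1_atMost_eq add.commute)
  finally show ?thesis .
qed

lemma sum_lessThan_le_suminf:
  fixes f :: "nat \<Rightarrow> real"
  assumes "summable f" "\<And>i. f i \<ge> 0"
  shows "(\<Sum>i<n. f i) \<le> suminf f"
  using assms by (intro sum_le_suminf) auto

text \<open>The product \<open>\<Prod>(1 + t f i)\<close> of a convergent series grows subexponentially in \<open>t\<close>: the factors
  \<open>i \<ge> J\<close> contribute at most \<open>exp (t \<epsilon>)\<close>, and each other one is at most
  \<open>(1 + 1 / \<eta>) exp (\<eta> t f i)\<close>.\<close>

lemma prod_subexponential:
  fixes f :: "nat \<Rightarrow> real" and \<epsilon> :: real
  assumes f: "summable f" "\<And>i. f i \<ge> 0" and \<epsilon>: "\<epsilon> > 0"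
  obtains C where "C > 0" "\<And>s t. t \<ge> 0 \<Longrightarrow> (\<Prod>i<s. 1 + t * f i) \<le> C * exp (\<epsilon> * t)"
proof -
  define F where "F = suminf f"
  have F: "F \<ge> 0" unfolding F_def using f by (intro suminf_nonneg)
  \<comment> \<open>The small multiple \<eta> of the whole series and the tail from \<open>J\<close>
    on each take at most half of \<epsilon>.\<close>
  define \<eta> where "\<eta> = \<epsilon> / (2 * (F + 1))"
  have \<eta>: "\<eta> > 0" using F \<epsilon> by (simp add: \<eta>_def)
  have \<eta>F: "\<eta> * F \<le> \<epsilon> / 2"
  proof -
    have "\<eta> * F \<le> \<eta> * (F + 1)" using \<eta> by simp
    also have "\<dots> = \<epsilon> / 2" using F by (simp add: \<eta>_def field_simps)
    finally show ?thesis .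
  qed
  obtain J where J: "\<And>s. (\<Sum>i\<in>{J..<s}. f i) \<le> \<epsilon> / 2"
  proof -
    have "\<exists>J. \<forall>m\<ge>J. \<forall>n. norm (sum f {m..<n}) < \<epsilon> / 2"
      using f(1) \<epsilon> unfolding summable_Cauchy by (metis half_gt_zero)
    then obtain J where J: "\<And>n. norm (sum f {J..<n}) < \<epsilon> / 2" by blast
    show thesis by (rule that[of J]) (use J in \<open>metis abs_ge_self less_imp_le order_trans real_norm_def\<close>)
  qed
  show thesis
  proof (rule that)
    show "(1 + 1 / \<eta>) ^ J > 0" using \<eta> by (simp add: add_pos_pos)
    fix s :: nat and t :: real assume t: "t \<ge> 0"
    define h where "h i = (if i < J then \<eta> * f i else f i)" for i
    define c where "c i = (if i < J then 1 + 1 / \<eta> else 1)" for i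
    have "(\<Prod>i<s. 1 + t * f i) \<le> (\<Prod>i<s. c i * exp (t * h i))"
    proof (intro prod_mono conjI)
      fix i
      show "0 \<le> 1 + t * f i" using t f(2) by (simp add: add_nonneg_nonneg)
      show "1 + t * f i \<le> c i * exp (t * h i)"
      proof (cases "i < J")
        case True
        have "\<eta> * (t * f i) \<le> exp (\<eta> * (t * f i))" "1 \<le> exp (\<eta> * (t * f i))"
          using exp_ge_add_one_self[of "\<eta> * (t * f i)"] \<eta> t f(2)[of i] by (linarith, simp)
        then have "1 + t * f i \<le> exp (\<eta> * (t * f i)) + exp (\<eta> * (t * f i)) / \<eta>"
          using \<eta> by (intro add_mono) (auto simp: field_simps)
        then show ?thesis using True by (simp add: c_def h_def distrib_right mult_ac)
      qed (simp add: c_def h_def exp_ge_add_one_self)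
    qed
    also have "\<dots> = (\<Prod>i<s. c i) * exp (t * (\<Sum>i<s. h i))"
      by (simp add: prod.distrib exp_sum[symmetric] sum_distrib_left)
    also have "\<dots> \<le> (1 + 1 / \<eta>) ^ J * exp (t * (\<Sum>i<s. h i))"
    proof (rule mult_right_mono)
      have "(\<Prod>i<s. c i) = (\<Prod>i\<in>{..<s} \<inter> {..<J}. 1 + 1 / \<eta>)"
        unfolding c_def by (subst prod.inter_restrict) (auto intro!: prod.cong)
      also have "\<dots> = (1 + 1 / \<eta>) ^ min s J"
      proof -
        have "{..<s} \<inter> {..<J} = {..<min s J}" by auto
        then show ?thesis by simp
      qed
      also have "\<dots> \<le> (1 + 1 / \<eta>) ^ J" using \<eta> by (intro power_increasing) auto
      finally show "(\<Prod>i<s. c i) \<le> (1 + 1 / \<eta>) ^ J" .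
    qed simp
    also have "\<dots> \<le> (1 + 1 / \<eta>) ^ J * exp (\<epsilon> * t)"
    proof -
      have "(\<Sum>i<s. h i) \<le> (\<Sum>i<s. \<eta> * f i + (if i \<in> {J..<s} then f i else 0))"
        using \<eta> f(2) by (intro sum_mono) (auto simp: h_def)
      also have "\<dots> = \<eta> * (\<Sum>i<s. f i) + (\<Sum>i\<in>{..<s} \<inter> {J..<s}. f i)"
        by (simp add: sum.distrib sum_distrib_left sum.inter_restrict)
      also have "{..<s} \<inter> {J..<s} = {J..<s}" by auto
      also have "\<eta> * (\<Sum>i<s. f i) + (\<Sum>i\<in>{J..<s}. f i) \<le> \<eta> * F + \<epsilon> / 2"
        using \<eta> J sum_lessThan_le_suminf[OF f] by (intro add_mono mult_left_mono) (auto simp: F_def)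
      finally have "(\<Sum>i<s. h i) \<le> \<epsilon>" using \<eta>F by linarith
      then have "t * (\<Sum>i<s. h i) \<le> t * \<epsilon>" using t by (rule mult_left_mono)
      then show ?thesis using \<eta> by (intro mult_left_mono) (auto simp: mult.commute)
    qed
    finally show "(\<Prod>i<s. 1 + t * f i) \<le> (1 + 1 / \<eta>) ^ J * exp (\<epsilon> * t)" .
  qed
qed

text \<open>Summing over subsets turns products into \<open>\<Prod>(1 + ...)\<close>. The weight sum
  stays below an exponential of a convergent series. In the ratio sum the exponent
  \<open>card u - 1\<close> of \<open>m + 1\<close> is raised to \<open>card u\<close>, so that the
  summand factorises with \<open>t = c * (m + 1)\<close>; subexponential growth in \<open>t\<close>
  then gives an arbitrarily small power of \<open>b ^ m\<close>.\<close>

lemma stability_product_weights: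
  fixes \<alpha> \<alpha>' lam \<delta> :: real
  assumes \<alpha>: "\<alpha> > 1/2" and \<alpha>': "\<alpha>' > 1/2" and \<gamma>: "weights \<gamma>" and \<gamma>': "weights \<gamma>'"
    and prod: "product_weights \<gamma> g" "product_weights \<gamma>' g'"
    and lam: "1 / (2 * \<alpha>) < lam" "lam \<le> 1"
    and sum: "(\<Sum>j. ennreal (g (Suc j) powr lam)) < \<infinity>"
    and sum': "(\<Sum>j. weight_ratio \<alpha> \<alpha>' (g (Suc j)) (g' (Suc j))) < \<infinity>" and \<delta>: "\<delta> > 0"
  shows "\<exists>C>0. \<forall>s\<ge>1. \<forall>m\<ge>1. \<forall>(p :: 'b::prime_card mod_ring poly) q.
    Factorial_Ring.irreducible p \<and> Polynomial.degree p = m \<and> cbc_output \<alpha> \<gamma> m p s q \<longrightarrow>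
      wce_sq \<alpha>' \<gamma>' m p s q \<le> C * real CARD('b) powr (- (\<alpha>' / (\<alpha> * lam) - \<delta>) * real m)"
proof -
  let ?b = "CARD('b)" and ?e = "\<alpha>' / (\<alpha> * lam)"
  note b2 = card_prime_card_ge_2[where 'b='b]
  have \<beta>: "\<alpha> * lam > 1/2" using lam(1) \<alpha> by (simp add: field_simps)
  then have "\<alpha> * lam > 0" by linarith
  then have e0: "?e > 0" using \<alpha>' by simp
  have g: "g (Suc j) \<ge> 0" "g' (Suc j) \<ge> 0" for j using prod by (auto simp: product_weights_def)
  obtain K where K: "K > 0"
    "\<And>m s (p :: 'b mod_ring poly) q. \<lbrakk>m \<ge> 1; Factorial_Ring.irreducible p; Polynomial.degree p = m;
       cbc_output \<alpha> \<gamma> m p s q; \<And>u. u \<in> nonempty_subsets s \<Longrightarrow> \<gamma> u = 0 \<Longrightarrow> \<gamma>' u = 0\<rbrakk> \<Longrightarrow>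
       wce_sq \<alpha>' \<gamma>' m p s q \<le> K * weight_sum ?b \<alpha> lam \<gamma> s powr ?e *
         real ?b powr (- ?e * real m) * real_ratio_sum ?b \<alpha> \<alpha>' \<gamma> \<gamma>' s m"
    using exists_stability_const[OF \<alpha> \<alpha>' lam, where 'b='b] \<gamma> \<gamma>' by metis
  define S where "S = walsh_sum ?b (\<alpha> * lam)"
  have S_eq: "(real ?b - 1) / (real ?b powr (2 * \<alpha> * lam) - real ?b) = S"
    by (simp only: S_def walsh_sum_def mult.assoc)
  have S: "S > 0" unfolding S_def by (rule walsh_sum_pos[OF b2 \<beta>])
  define c where "c = ratio_base ?b \<alpha>'"
  have c: "c > 0" unfolding c_def by (rule ratio_base_props(4)[OF b2 \<alpha>'])
  define \<rho> where "\<rho> j = g' j / g j powr (\<alpha>' / \<alpha>)" for j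
  have \<rho>: "\<rho> (Suc j) \<ge> 0" for j using g[of j] by (simp add: \<rho>_def)
  have wr: "weight_ratio \<alpha> \<alpha>' (g (Suc j)) (g' (Suc j)) < \<infinity>" for j
    by (rule ennreal_suminf_lessD[OF sum'])
  have zero: "g (Suc j) = 0 \<Longrightarrow> g' (Suc j) = 0" for j
    using wr[of j] g[of j] by (auto simp: weight_ratio_eq split: if_splits)
  have wr_eq: "weight_ratio \<alpha> \<alpha>' (g (Suc j)) (g' (Suc j)) = ennreal (\<rho> (Suc j))" for j
    using zero[of j] g[of j] by (simp add: weight_ratio_eq \<rho>_def)
  have sm_\<rho>: "summable (\<lambda>j. \<rho> (Suc j))"
    using sum' unfolding wr_eq by (intro summable_suminf_not_top \<rho>) simp
  have sm_g: "summable (\<lambda>j. g (Suc j) powr lam)"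
    using sum by (intro summable_suminf_not_top) simp_all
  have usub: "finite u" "\<And>j. j \<in> u \<Longrightarrow> \<exists>i. j = Suc i" "\<gamma> u = (\<Prod>j\<in>u. g j)" "\<gamma>' u = (\<Prod>j\<in>u. g' j)"
    if "u \<in> nonempty_subsets s" for u s
  proof -
    note u = nonempty_subsetsD[OF that]
    show "finite u" by (rule u(1))
    show "\<exists>i. j = Suc i" if "j \<in> u" for j using u(3) that by (cases j) auto
    show "\<gamma> u = (\<Prod>j\<in>u. g j)" "\<gamma>' u = (\<Prod>j\<in>u. g' j)" using prod u(4) by (auto simp: product_weights_def)
  qed
  have zero_u: "\<gamma>' u = 0" if "u \<in> nonempty_subsets s" "\<gamma> u = 0" for u s
    using usub[OF that(1)] that(2) zero by (metis prod_zero_iff)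
  define C1 where "C1 = exp (S * (\<Sum>j. g (Suc j) powr lam))"
  have ws: "weight_sum ?b \<alpha> lam \<gamma> s \<le> C1" for s
  proof -
    have "weight_sum ?b \<alpha> lam \<gamma> s = (\<Sum>u\<in>nonempty_subsets s. \<Prod>j\<in>u. g j powr lam * S)"
      unfolding weight_sum_def
    proof (rule sum.cong)
      fix u assume u: "u \<in> nonempty_subsets s"
      show "\<gamma> u powr lam * ((real ?b - 1) / (real ?b powr (2 * \<alpha> * lam) - real ?b)) ^ card u =
          (\<Prod>j\<in>u. g j powr lam * S)"
        unfolding S_eq usub(3)[OF u] by (simp add: prod_powr_distrib prod.distrib)
    qed simp
    also have "\<dots> \<le> (\<Prod>i<s. 1 + g (Suc i) powr lam * S)"
      using S by (intro sum_nonempty_subsets_prod_le) auto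
    also have "\<dots> \<le> (\<Prod>i<s. exp (g (Suc i) powr lam * S))"
      using S by (intro prod_mono) (auto simp: exp_ge_add_one_self add_nonneg_nonneg)
    also have "\<dots> = exp (S * (\<Sum>i<s. g (Suc i) powr lam))"
      by (simp add: exp_sum[symmetric] sum_distrib_left mult.commute)
    also have "\<dots> \<le> C1"
      unfolding C1_def using S by (simp add: sum_lessThan_le_suminf[OF sm_g])
    finally show ?thesis .
  qed
  \<comment> \<open>With this choice \<open>exp (\<epsilon> * t)\<close> at
    \<open>t = c * (m + 1)\<close> is \<open>b powr (\<delta> * (m + 1))\<close>; the extra
    \<open>b powr \<delta>\<close> goes into the constant.\<close>
  define \<epsilon> where "\<epsilon> = \<delta> * ln (real ?b) / c"
  have "\<epsilon> > 0" using \<delta> b2 c by (simp add: \<epsilon>_def)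
  then obtain C2 where C2: "C2 > 0"
    "\<And>s t. t \<ge> 0 \<Longrightarrow> (\<Prod>i<s. 1 + t * \<rho> (Suc i)) \<le> C2 * exp (\<epsilon> * t)"
    using prod_subexponential[OF sm_\<rho> \<rho>] by blast
  have rs: "real_ratio_sum ?b \<alpha> \<alpha>' \<gamma> \<gamma>' s m \<le> C2 * real ?b powr \<delta> * real ?b powr (\<delta> * real m)" for s m
  proof -
    let ?t = "c * real (m + 1)"
    have "real_ratio_sum ?b \<alpha> \<alpha>' \<gamma> \<gamma>' s m \<le> (\<Sum>u\<in>nonempty_subsets s. \<Prod>j\<in>u. ?t * \<rho> j)"
      unfolding real_ratio_sum_def
    proof (rule sum_mono)
      fix u assume u: "u \<in> nonempty_subsets s"
      have ratio: "\<gamma>' u / \<gamma> u powr (\<alpha>' / \<alpha>) = (\<Prod>j\<in>u. \<rho> j)"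
        by (simp add: usub(3,4)[OF u] \<rho>_def prod_powr_distrib prod_dividef)
      have "(\<Prod>j\<in>u. \<rho> j) \<ge> 0" using usub(2)[OF u] \<rho> by (intro prod_nonneg) fastforce
      moreover have "real (m + 1) ^ (card u - 1) \<le> real (m + 1) ^ card u" by (intro power_increasing) auto
      ultimately have "(\<Prod>j\<in>u. \<rho> j) * (c ^ card u * real (m + 1) ^ (card u - 1)) \<le>
          (\<Prod>j\<in>u. \<rho> j) * (c ^ card u * real (m + 1) ^ card u)"
        using c by (intro mult_left_mono) auto
      also have "\<dots> = (\<Prod>j\<in>u. ?t * \<rho> j)"
        by (simp add: prod.distrib power_mult_distrib mult.commute)
      finally show "\<gamma>' u / \<gamma> u powr (\<alpha>' / \<alpha>) * (ratio_base ?b \<alpha>' ^ card u * real (m + 1) ^ (card u - 1))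
          \<le> (\<Prod>j\<in>u. ?t * \<rho> j)" by (simp only: ratio c_def)
    qed
    also have "\<dots> \<le> (\<Prod>i<s. 1 + ?t * \<rho> (Suc i))"
    proof (rule sum_nonempty_subsets_prod_le)
      fix j :: nat assume "j \<ge> 1"
      then show "?t * \<rho> j \<ge> 0" using c \<rho>[of "j - 1"] by simp
    qed
    also have "\<dots> \<le> C2 * exp (\<epsilon> * ?t)" using c by (intro C2(2)) simp
    also have "\<epsilon> * ?t = (\<delta> + \<delta> * real m) * ln (real ?b)" using c by (simp add: \<epsilon>_def field_simps)
    also have "exp \<dots> = real ?b powr (\<delta> + \<delta> * real m)" using b2 by (simp add: powr_def)
    finally show ?thesis by (simp add: powr_add mult.assoc)
  qed
  define C where "C = K * C1 powr ?e * (C2 * real ?b powr \<delta>)"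
  show ?thesis
  proof (intro exI[of _ C] conjI allI impI)
    show "C > 0" using K(1) C2(1) b2 by (simp add: C_def C1_def)
    fix s m :: nat and p :: "'b mod_ring poly" and q
    assume s: "1 \<le> s" and m: "1 \<le> m"
      and pq: "Factorial_Ring.irreducible p \<and> Polynomial.degree p = m \<and> cbc_output \<alpha> \<gamma> m p s q"
    let ?B = "real ?b powr (- ?e * real m)"
    have "wce_sq \<alpha>' \<gamma>' m p s q \<le> K * weight_sum ?b \<alpha> lam \<gamma> s powr ?e * ?B * real_ratio_sum ?b \<alpha> \<alpha>' \<gamma> \<gamma>' s m"
      using K(2)[OF m] pq zero_u by blast
    also have "\<dots> \<le> K * C1 powr ?e * ?B * (C2 * real ?b powr \<delta> * real ?b powr (\<delta> * real m))"
    proof -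
      have "weight_sum ?b \<alpha> lam \<gamma> s powr ?e \<le> C1 powr ?e"
        using ws e0 weight_sum_nonneg[OF b2 \<beta>] by (intro powr_mono2) auto
      then show ?thesis using K(1) C2(1) rs
        by (intro mult_mono mult_nonneg_nonneg real_ratio_sum_nonneg[OF b2 \<alpha>' \<gamma>']) auto
    qed
    also have "\<dots> = C * (real ?b powr (\<delta> * real m) * ?B)" by (simp add: C_def mult_ac)
    also have "\<dots> = C * real ?b powr (- (?e - \<delta>) * real m)"
      by (simp add: powr_add[symmetric] algebra_simps)
    finally show "wce_sq \<alpha>' \<gamma>' m p s q \<le> C * real ?b powr (- (?e - \<delta>) * real m)" .
  qed
qed

theorem corollary3:
  fixes b :: nat and \<alpha> \<alpha>' :: real and \<gamma> \<gamma>' :: "nat set \<Rightarrow> real"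
  assumes "b = CARD('b::prime_card)"
    and "\<alpha> > 1/2" and "\<alpha>' > 1/2"
    and "weights \<gamma>" and "weights \<gamma>'"
  shows
    "(\<forall>lam \<delta> r r' :: real.
        1 / (2 * \<alpha>) < lam \<and> lam < 1 \<and> 0 < \<delta> \<and> \<delta> < \<alpha>' / (\<alpha> * lam) \<and> 0 \<le> r \<and> 0 \<le> r' \<and>
        (SUP s\<in>{1..}. ennreal (1 / real s powr r * weight_sum b \<alpha> lam \<gamma> s)) < \<infinity> \<and>
        (SUP (s, m)\<in>{1..} \<times> {1..}.
           ennreal (1 / (real s powr r' * real b powr (\<delta> * real m))) * ratio_sum b \<alpha> \<alpha>' \<gamma> \<gamma>' s m) < \<infinity>
        \<longrightarrow>
        (\<exists>C>0. \<forall>s\<ge>1. \<forall>m\<ge>1. \<forall>(p :: 'b mod_ring poly) q.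
           Factorial_Ring.irreducible p \<and> Polynomial.degree p = m \<and> cbc_output \<alpha> \<gamma> m p s q \<longrightarrow>
           wce_sq \<alpha>' \<gamma>' m p s q
             \<le> C * real s powr (r * \<alpha>' / (\<alpha> * lam) + r') * real b powr (- (\<alpha>' / (\<alpha> * lam) - \<delta>) * real m)))
     \<and>
     (\<forall>lam \<delta> :: real.
        1 / (2 * \<alpha>) < lam \<and> lam < 1 \<and> 0 < \<delta> \<and> \<delta> < \<alpha>' / (\<alpha> * lam) \<and>
        (SUP s\<in>{1..}. ennreal (weight_sum b \<alpha> lam \<gamma> s)) < \<infinity> \<and>
        (SUP (s, m)\<in>{1..} \<times> {1..}.
           ennreal (1 / real b powr (\<delta> * real m)) * ratio_sum b \<alpha> \<alpha>' \<gamma> \<gamma>' s m) < \<infinity>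
        \<longrightarrow>
        (\<exists>C>0. \<forall>s\<ge>1. \<forall>m\<ge>1. \<forall>(p :: 'b mod_ring poly) q.
           Factorial_Ring.irreducible p \<and> Polynomial.degree p = m \<and> cbc_output \<alpha> \<gamma> m p s q \<longrightarrow>
           wce_sq \<alpha>' \<gamma>' m p s q \<le> C * real b powr (- (\<alpha>' / (\<alpha> * lam) - \<delta>) * real m)))
     \<and>
     (\<forall>(g :: nat \<Rightarrow> real) g' (lam :: real).
        product_weights \<gamma> g \<and> product_weights \<gamma>' g' \<and>
        1 / (2 * \<alpha>) < lam \<and> lam \<le> 1 \<and>
        (\<Sum>j. ennreal (g (Suc j) powr lam)) < \<infinity> \<and>
        (\<Sum>j. weight_ratio \<alpha> \<alpha>' (g (Suc j)) (g' (Suc j))) < \<infinity>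
        \<longrightarrow>
        (\<forall>\<delta>>0. \<exists>C>0. \<forall>s\<ge>1. \<forall>m\<ge>1. \<forall>(p :: 'b mod_ring poly) q.
           Factorial_Ring.irreducible p \<and> Polynomial.degree p = m \<and> cbc_output \<alpha> \<gamma> m p s q \<longrightarrow>
           wce_sq \<alpha>' \<gamma>' m p s q \<le> C * real b powr (- (\<alpha>' / (\<alpha> * lam) - \<delta>) * real m)))"
proof (intro conjI allI impI)
  fix lam \<delta> r r' :: real
  assume "1 / (2 * \<alpha>) < lam \<and> lam < 1 \<and> 0 < \<delta> \<and> \<delta> < \<alpha>' / (\<alpha> * lam) \<and> 0 \<le> r \<and> 0 \<le> r' \<and>
    (SUP s\<in>{1..}. ennreal (1 / real s powr r * weight_sum b \<alpha> lam \<gamma> s)) < \<infinity> \<and>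
    (SUP (s, m)\<in>{1..} \<times> {1..}.
      ennreal (1 / (real s powr r' * real b powr (\<delta> * real m))) * ratio_sum b \<alpha> \<alpha>' \<gamma> \<gamma>' s m) < \<infinity>"
  then show "\<exists>C>0. \<forall>s\<ge>1. \<forall>m\<ge>1. \<forall>(p :: 'b mod_ring poly) q.
     Factorial_Ring.irreducible p \<and> Polynomial.degree p = m \<and> cbc_output \<alpha> \<gamma> m p s q \<longrightarrow>
     wce_sq \<alpha>' \<gamma>' m p s q
       \<le> C * real s powr (r * \<alpha>' / (\<alpha> * lam) + r') * real b powr (- (\<alpha>' / (\<alpha> * lam) - \<delta>) * real m)"
    unfolding assms(1) using assms(2-5) by (intro stability_general_weights) auto
next
  fix lam \<delta> :: real
  assume *: "1 / (2 * \<alpha>) < lam \<and> lam < 1 \<and> 0 < \<delta> \<and> \<delta> < \<alpha>' / (\<alpha> * lam) \<and>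
    (SUP s\<in>{1..}. ennreal (weight_sum b \<alpha> lam \<gamma> s)) < \<infinity> \<and>
    (SUP (s, m)\<in>{1..} \<times> {1..}.
      ennreal (1 / real b powr (\<delta> * real m)) * ratio_sum b \<alpha> \<alpha>' \<gamma> \<gamma>' s m) < \<infinity>"
  \<comment> \<open>This is the case of exponents 0. The powers of \<open>s\<close> disappear
    because \<open>s \<ge> 1\<close>; at 0 the value of \<open>powr\<close> would be 0 and not
    1.\<close>
  have "(SUP s\<in>{1..}. ennreal (1 / real s powr 0 * weight_sum b \<alpha> lam \<gamma> s)) =
      (SUP s\<in>{1..}. ennreal (weight_sum b \<alpha> lam \<gamma> s))"
    by (rule SUP_cong) auto
  moreover have "(SUP (s, m)\<in>{1..} \<times> {1..}.
      ennreal (1 / (real s powr 0 * real b powr (\<delta> * real m))) * ratio_sum b \<alpha> \<alpha>' \<gamma> \<gamma>' s m) =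
    (SUP (s, m)\<in>{1..} \<times> {1..}. ennreal (1 / real b powr (\<delta> * real m)) * ratio_sum b \<alpha> \<alpha>' \<gamma> \<gamma>' s m)"
    by (rule SUP_cong) auto
  ultimately have "\<exists>C>0. \<forall>s\<ge>1. \<forall>m\<ge>1. \<forall>(p :: 'b mod_ring poly) q.
     Factorial_Ring.irreducible p \<and> Polynomial.degree p = m \<and> cbc_output \<alpha> \<gamma> m p s q \<longrightarrow>
     wce_sq \<alpha>' \<gamma>' m p s q
       \<le> C * real s powr (0 * \<alpha>' / (\<alpha> * lam) + 0) * real b powr (- (\<alpha>' / (\<alpha> * lam) - \<delta>) * real m)"
    using * assms(2-5) unfolding assms(1) by (intro stability_general_weights) auto
  then obtain C where C: "C > 0" "\<And>s m (p :: 'b mod_ring poly) q. s \<ge> 1 \<Longrightarrow> m \<ge> 1 \<Longrightarrow>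
     Factorial_Ring.irreducible p \<and> Polynomial.degree p = m \<and> cbc_output \<alpha> \<gamma> m p s q \<Longrightarrow>
     wce_sq \<alpha>' \<gamma>' m p s q
       \<le> C * real s powr (0 * \<alpha>' / (\<alpha> * lam) + 0) * real b powr (- (\<alpha>' / (\<alpha> * lam) - \<delta>) * real m)"
    by blast
  show "\<exists>C>0. \<forall>s\<ge>1. \<forall>m\<ge>1. \<forall>(p :: 'b mod_ring poly) q.
     Factorial_Ring.irreducible p \<and> Polynomial.degree p = m \<and> cbc_output \<alpha> \<gamma> m p s q \<longrightarrow>
     wce_sq \<alpha>' \<gamma>' m p s q \<le> C * real b powr (- (\<alpha>' / (\<alpha> * lam) - \<delta>) * real m)"
  proof (intro exI[of _ C] conjI allI impI)
    fix s m :: nat and p :: "'b mod_ring poly" and q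
    assume "1 \<le> s" "1 \<le> m"
      "Factorial_Ring.irreducible p \<and> Polynomial.degree p = m \<and> cbc_output \<alpha> \<gamma> m p s q"
    from C(2)[OF this] show "wce_sq \<alpha>' \<gamma>' m p s q \<le> C * real b powr (- (\<alpha>' / (\<alpha> * lam) - \<delta>) * real m)"
      using \<open>1 \<le> s\<close> by simp
  qed (rule C(1))
next
  fix g g' :: "nat \<Rightarrow> real" and lam \<delta> :: real
  assume "product_weights \<gamma> g \<and> product_weights \<gamma>' g' \<and> 1 / (2 * \<alpha>) < lam \<and> lam \<le> 1 \<and>
    (\<Sum>j. ennreal (g (Suc j) powr lam)) < \<infinity> \<and>
    (\<Sum>j. weight_ratio \<alpha> \<alpha>' (g (Suc j)) (g' (Suc j))) < \<infinity>" and "\<delta> > 0"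
  then show "\<exists>C>0. \<forall>s\<ge>1. \<forall>m\<ge>1. \<forall>(p :: 'b mod_ring poly) q.
     Factorial_Ring.irreducible p \<and> Polynomial.degree p = m \<and> cbc_output \<alpha> \<gamma> m p s q \<longrightarrow>
     wce_sq \<alpha>' \<gamma>' m p s q \<le> C * real b powr (- (\<alpha>' / (\<alpha> * lam) - \<delta>) * real m)"
    unfolding assms(1) using assms(2-5) by (intro stability_product_weights) auto
qed

end
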